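(* Let $m\ge3$ be odd, $0\le i\le m-2$ and $e_i\in\mathbb{C}$. Let $K^i_{+,m}(\underline{x},\underline{y})=e_i\tilde f_m^i(s,t)+I\,e_i^c\,\hat f_m^i(s,t)+(\underline{x}\wedge\underline{y})\,e_i\,g_m^i(s,t)$ and $\mathcal{F}^i_{+,m}[f](\underline{y})=(2\pi)^{-m/2}\int_{\mathbb{R}^m}K^i_{+,m}(\underline{x},\underline{y})f(\underline{x})\,dV(\underline{x})$. Then for all $p,k\in\mathbb{N}$ and admissible $\ell$: If $i$ is even: for $k$ even, $\mathcal{F}^i_{+,m}[\psi_{2p,k,\ell}]=I\,e_i^c(-1)^{(m+1)/2}\frac{(k+i-1)!!}{(k-i+m-3)!!}(-1)^p\psi_{2p,k,\ell}$ and $\mathcal{F}^i_{+,m}[\psi_{2p+1,k,\ell}]=e_i\frac{(k+i-1)!!}{(k+m-i-3)!!}(-1)^p\psi_{2p+1,k,\ell}$; for $k$ odd, $\mathcal{F}^i_{+,m}[\psi_{2p,k,\ell}]=e_i\frac{(k+i)!!}{(k+m-i-2)!!}(-1)^{p+1}\psi_{2p,k,\ell}$ and $\mathcal{F}^i_{+,m}[\psi_{2p+1,k,\ell}]=I\,e_i^c(-1)^{(m+1)/2}\frac{(k+i)!!}{(k-i+m-2)!!}(-1)^p\psi_{2p+1,k,\ell}$. If $i$ is odd: for $k$ even, $\mathcal{F}^i_{+,m}[\psi_{2p,k,\ell}]=e_i\frac{(k+i)!!}{(k+m-i-2)!!}(-1)^{p+1}\psi_{2p,k,\ell}$ and $\mathcal{F}^i_{+,m}[\psi_{2p+1,k,\ell}]=I\,e_i^c(-1)^{(m+1)/2}\frac{(k+i)!!}{(k+m-i-2)!!}(-1)^{p+1}\psi_{2p+1,k,\ell}$;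 for $k$ odd, $\mathcal{F}^i_{+,m}[\psi_{2p,k,\ell}]=I\,e_i^c(-1)^{(m+1)/2}\frac{(k-1+i)!!}{(k+m-i-3)!!}(-1)^{p+1}\psi_{2p,k,\ell}$ and $\mathcal{F}^i_{+,m}[\psi_{2p+1,k,\ell}]=e_i\frac{(k+i-1)!!}{(k+m-i-3)!!}(-1)^p\psi_{2p+1,k,\ell}$.
   Context: $\mathcal{C}l_{0,m}$ is the real Clifford algebra generated by $e_1,\dots,e_m$ with $e_ie_j+e_je_i=-2\delta_{ij}$ (not to be confused with the complex constant $e_i$ above); values are in $\mathcal{C}l_{0,m}\otimes\mathbb{C}$, $I$ is the complex unit and $c$ complex conjugation. $\underline{x}=\sum_jx_je_j$, $\underline{x}\wedge\underline{y}=\sum_{j<k}e_je_k(x_jy_k-x_ky_j)$, $\partial_{\underline{x}}=\sum_je_j\partial_{x_j}$, $s=\langle\underline{x},\underline{y}\rangle$, $t=|\underline{x}\wedge\underline{y}|$, $\widetilde J_\alpha(t)=t^{-\alpha}J_\alpha(t)$. $\tilde f_m^i(s,t)=-\sum_{\ell=0}^{\lfloor (i-1)/2\rfloor}s^{i-1-2\ell}\frac{1}{2^\ell\ell!}\frac{\Gamma(i+1)}{\Gamma(i-2\ell)}\widetilde J_{(m-2\ell-3)/2}(t)$ for $i\ge1$, $\tilde f_m^0:=0$; $\hat f_m^i(s,t)=(-1)^{(m+1)/2+i}\sum_{\ell=0}^{\lfloor i/2\rfloor}s^{i-2\ell}\frac{1}{2^\ell\ell!}\frac{\Gamma(i+1)}{\Gamma(i+1-2\ell)}\widetilde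 J_{(m-2\ell-3)/2}(t)$; $g_m^i(s,t)=\sum_{\ell=0}^{\lfloor i/2\rfloor}s^{i-2\ell}\frac{1}{2^\ell\ell!}\frac{\Gamma(i+1)}{\Gamma(i+1-2\ell)}\widetilde J_{(m-2\ell-1)/2}(t)$. $\mathcal{M}_k$ is the space of spherical monogenics of degree $k$ (homogeneous $\mathcal{C}l_{0,m}$-valued polynomials $M$ of degree $k$ with $\partial_{\underline{x}}M=0$) with basis $M_k^{(\ell)}$; $\psi_{2p,k,\ell}(\underline{x})=L_p^{m/2+k-1}(|\underline{x}|^2)M_k^{(\ell)}(\underline{x})e^{-|\underline{x}|^2/2}$, $\psi_{2p+1,k,\ell}(\underline{x})=L_p^{m/2+k}(|\underline{x}|^2)\,\underline{x}\,M_k^{(\ell)}(\underline{x})e^{-|\underline{x}|^2/2}$. Double factorials: $u!!=u(u-2)\cdots$ down to $1$ or $2$, $0!!=(-1)!!=1$. *)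

theory Defs
  imports "HOL-Analysis.Analysis"
begin

text \<open>Elements of the complexified Clifford algebra Cl(0,m) tensor C, with generators
indexed by a finite linearly ordered type 'n (m = CARD('n)). A multivector is the
function assigning to each blade (a set A of generator indices, representing the
ordered product e_A) its complex coefficient.\<close>

type_synonym 'n clif = "'n set \<Rightarrow> complex"

definition clif_sign :: "'n::linorder set \<Rightarrow> 'n set \<Rightarrow> complex" where
  "clif_sign A B = (-1) ^ (card {(a,b). a \<in> A \<and> b \<in> B \<and> b < a} + card (A \<inter> B))"

text \<open>Clifford product: e_A e_B = sign(A,B) e_(A symmetric difference B), with e_j e_j = -1.\<close>
definition clif_mult :: "'n::{finite,linorder} clif \<Rightarrow> 'n clif \<Rightarrow> 'n clif" where
  "clif_mult a b = (\<lambda>C. \<Sum>A\<in>UNIV. \<Sum>B\<in>UNIV.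
      if (A - B) \<union> (B - A) = C then clif_sign A B * a A * b B else 0)"

definition clif_add :: "'n clif \<Rightarrow> 'n clif \<Rightarrow> 'n clif" where
  "clif_add a b = (\<lambda>A. a A + b A)"

definition clif_scal :: "complex \<Rightarrow> 'n clif \<Rightarrow> 'n clif" where
  "clif_scal c a = (\<lambda>A. c * a A)"

definition clif_one :: "'n clif" where
  "clif_one = (\<lambda>A. if A = {} then 1 else 0)"

definition clif_gen :: "'n \<Rightarrow> 'n clif" where
  "clif_gen j = (\<lambda>A. if A = {j} then 1 else 0)"

definition clif_vec :: "real^'n::_ \<Rightarrow> ('n::finite) clif" where
  "clif_vec x = (\<lambda>A. \<Sum>j\<in>UNIV. if A = {j} then complex_of_real (x $ j) else 0)"

definition clif_wedge :: "real^'n::_ \<Rightarrow> real^'n::_ \<Rightarrow> ('n::{finite,linorder}) clif" where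
  "clif_wedge x y = (\<lambda>A. \<Sum>j\<in>UNIV. \<Sum>k\<in>UNIV.
      if j < k \<and> A = {j,k} then complex_of_real (x$j * y$k - x$k * y$j) else 0)"

definition wedge_norm :: "real^'n::{finite,linorder} \<Rightarrow> real^'n::_ \<Rightarrow> real" where
  "wedge_norm x y = sqrt (\<Sum>j\<in>UNIV. \<Sum>k\<in>UNIV.
      if j < k then (x$j * y$k - x$k * y$j)^2 else (0::real))"

text \<open>Normalized Bessel function tilde J_alpha(t) = t^(-alpha) J_alpha(t), given by its
(entire) power series, so that it is also defined at t = 0.\<close>
definition Jt :: "real \<Rightarrow> real \<Rightarrow> real" where
  "Jt \<alpha> t = (\<Sum>n. (-1)^n / (fact n * Gamma (real n + \<alpha> + 1)) * (t/2)^(2*n)) / 2 powr \<alpha>"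

definition f_tilde :: "nat \<Rightarrow> nat \<Rightarrow> real \<Rightarrow> real \<Rightarrow> real" where
  "f_tilde m i s t = (if i = 0 then 0 else
     - (\<Sum>l=0..(i-1) div 2. s^(i-1-2*l) * (1 / (2^l * fact l))
          * (Gamma (real i + 1) / Gamma (real i - 2 * real l))
          * Jt ((real m - 2 * real l - 3) / 2) t))"

definition f_hat :: "nat \<Rightarrow> nat \<Rightarrow> real \<Rightarrow> real \<Rightarrow> real" where
  "f_hat m i s t = (-1) ^ ((m + 1) div 2 + i) *
     (\<Sum>l=0..i div 2. s^(i-2*l) * (1 / (2^l * fact l))
          * (Gamma (real i + 1) / Gamma (real i + 1 - 2 * real l))
          * Jt ((real m - 2 * real l - 3) / 2) t)"

definition g_fun :: "nat \<Rightarrow> nat \<Rightarrow> real \<Rightarrow> real \<Rightarrow> real" where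
  "g_fun m i s t =
     (\<Sum>l=0..i div 2. s^(i-2*l) * (1 / (2^l * fact l))
          * (Gamma (real i + 1) / Gamma (real i + 1 - 2 * real l))
          * Jt ((real m - 2 * real l - 1) / 2) t)"

definition kernel_plus :: "nat \<Rightarrow> complex \<Rightarrow> real^'n::_ \<Rightarrow> real^'n::_ \<Rightarrow> ('n::{finite,linorder}) clif" where
  "kernel_plus i ec x y =
     (let m = CARD('n); s = x \<bullet> y; t = wedge_norm x y in
      clif_add
        (clif_add (clif_scal (ec * complex_of_real (f_tilde m i s t)) clif_one)
                  (clif_scal (\<i> * cnj ec * complex_of_real (f_hat m i s t)) clif_one))
        (clif_scal (ec * complex_of_real (g_fun m i s t)) (clif_wedge x y)))"

definition fourier_plus :: "nat \<Rightarrow> complex \<Rightarrow> (real^'n::_ \<Rightarrow> 'n clif) \<Rightarrow> real^'n::_ \<Rightarrow> ('n::{finite,linorder}) clif" where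
  "fourier_plus i ec f y = (\<lambda>C. complex_of_real ((2 * pi) powr (- real CARD('n) / 2)) *
      (LINT x|lborel. clif_mult (kernel_plus i ec x y) (f x) C))"

definition clif_partial :: "'n::finite \<Rightarrow> (real^'n::_ \<Rightarrow> 'n clif) \<Rightarrow> real^'n::_ \<Rightarrow> 'n clif" where
  "clif_partial j M x = (\<lambda>A. vector_derivative (\<lambda>h::real. M (x + h *\<^sub>R axis j 1) A) (at 0))"

definition dirac :: "(real^'n::_ \<Rightarrow> 'n clif) \<Rightarrow> real^'n::_ \<Rightarrow> ('n::{finite,linorder}) clif" where
  "dirac M x = (\<lambda>C. \<Sum>j\<in>UNIV. clif_mult (clif_gen j) (clif_partial j M x) C)"

definition spherical_monogenic :: "nat \<Rightarrow> (real^'n::_ \<Rightarrow> ('n::{finite,linorder}) clif) \<Rightarrow> bool" where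
  "spherical_monogenic k M \<longleftrightarrow>
     (\<exists>c :: ('n \<Rightarrow> nat) \<Rightarrow> 'n set \<Rightarrow> real. \<forall>x A.
        M x A = complex_of_real (\<Sum>\<alpha>\<in>{\<alpha>. sum \<alpha> UNIV = k}. c \<alpha> A * (\<Prod>j\<in>UNIV. (x$j) ^ \<alpha> j)))
   \<and> (\<forall>x. dirac M x = (\<lambda>_. 0))"

definition laguerre :: "nat \<Rightarrow> real \<Rightarrow> real \<Rightarrow> real" where
  "laguerre p a x = (\<Sum>j=0..p. (-1)^j * ((real p + a) gchoose (p - j)) * x^j / fact j)"

definition psi_even :: "nat \<Rightarrow> nat \<Rightarrow> (real^'n::_ \<Rightarrow> 'n clif) \<Rightarrow> real^'n::_ \<Rightarrow> ('n::finite) clif" where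
  "psi_even p k M x = clif_scal (complex_of_real
      (laguerre p (real CARD('n) / 2 + real k - 1) ((norm x)^2) * exp (- ((norm x)^2) / 2))) (M x)"

definition psi_odd :: "nat \<Rightarrow> nat \<Rightarrow> (real^'n::_ \<Rightarrow> 'n clif) \<Rightarrow> real^'n::_ \<Rightarrow> ('n::{finite,linorder}) clif" where
  "psi_odd p k M x = clif_scal (complex_of_real
      (laguerre p (real CARD('n) / 2 + real k) ((norm x)^2) * exp (- ((norm x)^2) / 2)))
      (clif_mult (clif_vec x) (M x))"

definition fun_scal :: "complex \<Rightarrow> ('a \<Rightarrow> 'n clif) \<Rightarrow> 'a \<Rightarrow> 'n clif" where
  "fun_scal c f = (\<lambda>y. clif_scal c (f y))"

text \<open>Double factorial u!! for integers u \<ge> -1, with 0!! = (-1)!! = 1.\<close>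
definition dfact :: "int \<Rightarrow> real" where
  "dfact u = (\<Prod>j\<in>{0..<nat ((u + 1) div 2)}. real_of_int (u - 2 * int j))"

end

theory Submission
  imports Defs "HOL-Probability.Distributions"
begin

text \<open>
  Put $z = |x||y|$, so that $t^2 = z^2 - s^2$. Since differentiating $\tilde J_n(\sqrt{z^2-s^2})$
  in $s$ at fixed $z$ gives $s\,\tilde J_{n+1}(\sqrt{z^2-s^2})$, the sums over $\ell$ are
  $A_{N,i} = \partial_s^i \tilde J_{N-i}(\sqrt{z^2-s^2})$: with $\nu = (m-1)/2$ one has
  $\hat f = \pm A_{\nu-1,i}$, $g = A_{\nu,i}$ and $\tilde f - s g = -A_{\nu,i+1}$. As
  $(x \wedge y) a = -y(xa) - sa$, the kernel applied to a multivector only involves the scalar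
  functions $A_{N,i}$, and a monogenic $M$ as well as $xM$ has harmonic components. Expanding
  $A_{N,i}$ into terms $s^a z^{2b}$, everything reduces to the Gaussian moments of
  $s^a |x|^{2b} H(x)$ for harmonic $H$, which follow from integration by parts. The
  Chu--Vandermonde identity collapses the resulting double sum to an exponential series, which
  yields the case without Laguerre factor; by homogeneity a factor $|x|^{2j}$ multiplies the
  $q$-th term by $2^j$ times a Pochhammer symbol, and the Laguerre combination of these factors
  reproduces the Laguerre polynomial up to the sign $(-1)^p$.
\<close>

section \<open>Homogeneous polynomials\<close>

text \<open>Only polynomials are integrated against the Gaussian, so one-dimensional moments and
  integration by parts take the place of polar coordinates and of the Funk-Hecke theorem on the
  sphere. The price is a termwise integration of the kernel series. Its R-th term is used in two
  forms: the chain-rule form \<open>QL\<close>, whose partial sums stay below a polynomial in |s|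
  times exp t, which the Gaussian dominates because t <= |x||y|, and the binomial form
  \<open>QR\<close>, whose Gaussian integral is explicit. For odd m and i <= m - 2 all Bessel orders
  are natural numbers, so Gamma values become factorials. The integral of \<open>Aker N i\<close>
  against H vanishes unless i + deg H is even, so either the part with e_i or the part with its
  conjugate drops out. The conjugate part is an exponential series by itself; the two integrals with
  e_i are not so in general, and only their combination is. In the eigenvalue the numerator
  2^\<kappa> (1/2)_\<kappa> comes from the factorial (2r)! in \<open>QR\<close>, the denominator
  2^\<mu> \<mu>! from the first Bessel coefficient that survives.\<close>

definition monom_fun :: "('n::finite \<Rightarrow> nat) \<Rightarrow> real^'n \<Rightarrow> real" where
  "monom_fun \<alpha> x = (\<Prod>j\<in>UNIV. (x$j) ^ \<alpha> j)"

text \<open>Homogeneous complex polynomials are generated as functions, so that an identity additive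
  in the polynomial has to be checked on monomials only. Monomials with coefficient 0 put the zero
  function in every degree.\<close>

inductive hpoly :: "nat \<Rightarrow> (real^'n::finite \<Rightarrow> complex) \<Rightarrow> bool" for k where
  hpoly_monom: "sum \<alpha> UNIV = k \<Longrightarrow> hpoly k (\<lambda>x. c * of_real (monom_fun \<alpha> x))"
| hpoly_add: "hpoly k f \<Longrightarrow> hpoly k g \<Longrightarrow> hpoly k (\<lambda>x. f x + g x)"

text \<open>The body repeats that of \<open>clif_partial\<close> for a single coefficient, so that
  \<open>dirac\<close> unfolds to sums of \<open>pd\<close>.\<close>

definition pd :: "'n::finite \<Rightarrow> (real^'n \<Rightarrow> complex) \<Rightarrow> real^'n \<Rightarrow> complex" where
  "pd j f x = vector_derivative (\<lambda>h::real. f (x + h *\<^sub>R axis j 1)) (at 0)"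

lemma ex_sum_eq: "\<exists>\<alpha>::'n::finite \<Rightarrow> nat. sum \<alpha> UNIV = k"
  by (intro exI[of _ "\<lambda>j. if j = undefined then k else 0"]) simp

lemma hpoly_0: "hpoly k (\<lambda>x::real^'n::finite. 0)"
proof -
  obtain \<alpha> :: "'n \<Rightarrow> nat" where "sum \<alpha> UNIV = k" using ex_sum_eq by blast
  from hpoly_monom[OF this, of 0] show ?thesis by simp
qed

lemma hpoly_cmul: "hpoly k f \<Longrightarrow> hpoly k (\<lambda>x. c * f x)"
proof (induction rule: hpoly.induct)
  case (hpoly_monom \<alpha> d)
  from hpoly.hpoly_monom[OF hpoly_monom, of "c * d"] show ?case by (simp add: mult.assoc)
next
  case (hpoly_add f g)
  from hpoly.hpoly_add[OF hpoly_add.IH] show ?case by (simp add: distrib_left)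
qed

lemma hpoly_sum:
  assumes "finite I" "\<And>i. i \<in> I \<Longrightarrow> hpoly k (f i)"
  shows "hpoly k (\<lambda>x. \<Sum>i\<in>I. f i x)"
  using assms by (induction I rule: finite_induct) (auto intro: hpoly_0 hpoly_add)

lemma monom_fun_split: "monom_fun \<alpha> x = (x$j) ^ \<alpha> j * (\<Prod>i\<in>-{j}. (x$i) ^ \<alpha> i)"
  unfolding monom_fun_def by (subst prod.remove[of _ j]) (auto simp: Compl_eq_Diff_UNIV)

lemma monom_fun_mult: "monom_fun \<alpha> x * monom_fun \<beta> x = monom_fun (\<lambda>j. \<alpha> j + \<beta> j) x"
  by (simp add: monom_fun_def power_add prod.distrib)

lemma hpoly_mult:
  assumes "hpoly k f" "hpoly l g"
  shows "hpoly (k + l) (\<lambda>x. f x * g x)"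
  using assms
proof (induction rule: hpoly.induct)
  case (hpoly_monom \<alpha> c)
  from hpoly_monom(2) show ?case
  proof (induction rule: hpoly.induct)
    case (hpoly_monom \<beta> d)
    have "sum (\<lambda>j. \<alpha> j + \<beta> j) UNIV = k + l"
      using hpoly_monom \<open>sum \<alpha> UNIV = k\<close> by (simp add: sum.distrib)
    from hpoly.hpoly_monom[OF this, of "c * d"] show ?case
      by (simp add: monom_fun_mult[symmetric] mult_ac)
  next
    case (hpoly_add f g)
    from hpoly.hpoly_add[OF hpoly_add.IH] show ?case by (simp add: distrib_left)
  qed
next
  case (hpoly_add f g)
  from hpoly.hpoly_add[OF hpoly_add.IH(1)[OF hpoly_add.prems] hpoly_add.IH(2)[OF hpoly_add.prems]]
  show ?case by (simp add: distrib_right)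
qed

lemma hpoly_coord:
  fixes j :: "'n::finite"
  shows "hpoly 1 (\<lambda>x. of_real (x$j))"
proof -
  have "monom_fun (\<lambda>i. if i = j then 1 else 0) x = x$j" for x :: "real^'n"
    by (subst monom_fun_split[of _ _ j]) simp
  with hpoly_monom[of "\<lambda>i. if i = j then 1 else 0" 1 1] show ?thesis by simp
qed

lemma hpoly_const: "hpoly 0 (\<lambda>x. c)"
  using hpoly_monom[of "\<lambda>_. 0" 0 c] by (simp add: monom_fun_def)

lemma hpoly_coord_mult: "hpoly k f \<Longrightarrow> hpoly (Suc k) (\<lambda>x. of_real (x$j) * f x)"
  using hpoly_mult[OF hpoly_coord] by fastforce

lemma hpoly_power: "hpoly k f \<Longrightarrow> hpoly (n * k) (\<lambda>x. f x ^ n)"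
  by (induction n) (auto intro: hpoly_mult hpoly_const)

lemma inner_vec_sum: "x \<bullet> y = (\<Sum>j\<in>UNIV. x$j * y$j)" for x y :: "real^'n::finite"
  by (simp add: inner_vec_def)

lemma norm_sq_sum: "(norm x)\<^sup>2 = (\<Sum>j\<in>UNIV. x$j * x$j)" for x :: "real^'n::finite"
  unfolding inner_vec_sum[symmetric] by (simp add: power2_norm_eq_inner)

lemma hpoly_inner: "hpoly 1 (\<lambda>x. of_real (x \<bullet> y))"
proof -
  have "hpoly 1 (\<lambda>x. \<Sum>j\<in>UNIV. of_real (y$j) * of_real (x$j))"
    by (intro hpoly_sum hpoly_cmul hpoly_coord) simp
  then show ?thesis by (simp add: inner_vec_sum mult_ac)
qed

lemma hpoly_norm_sq: "hpoly 2 (\<lambda>x::real^'n::finite. of_real ((norm x)\<^sup>2))"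
proof -
  have "hpoly (1 + 1) (\<lambda>x. of_real (x$j) * of_real (x$j))" for j :: 'n
    by (intro hpoly_mult hpoly_coord)
  then have "hpoly 2 (\<lambda>x::real^'n. \<Sum>j\<in>UNIV. of_real (x$j) * of_real (x$j))"
    by (intro hpoly_sum) (simp_all add: numeral_2_eq_2)
  then show ?thesis by (simp add: norm_sq_sum)
qed

text \<open>The truncated exponent \<open>\<alpha> j - 1\<close> is harmless: for
  \<open>\<alpha> j = 0\<close> the factor \<open>\<alpha> j\<close> vanishes.\<close>

lemma monom_pd:
  fixes c :: complex
  shows "((\<lambda>h::real. c * of_real (monom_fun \<alpha> (x + h *\<^sub>R axis j 1))) has_vector_derivative
    c * of_nat (\<alpha> j) * of_real (monom_fun (\<alpha>(j := \<alpha> j - 1)) x)) (at 0)"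
proof -
  let ?r = "\<Prod>i\<in>-{j}. (x$i) ^ \<alpha> i"
  have eq: "monom_fun \<alpha> (x + h *\<^sub>R axis j 1) = (x$j + h) ^ \<alpha> j * ?r" for h
    by (subst monom_fun_split[of _ _ j]) (auto simp: axis_def intro!: prod.cong)
  have "((\<lambda>h::real. (x$j + h) ^ \<alpha> j * ?r) has_real_derivative
          of_nat (\<alpha> j) * (x$j) ^ (\<alpha> j - 1) * ?r) (at 0)"
    by (auto intro!: derivative_eq_intros)
  also have "of_nat (\<alpha> j) * (x$j) ^ (\<alpha> j - 1) * ?r = of_nat (\<alpha> j) * monom_fun (\<alpha>(j := \<alpha> j - 1)) x"
    by (subst monom_fun_split[of _ _ j]) (auto intro!: prod.cong)
  finally have "((\<lambda>h::real. monom_fun \<alpha> (x + h *\<^sub>R axis j 1)) has_vector_derivative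
       of_nat (\<alpha> j) * monom_fun (\<alpha>(j := \<alpha> j - 1)) x) (at 0)"
    by (simp only: eq has_real_derivative_iff_has_vector_derivative)
  from has_vector_derivative_mult_right[OF bounded_linear.has_vector_derivative[OF bounded_linear_of_real this], of c]
  show ?thesis by (simp add: mult_ac)
qed

lemma pd_monom: "pd j (\<lambda>x. c * of_real (monom_fun \<alpha> x)) =
   (\<lambda>x. c * of_nat (\<alpha> j) * of_real (monom_fun (\<alpha>(j := \<alpha> j - 1)) x))"
  unfolding pd_def using vector_derivative_at[OF monom_pd] by fastforce

lemma hpoly_has_pd:
  assumes "hpoly k f"
  shows "((\<lambda>h::real. f (x + h *\<^sub>R axis j 1)) has_vector_derivative pd j f x) (at 0)"
  using assms
proof (induction rule: hpoly.induct)
  case (hpoly_monom \<alpha> c)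
  show ?case unfolding pd_monom by (rule monom_pd)
next
  case (hpoly_add f g)
  from has_vector_derivative_add[OF hpoly_add.IH]
  show ?case unfolding pd_def[of j "\<lambda>x. f x + g x"] by (simp add: vector_derivative_at)
qed

lemma pd_eqI: "((\<lambda>h::real. f (x + h *\<^sub>R axis j 1)) has_vector_derivative d) (at 0) \<Longrightarrow> pd j f x = d"
  unfolding pd_def by (rule vector_derivative_at)

lemma pd_add: "hpoly k f \<Longrightarrow> hpoly l g \<Longrightarrow> pd j (\<lambda>x. f x + g x) = (\<lambda>x. pd j f x + pd j g x)"
  by (intro ext pd_eqI has_vector_derivative_add hpoly_has_pd)

lemma pd_cmul: "hpoly k f \<Longrightarrow> pd j (\<lambda>x. c * f x) = (\<lambda>x. c * pd j f x)"
  by (intro ext pd_eqI has_vector_derivative_mult_right hpoly_has_pd)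

lemma pd_mult: "hpoly k f \<Longrightarrow> hpoly l g \<Longrightarrow> pd j (\<lambda>x. f x * g x) = (\<lambda>x. f x * pd j g x + pd j f x * g x)"
  by (rule ext, rule pd_eqI, rule has_vector_derivative_eq_rhs,
      rule has_vector_derivative_mult[OF hpoly_has_pd hpoly_has_pd]) simp_all

lemma pd_sum:
  assumes "finite I" "\<And>i. i \<in> I \<Longrightarrow> hpoly k (f i)"
  shows "pd j (\<lambda>x. \<Sum>i\<in>I. f i x) = (\<lambda>x. \<Sum>i\<in>I. pd j (f i) x)"
  by (intro ext pd_eqI has_vector_derivative_sum hpoly_has_pd[OF assms(2)])

lemma pd_coord:
  fixes i j :: "'n::finite"
  shows "pd j (\<lambda>x. of_real (x$i)) = (\<lambda>x. if i = j then 1 else 0)"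
proof (intro ext pd_eqI)
  fix x :: "real^'n"
  have "((\<lambda>h::real. x$i + h * (if i = j then 1 else 0)) has_vector_derivative (if i = j then 1 else 0)) (at 0)"
    unfolding has_real_derivative_iff_has_vector_derivative[symmetric]
    by (auto intro!: derivative_eq_intros)
  from bounded_linear.has_vector_derivative[OF bounded_linear_of_real this]
  show "((\<lambda>h. complex_of_real ((x + h *\<^sub>R axis j 1) $ i)) has_vector_derivative (if i = j then 1 else 0)) (at 0)"
    by (simp add: axis_def of_real_def if_distrib cong: if_cong)
qed

lemma hpoly_pd:
  assumes "hpoly (Suc k) f"
  shows "hpoly k (pd j f)"
  using assms
proof (induction rule: hpoly.induct)
  case (hpoly_monom \<alpha> c)
  show ?case
  proof (cases "\<alpha> j = 0")
    case True
    then show ?thesis by (simp add: pd_monom hpoly_0)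
  next
    case False
    have "sum (\<alpha>(j := \<alpha> j - 1)) UNIV = k"
      using hpoly_monom False by (simp add: sum.remove[of UNIV j])
    from hpoly.hpoly_monom[OF this] show ?thesis by (simp add: pd_monom)
  qed
next
  case (hpoly_add f g)
  then show ?case by (simp add: pd_add hpoly.hpoly_add)
qed

lemma pd_hpoly0:
  assumes "hpoly 0 f"
  shows "pd j f = (\<lambda>x. 0)"
  using assms
proof (induction rule: hpoly.induct)
  case (hpoly_monom \<alpha> c)
  then show ?case by (simp add: pd_monom)
next
  case (hpoly_add f g)
  then show ?case by (simp add: pd_add)
qed

text \<open>In degree 0 the derivative is the zero function, which belongs to every degree, so the
  truncated \<open>k - 1\<close> is right there too.\<close>

lemma hpoly_pd_pred: "hpoly k f \<Longrightarrow> hpoly (k - 1) (pd j f)"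
  by (cases k) (auto intro: hpoly_pd simp: pd_hpoly0 hpoly_0)

lemma pd_commute:
  assumes "hpoly k f"
  shows "pd i (pd j f) = pd j (pd i f)"
  using assms
proof (induction rule: hpoly.induct)
  case (hpoly_monom \<alpha> c)
  show ?case unfolding pd_monom by (cases "i = j") (auto simp: fun_upd_twist mult_ac)
next
  case (hpoly_add f g)
  then show ?case by (simp add: pd_add[OF hpoly_pd_pred hpoly_pd_pred] pd_add)
qed

lemma euler_monom:
  assumes "sum \<alpha> UNIV = k"
  shows "(\<Sum>j\<in>UNIV. x$j * (of_nat (\<alpha> j) * monom_fun (\<alpha>(j := \<alpha> j - 1)) x)) = of_nat k * monom_fun \<alpha> x"
proof -
  have "x$j * (of_nat (\<alpha> j) * monom_fun (\<alpha>(j := \<alpha> j - 1)) x) = of_nat (\<alpha> j) * monom_fun \<alpha> x" for j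
  proof (cases "\<alpha> j = 0")
    case False
    have "(\<Prod>i\<in>-{j}. (x$i) ^ (\<alpha>(j := \<alpha> j - 1)) i) = (\<Prod>i\<in>-{j}. (x$i) ^ \<alpha> i)"
      by (rule prod.cong) auto
    then have "monom_fun (\<alpha>(j := \<alpha> j - 1)) x = x$j ^ (\<alpha> j - 1) * (\<Prod>i\<in>-{j}. (x$i) ^ \<alpha> i)"
      by (subst monom_fun_split[of _ _ j]) simp
    moreover have "x$j ^ \<alpha> j = x$j * x$j ^ (\<alpha> j - 1)" using False by (cases "\<alpha> j") auto
    ultimately show ?thesis by (simp add: monom_fun_split[of \<alpha> x j])
  qed simp
  then have "(\<Sum>j\<in>UNIV. x$j * (of_nat (\<alpha> j) * monom_fun (\<alpha>(j := \<alpha> j - 1)) x)) = (\<Sum>j\<in>UNIV. of_nat (\<alpha> j) * monom_fun \<alpha> x)"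
    by (intro sum.cong) auto
  also have "\<dots> = of_nat (sum \<alpha> UNIV) * monom_fun \<alpha> x"
    by (simp add: sum_distrib_right)
  finally show ?thesis using assms by simp
qed

lemma euler_hpoly:
  assumes "hpoly k f"
  shows "(\<Sum>j\<in>UNIV. of_real (x$j) * pd j f x) = of_nat k * f x"
  using assms
proof (induction rule: hpoly.induct)
  case (hpoly_monom \<alpha> c)
  have "(\<Sum>j\<in>UNIV. of_real (x$j) * pd j (\<lambda>x. c * of_real (monom_fun \<alpha> x)) x) =
    c * of_real (\<Sum>j\<in>UNIV. x$j * (of_nat (\<alpha> j) * monom_fun (\<alpha>(j := \<alpha> j - 1)) x))"
    by (simp add: pd_monom sum_distrib_left mult_ac)
  also have "\<dots> = of_nat k * (c * of_real (monom_fun \<alpha> x))"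
    unfolding euler_monom[OF hpoly_monom] by simp
  finally show ?case .
next
  case (hpoly_add f g)
  then show ?case by (simp add: pd_add distrib_left sum.distrib)
qed

section \<open>Gaussian integrals\<close>

text \<open>Fubini for products of one-variable functions. \<open>lborel\<close> on
  \<open>real^'n\<close> is the image of a product measure indexed by \<open>Basis\<close>, so the
  index is carried from \<open>'n\<close> to \<open>Basis\<close> along \<open>ax\<close> and
  back.\<close>

lemma has_integral_prod_vec:
  fixes f :: "'n::finite \<Rightarrow> real \<Rightarrow> real"
  assumes int: "\<And>j. integrable lborel (f j)"
  shows "has_bochner_integral lborel (\<lambda>x::real^'n. \<Prod>j\<in>UNIV. f j (x$j)) (\<Prod>j\<in>UNIV. integral\<^sup>L lborel (f j))"
proof -
  define ax :: "'n \<Rightarrow> real^'n" where "ax = (\<lambda>i. axis i 1)"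
  have inj: "inj ax" unfolding ax_def inj_def by (auto simp: axis_eq_axis)
  have B: "(Basis :: (real^'n) set) = range ax"
    by (auto simp: Basis_vec_def ax_def)
  define g where "g = (\<lambda>b. f (inv ax b))"
  have g_ax: "g (ax j) = f j" for j by (simp add: g_def inj)
  have fm: "f j \<in> borel_measurable borel" for j
    using borel_measurable_integrable[OF int[of j]] by simp
  interpret product_sigma_finite "\<lambda>b::real^'n. lborel :: real measure" ..
  have gint: "integrable lborel (g b)" if "b \<in> Basis" for b
    using that int by (auto simp: B g_ax)
  let ?P = "\<Pi>\<^sub>M b\<in>(Basis::(real^'n) set). (lborel :: real measure)"
  let ?T = "\<lambda>h. \<Sum>b\<in>(Basis::(real^'n) set). h b *\<^sub>R b"
  have eq: "(\<Prod>j\<in>UNIV. f j (x$j)) = (\<Prod>b\<in>Basis. g b (x \<bullet> b))" for x :: "real^'n"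
  proof -
    have "x \<bullet> ax j = x $ j" for j by (simp add: ax_def inner_axis)
    then show ?thesis unfolding B by (subst prod.reindex[OF inj]) (simp add: g_ax)
  qed
  have eq2: "(\<Prod>b\<in>Basis. g b (?T h \<bullet> b)) = (\<Prod>b\<in>Basis. g b (h b))" for h
    by (intro prod.cong refl) simp
  have eq3: "(\<Prod>j\<in>UNIV. f j (?T h $ j)) = (\<Prod>b\<in>Basis. g b (h b))" for h
    unfolding eq eq2 ..
  have meas: "(\<lambda>x::real^'n. \<Prod>j\<in>UNIV. f j (x$j)) \<in> borel_measurable borel"
  proof (intro borel_measurable_prod)
    fix j :: 'n
    have "(\<lambda>x::real^'n. x$j) \<in> borel_measurable borel"
      by (intro borel_measurable_continuous_onI continuous_intros)
    then show "(\<lambda>x::real^'n. f j (x$j)) \<in> borel_measurable borel"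
      using fm[of j] by (rule measurable_compose)
  qed
  have T: "?T \<in> measurable ?P borel" by simp
  have "integrable ?P (\<lambda>h. \<Prod>b\<in>Basis. g b (h b))"
    by (rule product_integrable_prod) (auto intro: gint)
  then have 1: "integrable lborel (\<lambda>x::real^'n. \<Prod>j\<in>UNIV. f j (x$j))"
    by (subst lborel_eq, subst integrable_distr_eq[OF T meas]) (simp only: eq3)
  have "integral\<^sup>L lborel (\<lambda>x::real^'n. \<Prod>j\<in>UNIV. f j (x$j)) = (LINT h|?P. (\<Prod>b\<in>Basis. g b (h b)))"
    by (subst lborel_eq, subst integral_distr[OF T meas]) (simp only: eq3)
  also have "\<dots> = (\<Prod>b\<in>Basis. integral\<^sup>L lborel (g b))"
    by (rule product_integral_prod) (auto intro: gint)
  also have "\<dots> = (\<Prod>j\<in>UNIV. integral\<^sup>L lborel (f j))"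
    unfolding B by (subst prod.reindex[OF inj]) (simp add: g_ax)
  finally show ?thesis using 1 by (simp add: has_bochner_integral_iff)
qed

definition gmom :: "nat \<Rightarrow> real" where
  "gmom a = (LINT x|lborel. exp (- x\<^sup>2 / 2) * x ^ a)"

lemma gmom_has: 
  "has_bochner_integral lborel (\<lambda>x::real. exp (- x\<^sup>2 / 2) * x ^ (2*k)) (sqrt (2*pi) * (fact (2*k) / (2^k * fact k)))"
  "has_bochner_integral lborel (\<lambda>x::real. exp (- x\<^sup>2 / 2) * x ^ (2*k+1)) 0"
  using has_bochner_integral_mult_right[OF std_normal_moment_even[of k], of "sqrt (2*pi)"]
    has_bochner_integral_mult_right[OF std_normal_moment_odd[of k], of "sqrt (2*pi)"]
  by (simp_all add: normal_density_def)

lemma gmom_integrable: "integrable lborel (\<lambda>x::real. exp (- x\<^sup>2 / 2) * x ^ a)"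
  using gmom_has[of "a div 2"] by (cases "even a") (auto simp: has_bochner_integral_iff elim!: evenE oddE)

lemma gmom_even: "gmom (2*k) = sqrt (2*pi) * (fact (2*k) / (2^k * fact k))"
  and gmom_odd: "gmom (2*k+1) = 0"
  using gmom_has[of k] by (auto simp: has_bochner_integral_iff gmom_def)

text \<open>One-dimensional integration by parts against the Gaussian, read off from the closed
  forms of the moments, which avoids boundary terms.\<close>

lemma gmom_Suc: "gmom (Suc a) = of_nat a * gmom (a - 1)"
proof (cases "even a")
  case True
  then obtain k where k: "a = 2 * k" by auto
  show ?thesis
  proof (cases k)
    case 0 then show ?thesis using gmom_odd[of 0] k by simp
  next
    case (Suc l)
    then have "a - 1 = 2 * l + 1" using k by simp
    then show ?thesis using gmom_odd[of k] gmom_odd[of l] k by simp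
  qed
next
  case False
  then obtain k where k: "a = 2 * k + 1" by (auto elim: oddE)
  have "gmom (2 * Suc k) = of_nat (2*k+1) * gmom (2*k)"
  proof -
    have "fact (2 * Suc k) = (2 * (real k + 1)) * ((2 * real k + 1) * fact (2*k))"
      by (simp add: algebra_simps)
    moreover have "2 ^ Suc k * fact (Suc k) = (2 * (real k + 1)) * (2 ^ k * fact k)"
      by (simp add: algebra_simps)
    ultimately have "fact (2 * Suc k) / (2 ^ Suc k * fact (Suc k)) = (2 * real k + 1) * fact (2*k) / (2 ^ k * fact k)"
      by (simp only:) (subst mult_divide_mult_cancel_left, simp_all)
    then show ?thesis unfolding gmom_even by (simp add: mult_ac)
  qed
  then show ?thesis using k by simp
qed

lemma exp_norm_sq: "exp (- (norm x)\<^sup>2 / 2) = (\<Prod>j\<in>UNIV. exp (- (x$j)\<^sup>2 / 2))" for x :: "real^'n::finite"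
proof -
  have "- (norm x)\<^sup>2 / 2 = (\<Sum>j\<in>UNIV. - (x$j)\<^sup>2 / 2)"
    by (subst norm_sq_sum) (simp add: power2_eq_square sum_negf sum_divide_distrib)
  then show ?thesis by (simp add: exp_sum)
qed

text \<open>The weight is left unnormalised; the total mass is carried along as the factor
  \<open>gint (\<lambda>_. 1)\<close> until it cancels the prefactor of the transform in
  \<open>gauss_const\<close>.\<close>

definition gint :: "(real^'n::finite \<Rightarrow> complex) \<Rightarrow> complex" where
  "gint f = (LINT x|lborel. of_real (exp (- (norm x)\<^sup>2 / 2)) * f x)"

definition gintegrable :: "(real^'n::finite \<Rightarrow> complex) \<Rightarrow> bool" where
  "gintegrable f \<longleftrightarrow> integrable lborel (\<lambda>x. of_real (exp (- (norm x)\<^sup>2 / 2)) * f x)"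

lemma gint_monom_real:
  "has_bochner_integral lborel (\<lambda>x::real^'n::finite. exp (- (norm x)\<^sup>2 / 2) * monom_fun \<alpha> x) (\<Prod>j\<in>UNIV. gmom (\<alpha> j))"
  using has_integral_prod_vec[OF gmom_integrable, of \<alpha>]
  by (simp only: exp_norm_sq monom_fun_def prod.distrib gmom_def)

lemma gint_monom:
  "gintegrable (\<lambda>x::real^'n::finite. c * of_real (monom_fun \<alpha> x))"
  "gint (\<lambda>x::real^'n::finite. c * of_real (monom_fun \<alpha> x)) = c * of_real (\<Prod>j\<in>UNIV. gmom (\<alpha> j))"
  using has_bochner_integral_mult_right[OF has_bochner_integral_of_real[OF gint_monom_real[of \<alpha>]], of c]
  by (auto simp: gint_def gintegrable_def has_bochner_integral_iff mult_ac)

lemma gintegrable_add: "gintegrable f \<Longrightarrow> gintegrable g \<Longrightarrow> gintegrable (\<lambda>x. f x + g x)"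
  by (simp add: gintegrable_def distrib_left)

lemma gint_add: "gintegrable f \<Longrightarrow> gintegrable g \<Longrightarrow> gint (\<lambda>x. f x + g x) = gint f + gint g"
  by (simp add: gintegrable_def gint_def distrib_left)

lemma gintegrable_cmul: "gintegrable f \<Longrightarrow> gintegrable (\<lambda>x. c * f x)"
  by (simp add: gintegrable_def mult.left_commute)

lemma gint_cmul: "gint (\<lambda>x. c * f x) = c * gint f"
  by (simp add: gint_def mult.left_commute)

lemma gint_sum:
  assumes "\<And>i. i \<in> I \<Longrightarrow> gintegrable (f i)"
  shows "gint (\<lambda>x. \<Sum>i\<in>I. f i x) = (\<Sum>i\<in>I. gint (f i))"
  using assms unfolding gint_def gintegrable_def sum_distrib_left by (rule Bochner_Integration.integral_sum)

lemma gintegrable_sum: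
  assumes "\<And>i. i \<in> I \<Longrightarrow> gintegrable (f i)"
  shows "gintegrable (\<lambda>x. \<Sum>i\<in>I. f i x)"
  using assms unfolding gintegrable_def sum_distrib_left by (rule Bochner_Integration.integrable_sum)

lemma hpoly_gintegrable: "hpoly k f \<Longrightarrow> gintegrable f"
  by (induction rule: hpoly.induct) (auto intro: gint_monom gintegrable_add)

lemma gint_0 [simp]: "gint (\<lambda>x. 0) = 0"
  by (simp add: gint_def)

lemma gint_1: "gint (\<lambda>x::real^'n::finite. 1) = of_real (sqrt (2*pi) ^ CARD('n))"
proof -
  have "gint (\<lambda>x::real^'n. 1) = of_real (\<Prod>j\<in>(UNIV::'n set). gmom 0)"
    using gint_monom(2)[of 1 "\<lambda>_. 0"] by (simp add: monom_fun_def)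
  also have "gmom 0 = sqrt (2*pi)" using gmom_even[of 0] by simp
  finally show ?thesis by simp
qed

text \<open>On a monomial only the j-th factor of the product of moments changes, and there the
  claim is \<open>gmom_Suc\<close>.\<close>

lemma gint_by_parts:
  assumes "hpoly k f"
  shows "gint (\<lambda>x. of_real (x$j) * f x) = gint (pd j f)"
  using assms
proof (induction rule: hpoly.induct)
  case (hpoly_monom \<alpha> c)
  have eq: "x$j * monom_fun \<alpha> x = monom_fun (\<alpha>(j := Suc (\<alpha> j))) x" for x
    by (subst (1 2) monom_fun_split[of _ _ j]) (auto intro!: prod.cong)
  have split: "(\<Prod>i\<in>UNIV. gmom (\<beta> i)) = gmom (\<beta> j) * (\<Prod>i\<in>-{j}. gmom (\<beta> i))" for \<beta>
    by (subst prod.remove[of _ j]) (auto simp: Compl_eq_Diff_UNIV)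
  have P: "(\<Prod>i\<in>-{j}. gmom ((\<alpha>(j := a)) i)) = (\<Prod>i\<in>-{j}. gmom (\<alpha> i))" for a
    by (rule prod.cong) auto
  have "(\<lambda>x. of_real (x$j) * (c * of_real (monom_fun \<alpha> x))) =
        (\<lambda>x. c * complex_of_real (monom_fun (\<alpha>(j := Suc (\<alpha> j))) x))"
    by (auto simp: eq[symmetric] mult_ac)
  then show ?case
    unfolding pd_monom by (simp add: gint_monom split P gmom_Suc del: fun_upd_apply)
       (simp add: gmom_Suc)
next
  case (hpoly_add f g)
  have "gint (\<lambda>x. of_real (x$j) * (f x + g x)) = gint (\<lambda>x. of_real (x$j) * f x) + gint (\<lambda>x. of_real (x$j) * g x)"
    using hpoly_add.hyps by (simp add: distrib_left gint_add hpoly_gintegrable[OF hpoly_coord_mult])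
  also have "\<dots> = gint (pd j (\<lambda>x. f x + g x))"
    using hpoly_add by (simp add: pd_add gint_add hpoly_gintegrable[OF hpoly_pd_pred])
  finally show ?case .
qed

section \<open>Functions of at most exponential growth, and termwise Gaussian integration of
  series\<close>

definition expbd :: "(real^'n::finite \<Rightarrow> complex) \<Rightarrow> bool" where
  "expbd f \<longleftrightarrow> (\<exists>C c. 0 \<le> C \<and> 0 \<le> c \<and> (\<forall>x. norm (f x) \<le> C * exp (c * norm x)))"

lemma expbdI: "0 \<le> C \<Longrightarrow> 0 \<le> c \<Longrightarrow> (\<And>x. norm (f x) \<le> C * exp (c * norm x)) \<Longrightarrow> expbd f"
  unfolding expbd_def by blast

lemma expbd_mult:
  fixes f g :: "real^'n::finite \<Rightarrow> complex"
  assumes "expbd f" "expbd g"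
  shows "expbd (\<lambda>x. f x * g x)"
proof -
  from assms obtain C c D d where *: "0 \<le> C" "0 \<le> c" "\<And>x. norm (f x) \<le> C * exp (c * norm x)"
    "0 \<le> D" "0 \<le> d" "\<And>x. norm (g x) \<le> D * exp (d * norm x)" unfolding expbd_def by blast
  show ?thesis
  proof (rule expbdI)
    fix x :: "real^'n"
    have "norm (f x * g x) \<le> (C * exp (c * norm x)) * (D * exp (d * norm x))"
      unfolding norm_mult by (intro mult_mono *) (auto intro: * mult_nonneg_nonneg)
    then show "norm (f x * g x) \<le> (C * D) * exp ((c + d) * norm x)"
      by (simp only: exp_add distrib_right) (simp only: mult_ac)
  qed (use * in auto)
qed

lemma expbd_add:
  fixes f g :: "real^'n::finite \<Rightarrow> complex"
  assumes "expbd f" "expbd g"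
  shows "expbd (\<lambda>x. f x + g x)"
proof -
  from assms obtain C c D d where *: "0 \<le> C" "0 \<le> c" "\<And>x. norm (f x) \<le> C * exp (c * norm x)"
    "0 \<le> D" "0 \<le> d" "\<And>x. norm (g x) \<le> D * exp (d * norm x)" unfolding expbd_def by blast
  show ?thesis
  proof (rule expbdI)
    fix x :: "real^'n"
    have "C * exp (c * norm x) \<le> C * exp ((c + d) * norm x)" "D * exp (d * norm x) \<le> D * exp ((c + d) * norm x)"
      using * by (auto intro!: mult_left_mono mult_right_mono)
    with *(3)[of x] *(6)[of x] norm_triangle_ineq[of "f x" "g x"]
    show "norm (f x + g x) \<le> (C + D) * exp ((c + d) * norm x)"
      by (simp add: distrib_right)
  qed (use * in auto)
qed

lemma expbd_const: "expbd (\<lambda>x. c)"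
  by (rule expbdI[of "norm c" 0]) auto

lemma expbd_sum: "(\<And>i. i \<in> I \<Longrightarrow> expbd (f i)) \<Longrightarrow> expbd (\<lambda>x. \<Sum>i\<in>I. f i x)"
  by (induction I rule: infinite_finite_induct) (auto intro: expbd_const expbd_add)

lemma expbd_power: "expbd f \<Longrightarrow> expbd (\<lambda>x. f x ^ n)"
  by (induction n) (auto intro: expbd_const expbd_mult)

lemma expbd_prod: "(\<And>i. i \<in> I \<Longrightarrow> expbd (f i)) \<Longrightarrow> expbd (\<lambda>x. \<Prod>i\<in>I. f i x)"
  by (induction I rule: infinite_finite_induct) (auto intro: expbd_const expbd_mult)

lemma expbd_coord: 
  fixes j :: "'n::finite"
  shows "expbd (\<lambda>x. of_real (x$j))"
proof (rule expbdI[of 1 1])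
  fix x :: "real^'n"
  have "\<bar>x$j\<bar> \<le> norm x" by (rule component_le_norm_cart)
  also have "\<dots> \<le> exp (norm x)" using exp_ge_add_one_self[of "norm x"] by linarith
  finally show "norm (complex_of_real (x$j)) \<le> 1 * exp (1 * norm x)" by simp
qed auto

lemma hpoly_expbd: "hpoly k f \<Longrightarrow> expbd f"
  by (induction rule: hpoly.induct)
    (auto simp: monom_fun_def intro!: expbd_add expbd_mult expbd_const expbd_prod expbd_power expbd_coord)

lemma expbd_mono: "expbd g \<Longrightarrow> (\<And>x. norm (f x) \<le> norm (g x)) \<Longrightarrow> expbd f"
  unfolding expbd_def by (meson order_trans)

lemma integrable_exp_quarter: "integrable lborel (\<lambda>x::real^'n::finite. exp (- (norm x)\<^sup>2 / 4))"
proof -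
  have "integrable lborel (\<lambda>x. normal_density 0 (sqrt 2) x)" by simp
  then have "integrable lborel (\<lambda>x. sqrt (4 * pi) * normal_density 0 (sqrt 2) x)" by simp
  moreover have "(\<lambda>x. sqrt (4 * pi) * normal_density 0 (sqrt 2) x) = (\<lambda>x::real. exp (- x\<^sup>2 / 4))"
    by (simp add: normal_density_def fun_eq_iff)
  ultimately have "integrable lborel (\<lambda>x::real. exp (- x\<^sup>2 / 4))"
    by (simp only:)
  from has_integral_prod_vec[of "\<lambda>_::'n. \<lambda>x. exp (- x\<^sup>2 / 4)", OF this]
  have "integrable lborel (\<lambda>x::real^'n. \<Prod>j\<in>UNIV. exp (- (x$j)\<^sup>2 / 4))"
    by (simp add: has_bochner_integral_iff)
  moreover have "(\<lambda>x. \<Prod>j\<in>UNIV. exp (- (x$j)\<^sup>2 / 4)) = (\<lambda>x::real^'n. exp (- (norm x)\<^sup>2 / 4))"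
    by (rule ext, subst norm_sq_sum) (simp add: exp_sum[symmetric] power2_eq_square sum_negf sum_divide_distrib)
  ultimately show ?thesis by (simp only:)
qed

text \<open>From (c - r/2)^2 >= 0 with r = |x|: half of the Gaussian exponent absorbs the
  exponential growth, and exp (-r^2/4) remains as an integrable majorant.\<close>

lemma gauss_dominated:
  fixes z :: complex
  assumes "0 \<le> C" "norm z \<le> C * exp (c * norm x)"
  shows "norm (of_real (exp (- (norm x)\<^sup>2 / 2)) * z) \<le> C * exp (c\<^sup>2) * exp (- (norm x)\<^sup>2 / 4)"
proof -
  have "0 \<le> (c - norm x / 2)\<^sup>2" by simp
  then have *: "- (norm x)\<^sup>2 / 2 + c * norm x \<le> c\<^sup>2 + - (norm x)\<^sup>2 / 4"
    by (simp add: power2_eq_square algebra_simps)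
  have "norm (of_real (exp (- (norm x)\<^sup>2 / 2)) * z) \<le> exp (- (norm x)\<^sup>2 / 2) * (C * exp (c * norm x))"
    unfolding norm_mult using assms by (intro mult_mono) auto
  also have "\<dots> = C * exp (- (norm x)\<^sup>2 / 2 + c * norm x)" unfolding exp_add by simp
  also have "\<dots> \<le> C * exp (c\<^sup>2 + - (norm x)\<^sup>2 / 4)"
    using * assms(1) by (intro mult_left_mono) auto
  finally show ?thesis unfolding exp_add by simp
qed

text \<open>Dominated convergence applied to the partial sums, with the majorant of
  \<open>gauss_dominated\<close>; this is why C and c must not depend on n.\<close>

lemma gint_sums:
  fixes T :: "nat \<Rightarrow> real^'n::finite \<Rightarrow> complex"
  assumes [measurable]: "\<And>R. T R \<in> borel_measurable borel"
    and C: "0 \<le> C" and bd: "\<And>n x. norm (\<Sum>R<n. T R x) \<le> C * exp (c * norm x)"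
    and sums: "\<And>x. (\<lambda>R. T R x) sums F x"
    and int: "\<And>R. gintegrable (T R)"
  shows "gintegrable F" "(\<lambda>R. gint (T R)) sums gint F"
proof -
  let ?g = "\<lambda>x::real^'n. complex_of_real (exp (- (norm x)\<^sup>2 / 2))"
  have lim: "(\<lambda>n. ?g x * (\<Sum>R<n. T R x)) \<longlonglongrightarrow> ?g x * F x" for x
    using sums[of x] unfolding sums_def by (rule tendsto_mult_left)
  have Fm: "F \<in> borel_measurable borel"
    by (rule borel_measurable_LIMSEQ_metric[of "\<lambda>n x. \<Sum>R<n. T R x"])
       (use sums in \<open>auto simp: sums_def\<close>)
  have w: "integrable lborel (\<lambda>x::real^'n. C * exp (c\<^sup>2) * exp (- (norm x)\<^sup>2 / 4))"
    by (intro integrable_mult_right integrable_exp_quarter)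
  have m1: "(\<lambda>x. ?g x * F x) \<in> borel_measurable lborel" using Fm by measurable
  have m2: "(\<lambda>x. ?g x * (\<Sum>R<n. T R x)) \<in> borel_measurable lborel" for n by measurable
  have ae: "AE x in lborel. norm (?g x * (\<Sum>R<n. T R x)) \<le> C * exp (c\<^sup>2) * exp (- (norm x)\<^sup>2 / 4)" for n
    using gauss_dominated[OF C bd] by auto
  have lim': "AE x in lborel. (\<lambda>n. ?g x * (\<Sum>R<n. T R x)) \<longlonglongrightarrow> ?g x * F x"
    using lim by auto
  show "gintegrable F" unfolding gintegrable_def
    by (rule integrable_dominated_convergence[OF m1 m2 w lim' ae])
  have "(\<lambda>n. LINT x|lborel. ?g x * (\<Sum>R<n. T R x)) \<longlonglongrightarrow> (LINT x|lborel. ?g x * F x)"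
    by (rule integral_dominated_convergence[OF m1 m2 w lim' ae])
  moreover have "(LINT x|lborel. ?g x * (\<Sum>R<n. T R x)) = (\<Sum>R<n. gint (T R))" for n
    using gint_sum[of "{..<n}" T] int by (simp add: gint_def)
  ultimately show "(\<lambda>R. gint (T R)) sums gint F" by (simp add: sums_def gint_def)
qed

section \<open>Gaussian moments of harmonic polynomials\<close>

definition dird :: "real^'n::finite \<Rightarrow> (real^'n \<Rightarrow> complex) \<Rightarrow> real^'n \<Rightarrow> complex" where
  "dird y f x = (\<Sum>j\<in>UNIV. of_real (y$j) * pd j f x)"

definition harmonic_poly :: "nat \<Rightarrow> (real^'n::finite \<Rightarrow> complex) \<Rightarrow> bool" where
  "harmonic_poly k H \<longleftrightarrow> hpoly k H \<and> (\<forall>x. (\<Sum>j\<in>UNIV. pd j (pd j H) x) = 0)"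

lemma hpoly_dird: "hpoly (Suc k) f \<Longrightarrow> hpoly k (dird y f)"
  unfolding dird_def by (intro hpoly_sum hpoly_cmul hpoly_pd) auto

text \<open>By \<open>pd_commute\<close> the derivative along y can be pulled out of the Laplacian,
  where it acts on the zero function.\<close>

lemma harmonic_dird:
  assumes "harmonic_poly (Suc k) H"
  shows "harmonic_poly k (dird y H)"
  unfolding harmonic_poly_def
proof (intro conjI allI)
  have H: "hpoly (Suc k) H" and harm: "\<And>x. (\<Sum>j\<in>UNIV. pd j (pd j H) x) = 0"
    using assms by (auto simp: harmonic_poly_def)
  show "hpoly k (dird y H)" using H by (rule hpoly_dird)
  fix x
  have pp: "hpoly (k - 1) (pd i (pd j H))" for i j
    using H by (intro hpoly_pd_pred hpoly_pd)
  have "pd i (pd i (dird y H)) x = (\<Sum>j\<in>UNIV. of_real (y$j) * pd j (pd i (pd i H)) x)" for i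
  proof -
    have "pd i (dird y H) = (\<lambda>x. \<Sum>j\<in>UNIV. of_real (y$j) * pd i (pd j H) x)"
      unfolding dird_def using H
      by (subst pd_sum[where k = k]) (auto intro!: hpoly_cmul hpoly_pd simp: pd_cmul[OF hpoly_pd[OF H]])
    then have "pd i (pd i (dird y H)) = (\<lambda>x. \<Sum>j\<in>UNIV. of_real (y$j) * pd i (pd i (pd j H)) x)"
      by (simp, subst pd_sum[where k = "k - 1"]) (auto intro!: hpoly_cmul pp simp: pd_cmul[OF pp] simp del: One_nat_def)
    moreover have "pd i (pd i (pd j H)) = pd j (pd i (pd i H))" for j
      by (simp add: pd_commute[OF H, of i j] pd_commute[OF hpoly_pd[OF H], of i j])
    ultimately show ?thesis by simp
  qed
  then have "(\<Sum>i\<in>UNIV. pd i (pd i (dird y H)) x) = (\<Sum>j\<in>UNIV. of_real (y$j) * (\<Sum>i\<in>UNIV. pd j (pd i (pd i H)) x))"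
    by (simp add: sum_distrib_left) (rule sum.swap)
  also have "\<dots> = (\<Sum>j\<in>UNIV. of_real (y$j) * pd j (\<lambda>x. \<Sum>i\<in>UNIV. pd i (pd i H) x) x)"
    by (subst pd_sum[OF _ pp]) auto
  also have "\<dots> = 0" by (simp add: harm pd_hpoly0[OF hpoly_const])
  finally show "(\<Sum>i\<in>UNIV. pd i (pd i (dird y H)) x) = 0" .
qed

lemma hpoly0_const:
  assumes "hpoly 0 f"
  shows "f x = f y"
  using assms by (induction rule: hpoly.induct) (auto simp: monom_fun_def)

lemma gint_dird:
  assumes "hpoly k f"
  shows "gint (\<lambda>x. of_real (x \<bullet> y) * f x) = gint (dird y f)"
proof -
  have "gint (\<lambda>x. of_real (x \<bullet> y) * f x) = gint (\<lambda>x. \<Sum>j\<in>UNIV. of_real (y$j) * (of_real (x$j) * f x))"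
    by (simp add: inner_vec_sum sum_distrib_right sum_distrib_left mult_ac)
  also have "\<dots> = (\<Sum>j\<in>UNIV. of_real (y$j) * gint (\<lambda>x. of_real (x$j) * f x))"
    by (subst gint_sum, rule gintegrable_cmul, rule hpoly_gintegrable[OF hpoly_coord_mult[OF assms]])
       (simp add: gint_cmul)
  also have "\<dots> = gint (dird y f)"
    unfolding gint_by_parts[OF assms] dird_def
    by (subst gint_sum, rule gintegrable_cmul, rule hpoly_gintegrable[OF hpoly_pd_pred[OF assms]])
       (simp add: gint_cmul)
  finally show ?thesis .
qed

text \<open>Euler's identity produces factors x_j, and integration by parts trades each of them for
  a second derivative. Hence a harmonic polynomial of positive degree has Gaussian mean zero, the
  starting point of \<open>gint_harmonic\<close>.\<close>

lemma gint_euler: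
  assumes "hpoly k f"
  shows "of_nat k * gint f = gint (\<lambda>x. \<Sum>j\<in>UNIV. pd j (pd j f) x)"
proof -
  have "of_nat k * gint f = gint (\<lambda>x. \<Sum>j\<in>UNIV. of_real (x$j) * pd j f x)"
    unfolding euler_hpoly[OF assms] by (simp add: gint_cmul)
  also have "\<dots> = (\<Sum>j\<in>UNIV. gint (pd j (pd j f)))"
    by (subst gint_sum)
       (auto intro!: hpoly_gintegrable hpoly_coord_mult hpoly_pd_pred[OF assms] simp: gint_by_parts[OF hpoly_pd_pred[OF assms]])
  also have "\<dots> = gint (\<lambda>x. \<Sum>j\<in>UNIV. pd j (pd j f) x)"
    by (subst gint_sum) (auto intro!: hpoly_gintegrable hpoly_pd_pred[OF hpoly_pd_pred[OF assms]])
  finally show ?thesis .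
qed

lemma gint_harmonic_0:
  assumes "harmonic_poly k H" "k > 0"
  shows "gint H = 0"
  using gint_euler[of k H] assms by (simp add: harmonic_poly_def)

text \<open>The Gaussian mean of $\langle x,y\rangle^N H(x)$ is \<open>hmom N k\<close> times $|y|^{N-k} H(y)$, for $H$ harmonic of degree $k$.\<close>
definition hmom :: "nat \<Rightarrow> nat \<Rightarrow> real" where
  "hmom N k = (if k \<le> N \<and> even (N - k) then fact N / (2 ^ ((N - k) div 2) * fact ((N - k) div 2)) else 0)"

lemma hmom_eq: "hmom (k + 2 * n) k = fact (k + 2 * n) / (2 ^ n * fact n)"
  by (simp add: hmom_def)

lemma hmom_zero:
  assumes "\<And>n. N \<noteq> k + 2 * n"
  shows "hmom N k = 0"
proof -
  have "\<not> (k \<le> N \<and> even (N - k))"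
  proof
    assume *: "k \<le> N \<and> even (N - k)"
    then obtain n where "N - k = 2 * n" unfolding dvd_def by blast
    with * have "N = k + 2 * n" by simp
    then show False using assms by blast
  qed
  then show ?thesis unfolding hmom_def by (rule if_not_P)
qed

text \<open>One factor <x,y> is split off and integrated by parts: the derivative along y falls on
  H, giving k by Euler's identity at y, or on the remaining power, giving M |y|^2. The powers of r
  belong to the statement because the truncated exponents match only where the coefficients are
  nonzero.\<close>

lemma hmom_rec:
  fixes r :: real
  shows "hmom (Suc M) k * r ^ (Suc M - k) =
    of_nat k * (hmom M (k - 1) * r ^ (M - (k - 1))) + of_nat M * r\<^sup>2 * (hmom (M - 1) k * r ^ (M - 1 - k))"
proof (cases "\<exists>n. Suc M = k + 2 * n")
  case False
  have "hmom (Suc M) k = 0" using False by (intro hmom_zero) auto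
  moreover have "of_nat k * hmom M (k - 1) = 0"
  proof (cases k)
    case (Suc l)
    then show ?thesis using False by (auto intro!: hmom_zero)
  qed simp
  moreover have "of_nat M * hmom (M - 1) k = 0"
  proof (cases M)
    case (Suc l)
    have "l \<noteq> k + 2 * n" for n using False Suc by (auto dest: spec[of _ "Suc n"])
    then show ?thesis using Suc by (auto intro!: hmom_zero)
  qed simp
  ultimately show ?thesis by (metis add_0 mult_zero_left mult.assoc mult.left_commute)
next
  case True
  then obtain n where n: "Suc M = k + 2 * n" by auto
  show ?thesis
  proof (cases n)
    case 0
    then have k: "k = Suc M" using n by simp
    have "of_nat M * hmom (M - 1) k = 0" using k by (simp add: hmom_def)
    then have "of_nat M * r\<^sup>2 * (hmom (M - 1) k * r ^ (M - 1 - k)) = 0"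
      by (metis mult.assoc mult.left_commute mult_zero_left)
    then show ?thesis using k hmom_eq[of "Suc M" 0] hmom_eq[of M 0] by simp
  next
    case (Suc l)
    have M: "M = Suc (k + 2 * l)" using n Suc by simp
    have p: "r ^ (Suc M - k) = r ^ (2 * Suc l)" "r\<^sup>2 * r ^ (M - 1 - k) = r ^ (2 * Suc l)"
      using M by (simp_all add: power2_eq_square)
    have q: "of_nat k * (hmom M (k - 1) * r ^ (M - (k - 1))) = of_nat k * (fact M / (2 ^ Suc l * fact (Suc l))) * r ^ (2 * Suc l)"
    proof (cases k)
      case (Suc k')
      then have "M = k' + 2 * Suc l" using M by simp
      then have "hmom M (k - 1) = fact M / (2 ^ Suc l * fact (Suc l))" "M - (k - 1) = 2 * Suc l"
        using hmom_eq[of k' "Suc l"] Suc by simp_all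
      then show ?thesis by simp
    qed simp
    have r1: "hmom (Suc M) k = fact (Suc M) / (2 ^ Suc l * fact (Suc l))"
      using hmom_eq[of k "Suc l"] M by simp
    have r2: "hmom (M - 1) k = fact (M - 1) / (2 ^ l * fact l)"
      using hmom_eq[of k l] M by simp
    have "real M * fact (M - 1) = fact M" using M by simp
    then have e: "real M * hmom (M - 1) k = fact M / (2 ^ l * fact l)" unfolding r2 by simp
    have "(2::real) ^ Suc l * fact (Suc l) = (2 * (real l + 1)) * (2 ^ l * fact l)" by (simp add: algebra_simps)
    then have "fact M / (2 ^ l * fact l) = (2 * (real l + 1)) * fact M / (2 ^ Suc l * fact (Suc l) :: real)"
      by (simp only:) (subst mult_divide_mult_cancel_left, simp_all)
    then have "fact (Suc M) / (2 ^ Suc l * fact (Suc l)) = real k * (fact M / (2 ^ Suc l * fact (Suc l))) + real M * hmom (M - 1) k"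
      unfolding e using M by (simp add: add_divide_distrib[symmetric] algebra_simps del: fact_Suc power_Suc) (simp add: algebra_simps)
    then show ?thesis unfolding q r1 p(1)
      by (simp only: p(2)[symmetric] distrib_right) (simp only: mult_ac)
  qed
qed

lemma pd_inner: "pd j (\<lambda>x. of_real (x \<bullet> y)) = (\<lambda>x. of_real (y$j))"
proof -
  have "(\<lambda>x. complex_of_real (x \<bullet> y)) = (\<lambda>x. \<Sum>i\<in>UNIV. of_real (y$i) * of_real (x$i))"
    by (simp add: inner_vec_sum mult_ac)
  then show ?thesis
    by (simp only:, subst pd_sum[where k = 1])
       (auto intro!: hpoly_cmul hpoly_coord simp: pd_cmul[OF hpoly_coord] pd_coord if_distrib simp del: One_nat_def cong: if_cong)
qed

lemma hpoly_inner_power: "hpoly N (\<lambda>x. of_real (x \<bullet> y) ^ N)"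
  using hpoly_power[OF hpoly_inner[of y], of N] by simp

lemma pd_inner_power: "pd j (\<lambda>x. of_real (x \<bullet> y) ^ N) = (\<lambda>x. of_nat N * of_real (y$j) * of_real (x \<bullet> y) ^ (N - 1))"
proof (induction N)
  case 0
  show ?case using pd_hpoly0[OF hpoly_const] by simp
next
  case (Suc N)
  show ?case
    unfolding power_Suc pd_mult[OF hpoly_inner hpoly_inner_power] Suc pd_inner
    by (cases N) (auto simp: algebra_simps)
qed

lemma dird_inner_power_mult:
  assumes "hpoly k H"
  shows "dird y (\<lambda>x. of_real (x \<bullet> y) ^ M * H x) =
    (\<lambda>x. of_real (x \<bullet> y) ^ M * dird y H x + of_nat M * of_real ((norm y)\<^sup>2) * (of_real (x \<bullet> y) ^ (M - 1) * H x))"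
  unfolding dird_def pd_mult[OF hpoly_inner_power assms] pd_inner_power norm_sq_sum
  by (simp add: distrib_left sum.distrib sum_distrib_left sum_distrib_right mult_ac)

lemma dird_self: "hpoly k f \<Longrightarrow> dird y f y = of_nat k * f y"
  unfolding dird_def by (rule euler_hpoly)

text \<open>A Funk-Hecke formula with Gaussian weight. The induction replaces H by its derivative
  along y, which is harmonic of one degree less and takes the value k H(y) at y; evaluation at the
  same y closes the recursion.\<close>

lemma gint_harmonic:
  fixes H :: "real^'n::finite \<Rightarrow> complex"
  assumes "harmonic_poly k H"
  shows "gint (\<lambda>x. of_real (x \<bullet> y) ^ N * H x) = of_real (hmom N k * norm y ^ (N - k)) * H y * gint (\<lambda>_::real^'n. 1)"
  using assms
proof (induction N arbitrary: k H rule: less_induct)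
  case (less N)
  have H: "hpoly k H" using less.prems by (simp add: harmonic_poly_def)
  show ?case
  proof (cases N)
    case 0
    show ?thesis
    proof (cases "k = 0")
      case True
      have "H = (\<lambda>x. H y * 1)"
        using hpoly0_const[of H _ y] H True by auto
      with gint_cmul[of "H y" "\<lambda>_::real^'n. 1"] have "gint H = H y * gint (\<lambda>_::real^'n. 1)" by metis
      then show ?thesis using 0 True by (simp add: hmom_def)
    next
      case False
      then show ?thesis using 0 gint_harmonic_0[OF less.prems] by (simp add: hmom_def)
    qed
  next
    case (Suc M)
    let ?g = "gint (\<lambda>_::real^'n. 1)"
    let ?s = "\<lambda>x. complex_of_real (x \<bullet> y)"
    have sM: "hpoly (M + k) (\<lambda>x. ?s x ^ M * H x)"
      by (intro hpoly_mult hpoly_inner_power H)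
    have A: "gintegrable (\<lambda>x. ?s x ^ M * dird y H x) \<and>
       gint (\<lambda>x. ?s x ^ M * dird y H x) = of_nat k * of_real (hmom M (k - 1) * norm y ^ (M - (k - 1))) * H y * ?g"
    proof (cases k)
      case 0
      then have "dird y H = (\<lambda>x. 0)" using H by (simp add: dird_def pd_hpoly0 fun_eq_iff)
      then show ?thesis using 0 by (simp add: gintegrable_def)
    next
      case (Suc l)
      have h: "harmonic_poly l (dird y H)" using less.prems Suc harmonic_dird by blast
      show ?thesis using less.IH[OF _ h, of M] \<open>N = Suc M\<close> Suc dird_self[OF H, of y] h
        by (auto simp: harmonic_poly_def intro!: hpoly_gintegrable hpoly_mult hpoly_inner_power)
    qed
    have B: "of_nat M * gint (\<lambda>x. ?s x ^ (M - 1) * H x) = of_nat M * (of_real (hmom (M - 1) k * norm y ^ (M - 1 - k)) * H y * ?g)"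
      using less.IH[of "M - 1" k H] less.prems Suc by (cases M) auto
    have "gint (\<lambda>x. ?s x ^ N * H x) = gint (\<lambda>x. ?s x * (?s x ^ M * H x))"
      by (simp add: Suc mult_ac)
    also have "\<dots> = gint (dird y (\<lambda>x. ?s x ^ M * H x))"
      by (rule gint_dird[OF sM])
    also have "\<dots> = gint (\<lambda>x. ?s x ^ M * dird y H x) + of_nat M * of_real ((norm y)\<^sup>2) * gint (\<lambda>x. ?s x ^ (M - 1) * H x)"
      unfolding dird_inner_power_mult[OF H]
      by (subst gint_add, rule A[THEN conjunct1], rule gintegrable_cmul, rule hpoly_gintegrable[OF hpoly_mult[OF hpoly_inner_power H]])
         (simp add: gint_cmul)
    also have "of_nat M * of_real ((norm y)\<^sup>2) * gint (\<lambda>x. ?s x ^ (M - 1) * H x) =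
        of_real ((norm y)\<^sup>2) * (of_nat M * (of_real (hmom (M - 1) k * norm y ^ (M - 1 - k)) * H y * ?g))"
      unfolding B[symmetric] by (simp only: mult_ac)
    also have "gint (\<lambda>x. ?s x ^ M * dird y H x) + \<dots> = of_real (of_nat k * (hmom M (k - 1) * norm y ^ (M - (k - 1))) + of_nat M * (norm y)\<^sup>2 * (hmom (M - 1) k * norm y ^ (M - 1 - k))) * H y * ?g"
      unfolding A[THEN conjunct2] by (simp add: algebra_simps)
    finally show ?thesis unfolding hmom_rec[symmetric] Suc .
  qed
qed

text \<open>Integration by parts in each coordinate leaves the sum of f + x_j d_j f; the first parts
  contribute m, the second contribute d by Euler's identity.\<close>

lemma gint_norm_sq:
  fixes f :: "real^'n::finite \<Rightarrow> complex"
  assumes "hpoly d f"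
  shows "gint (\<lambda>x. of_real ((norm x)\<^sup>2) * f x) = of_nat (CARD('n) + d) * gint f"
proof -
  have xf: "hpoly (Suc d) (\<lambda>x. of_real (x$j) * f x)" for j by (rule hpoly_coord_mult[OF assms])
  have p: "pd j (\<lambda>x. of_real (x$j) * f x) = (\<lambda>x. f x + of_real (x$j) * pd j f x)" for j
    unfolding pd_mult[OF hpoly_coord assms] pd_coord by (simp add: add.commute)
  have xp: "gintegrable (\<lambda>x. of_real (x$j) * pd j f x)" for j
    by (rule hpoly_gintegrable[OF hpoly_coord_mult[OF hpoly_pd_pred[OF assms]]])
  have "gint (\<lambda>x. of_real ((norm x)\<^sup>2) * f x) = gint (\<lambda>x. \<Sum>j\<in>UNIV. of_real (x$j) * (of_real (x$j) * f x))"
    unfolding norm_sq_sum by (simp add: sum_distrib_right sum_distrib_left mult_ac)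
  also have "\<dots> = (\<Sum>j\<in>UNIV. gint (pd j (\<lambda>x. of_real (x$j) * f x)))"
    by (subst gint_sum) (auto intro!: hpoly_gintegrable hpoly_coord_mult xf simp: gint_by_parts[OF xf])
  also have "\<dots> = (\<Sum>j\<in>(UNIV::'n set). gint f + gint (\<lambda>x. of_real (x$j) * pd j f x))"
    unfolding p by (simp add: gint_add hpoly_gintegrable[OF assms] xp)
  also have "\<dots> = of_nat CARD('n) * gint f + gint (\<lambda>x. \<Sum>j\<in>UNIV. of_real (x$j) * pd j f x)"
    by (simp add: sum.distrib gint_sum xp)
  also have "\<dots> = of_nat (CARD('n) + d) * gint f"
    unfolding euler_hpoly[OF assms] gint_cmul by (simp add: distrib_right)
  finally show ?thesis .
qed

lemma hpoly_norm_sq_power: "hpoly (2 * j) (\<lambda>x. of_real ((norm x)\<^sup>2) ^ j)"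
  using hpoly_power[OF hpoly_norm_sq, of j] by (simp add: mult.commute)

lemma gint_norm_power:
  fixes f :: "real^'n::finite \<Rightarrow> complex"
  assumes "hpoly d f"
  shows "gint (\<lambda>x. of_real ((norm x)\<^sup>2) ^ j * f x) = of_real (2 ^ j * pochhammer (real (CARD('n) + d) / 2) j) * gint f"
proof (induction j)
  case (Suc j)
  have "hpoly (2 * j + d) (\<lambda>x. of_real ((norm x)\<^sup>2) ^ j * f x)"
    by (intro hpoly_mult hpoly_norm_sq_power assms)
  from gint_norm_sq[OF this]
  have "gint (\<lambda>x. of_real ((norm x)\<^sup>2) ^ Suc j * f x) = of_nat (CARD('n) + (2 * j + d)) * (of_real (2 ^ j * pochhammer (real (CARD('n) + d) / 2) j) * gint f)"
    using Suc by (simp add: mult.assoc)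
  also have "\<dots> = of_real (real (CARD('n) + (2 * j + d)) * (2 ^ j * pochhammer (real (CARD('n) + d) / 2) j)) * gint f"
    by simp
  also have "real (CARD('n) + (2 * j + d)) * (2 ^ j * pochhammer (real (CARD('n) + d) / 2) j) =
     2 ^ Suc j * pochhammer (real (CARD('n) + d) / 2) (Suc j)"
    by (simp add: pochhammer_Suc field_simps)
  finally show ?case .
qed simp

section \<open>Hermite-type sums\<close>

text \<open>The coefficients in $\partial_s^i G(s^2/2 + c) = \sum_\ell h_{i,\ell}\, s^{i-2\ell}\, G^{(i-\ell)}(s^2/2+c)$.\<close>
definition hcoef :: "nat \<Rightarrow> nat \<Rightarrow> real" where
  "hcoef i l = (if 2 * l \<le> i then fact i / (2 ^ l * fact l * fact (i - 2 * l)) else 0)"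

text \<open>The i-th derivative of v^a / a!. With a = R + l it is the (i - l)-th derivative of v^R /
  R!.\<close>

definition divpow :: "real \<Rightarrow> nat \<Rightarrow> nat \<Rightarrow> real" where
  "divpow v a i = (if i \<le> a then v ^ (a - i) / fact (a - i) else 0)"

lemma hcoef_0: "hcoef i 0 = 1"
  by (simp add: hcoef_def)

text \<open>\<open>hcoef i l\<close> counts the partial matchings of i points with l pairs (a
  Hermite coefficient up to sign). Of i + 2 points, the last one is either unmatched or paired with
  one of the other i + 1.\<close>

lemma hcoef_rec: "hcoef (Suc (Suc i)) (Suc l) = hcoef (Suc i) (Suc l) + real (Suc i) * hcoef i l"
proof -
  consider "i < 2 * l" | "i = 2 * l" | n where "i = 2 * l + Suc n"
    by (metis less_imp_Suc_add linorder_neqE_nat add_Suc_right)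
  then show ?thesis
  proof cases
    case 1 then show ?thesis by (simp add: hcoef_def)
  next
    case 2
    have "fact (Suc (Suc i)) = (2 * (real l + 1)) * fact (Suc i)" using 2 by simp
    moreover have "2 ^ Suc l * fact (Suc l) * fact (Suc (Suc i) - 2 * Suc l) = (2 * (real l + 1)) * (2 ^ l * fact l)"
      using 2 by simp
    ultimately have "fact (Suc (Suc i)) / (2 ^ Suc l * fact (Suc l) * fact (Suc (Suc i) - 2 * Suc l)) = fact (Suc i) / (2 ^ l * fact l :: real)"
      by (simp only:) (rule mult_divide_mult_cancel_left, simp)
    then show ?thesis using 2 by (simp add: hcoef_def)
  next
    case (3 n)
    have e: "Suc (Suc i) - 2 * Suc l = Suc n" "Suc i - 2 * Suc l = n" "i - 2 * l = Suc n"
      using 3 by simp_all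
    have c: "2 * Suc l \<le> Suc (Suc i)" "2 * Suc l \<le> Suc i" "2 * l \<le> i" using 3 by simp_all
    define F :: real where "F = fact (Suc i) / (2 ^ Suc l * fact (Suc l) * fact (Suc n))"
    have "hcoef (Suc (Suc i)) (Suc l) = (real i + 2) * F"
      unfolding hcoef_def F_def using c e by simp
    moreover have "hcoef (Suc i) (Suc l) = (real n + 1) * F"
    proof -
      have "F = fact (Suc i) / ((2 ^ Suc l * fact (Suc l) * fact n) * (real n + 1))"
        unfolding F_def fact_Suc[of n] by (simp add: mult_ac add_ac del: power_Suc)
      then have "(real n + 1) * F = fact (Suc i) / (2 ^ Suc l * fact (Suc l) * fact n)"
        by (simp del: fact_Suc power_Suc)
      then show ?thesis unfolding hcoef_def using c e by (simp del: fact_Suc power_Suc)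
    qed
    moreover have "real (Suc i) * hcoef i l = 2 * (real l + 1) * F"
      unfolding hcoef_def F_def using c e by (simp add: divide_simps) 
    moreover have "real i = 2 * real l + real n + 1" using 3 by simp
    ultimately show ?thesis by (simp add: algebra_simps)
  qed
qed

text \<open>For $v = (s^2-w)/2$ both \<open>QL\<close> (chain rule) and \<open>QR\<close> (binomial expansion) are $\partial_s^i (v^R/R!)$;
  they are identified through the common recurrence $Q_{i+2,R+1} = s\,Q_{i+1,R} + (i+1)\,Q_{i,R}$.\<close>
definition QL :: "nat \<Rightarrow> nat \<Rightarrow> nat \<Rightarrow> real \<Rightarrow> real \<Rightarrow> real" where
  "QL L i R s v = (\<Sum>l\<le>L. hcoef i l * s ^ (i - 2 * l) * divpow v (R + l) i)"

text \<open>The coefficient recurrence, applied after shifting l by one. The cut-off L is a free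
  parameter because the natural ranges \<open>i div 2\<close> of the three sums do not line up;
  \<open>QL_bound\<close> restores them.\<close>

lemma QL_rec: "QL (Suc L) (Suc (Suc i)) (Suc R) s v = s * QL (Suc L) (Suc i) R s v + real (Suc i) * QL L i R s v"
proof -
  have d: "divpow v (Suc a) (Suc b) = divpow v a b" for a b by (simp add: divpow_def)
  have t: "hcoef (Suc (Suc i)) (Suc l) * s ^ (Suc (Suc i) - 2 * Suc l) * divpow v (Suc R + Suc l) (Suc (Suc i)) =
     s * (hcoef (Suc i) (Suc l) * s ^ (Suc i - 2 * Suc l) * divpow v (R + Suc l) (Suc i)) +
     real (Suc i) * (hcoef i l * s ^ (i - 2 * l) * divpow v (R + l) i)" for l
  \<comment> \<open>A factor s can be split off \<open>s ^ (i - 2 * l)\<close> only if the exponent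
    is positive; otherwise the coefficient of the first summand is zero.\<close>
  proof (cases "2 * Suc l \<le> Suc i")
    case True
    then have "i - 2 * l = Suc (Suc i - 2 * Suc l)" by simp
    then have "s ^ (i - 2 * l) = s * s ^ (Suc i - 2 * Suc l)" by simp
    moreover have "Suc (Suc i) - 2 * Suc l = i - 2 * l" by simp
    ultimately show ?thesis unfolding hcoef_rec by (simp only: add_Suc add_Suc_right d) (simp only: algebra_simps)
  next
    case False
    then have "hcoef (Suc i) (Suc l) = 0" by (simp add: hcoef_def)
    moreover have "Suc (Suc i) - 2 * Suc l = i - 2 * l" by simp
    ultimately show ?thesis unfolding hcoef_rec by (simp only: add_Suc add_Suc_right d) simp
  qed
  show ?thesis unfolding QL_def sum.atMost_Suc_shift[of _ L] t
    by (simp add: hcoef_0 d sum.distrib sum_distrib_left distrib_left del: sum.atMost_Suc)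
qed

lemma QL_bound: "i div 2 \<le> L \<Longrightarrow> QL L i R s v = QL (i div 2) i R s v"
  unfolding QL_def by (rule sum.mono_neutral_right) (auto simp: hcoef_def)

definition QR :: "nat \<Rightarrow> nat \<Rightarrow> real \<Rightarrow> real \<Rightarrow> real" where
  "QR i R s w = (\<Sum>r\<le>R. (if i \<le> 2 * r then fact (2 * r) / (fact (2 * r - i) * fact r * fact (R - r) * 2 ^ R) else 0)
      * s ^ (2 * r - i) * (- w) ^ (R - r))"

text \<open>Since (2r+2)! / (r+1)! is 2 (2r+1) (2r)! / r!, the comparison of coefficients with n =
  2r - i comes down to 2r + 1 = n + (i + 1).\<close>

lemma QR_rec: "QR (Suc (Suc i)) (Suc R) s w = s * QR (Suc i) R s w + real (Suc i) * QR i R s w"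
proof -
  have t: "(if Suc (Suc i) \<le> 2 * Suc r then fact (2 * Suc r) / (fact (2 * Suc r - Suc (Suc i)) * fact (Suc r) * fact (Suc R - Suc r) * 2 ^ Suc R) else 0)
      * s ^ (2 * Suc r - Suc (Suc i)) * (- w) ^ (Suc R - Suc r) =
     s * ((if Suc i \<le> 2 * r then fact (2 * r) / (fact (2 * r - Suc i) * fact r * fact (R - r) * 2 ^ R) else 0) * s ^ (2 * r - Suc i) * (- w) ^ (R - r)) +
     real (Suc i) * ((if i \<le> 2 * r then fact (2 * r) / (fact (2 * r - i) * fact r * fact (R - r) * 2 ^ R) else 0) * s ^ (2 * r - i) * (- w) ^ (R - r))"
    (is "?A * _ * _ = s * (?B * _ * _) + real (Suc i) * (?C * _ * _)") for r
  proof -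
    consider "2 * r < i" | n where "2 * r = i + n" by (metis le_add_diff_inverse not_le)
    then show ?thesis
    proof cases
      case 1 then show ?thesis by simp
    next
      case (2 n)
      define F :: real where "F = fact (2 * r) / (fact n * fact r * fact (R - r) * 2 ^ R)"
      have n: "2 * Suc r - Suc (Suc i) = n" "2 * r - i = n" using 2 by simp_all
      have C: "?C = F" unfolding F_def n using 2 by simp
      have "fact (2 * Suc r) = (2 * (real r + 1)) * ((2 * real r + 1) * fact (2 * r))"
        by (simp add: algebra_simps)
      moreover have "fact n * fact (Suc r) * fact (Suc R - Suc r) * 2 ^ Suc R = (2 * (real r + 1)) * (fact n * fact r * fact (R - r) * 2 ^ R :: real)"
        by (simp add: algebra_simps)
      moreover have "?A = fact (2 * Suc r) / (fact n * fact (Suc r) * fact (Suc R - Suc r) * 2 ^ Suc R)"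
        unfolding n using 2 by (intro if_P) simp
      ultimately have "?A = (2 * (real r + 1)) * ((2 * real r + 1) * fact (2 * r)) / ((2 * (real r + 1)) * (fact n * fact r * fact (R - r) * 2 ^ R))"
        by (simp only:)
      then have A: "?A = (2 * real r + 1) * F"
        unfolding F_def by (subst (asm) mult_divide_mult_cancel_left) simp_all
      show ?thesis
      proof (cases n)
        case 0
        then have "real i = 2 * real r" "\<not> Suc i \<le> 2 * r" using 2 by simp_all
        then show ?thesis unfolding A C unfolding n by simp
      next
        case (Suc n')
        have n': "2 * r - Suc i = n'" using 2 Suc by simp
        have B: "?B = (real n' + 1) * F" unfolding F_def n' Suc using 2 Suc by (simp add: divide_simps)
        have i: "real i = 2 * real r - real n' - 1" using 2 Suc by simp
        show ?thesis unfolding A B C unfolding n n' by (simp add: Suc i algebra_simps)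
      qed
    qed
  qed
  show ?thesis unfolding QR_def sum.atMost_Suc_shift t by (simp add: sum.distrib sum_distrib_left)
qed

lemma QR_0: "v = (s\<^sup>2 - w) / 2 \<Longrightarrow> QR 0 R s w = v ^ R / fact R"
proof -
  assume v: "v = (s\<^sup>2 - w) / 2"
  have "v ^ R = (s\<^sup>2 + (- w)) ^ R / 2 ^ R" by (simp add: v power_divide)
  also have "\<dots> = (\<Sum>r\<le>R. real (R choose r) * s ^ (2 * r) * (- w) ^ (R - r)) / 2 ^ R"
    by (simp only: binomial_ring power_mult)
  finally have "v ^ R / fact R = (\<Sum>r\<le>R. real (R choose r) * s ^ (2 * r) * (- w) ^ (R - r)) / 2 ^ R / fact R"
    by (rule arg_cong)
  also have "\<dots> = (\<Sum>r\<le>R. fact (2 * r) / (fact (2 * r - 0) * fact r * fact (R - r) * 2 ^ R) * s ^ (2 * r) * (- w) ^ (R - r))"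
    unfolding sum_divide_distrib
  proof (rule sum.cong[OF refl])
    fix r assume "r \<in> {..R}"
    then have "real (R choose r) = fact R / (fact r * fact (R - r))" by (intro binomial_fact) simp
    then show "real (R choose r) * s ^ (2 * r) * (- w) ^ (R - r) / 2 ^ R / fact R = fact (2 * r) / (fact (2 * r - 0) * fact r * fact (R - r) * 2 ^ R) * s ^ (2 * r) * (- w) ^ (R - r)"
      by simp
  qed
  finally show ?thesis by (simp add: QR_def)
qed

lemma QR_1: "QR 1 (Suc R) s w = s * QR 0 R s w"
proof -
  have t: "(if 1 \<le> 2 * Suc r then fact (2 * Suc r) / (fact (2 * Suc r - 1) * fact (Suc r) * fact (Suc R - Suc r) * 2 ^ Suc R) else 0)
      * s ^ (2 * Suc r - 1) * (- w) ^ (Suc R - Suc r) =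
     s * ((if 0 \<le> 2 * r then fact (2 * r) / (fact (2 * r - 0) * fact r * fact (R - r) * 2 ^ R) else 0) * s ^ (2 * r - 0) * (- w) ^ (R - r))"
    (is "?A * _ * _ = _") for r
  proof -
    have "fact (2 * Suc r) = (2 * (real r + 1)) * fact (2 * r + 1)" by (simp add: algebra_simps)
    moreover have "fact (2 * Suc r - 1) * fact (Suc r) * fact (Suc R - Suc r) * 2 ^ Suc R = (2 * (real r + 1)) * (fact (2 * r + 1) * fact r * fact (R - r) * 2 ^ R :: real)"
      by (simp add: algebra_simps)
    moreover have "?A = fact (2 * Suc r) / (fact (2 * Suc r - 1) * fact (Suc r) * fact (Suc R - Suc r) * 2 ^ Suc R)"
      by (intro if_P) simp
    ultimately have "?A = (2 * (real r + 1)) * fact (2 * r + 1) / ((2 * (real r + 1)) * (fact (2 * r + 1) * fact r * fact (R - r) * 2 ^ R))"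
      by (simp only:)
    also have "\<dots> = 1 / (fact r * fact (R - r) * 2 ^ R)"
      by (subst mult_divide_mult_cancel_left, simp, simp add: mult.assoc del: fact_Suc)
    finally show ?thesis by simp
  qed
  show ?thesis unfolding QR_def sum.atMost_Suc_shift t by (simp add: sum_distrib_left)
qed

lemma QL_eq_QR:
  assumes v: "v = (s\<^sup>2 - w) / 2"
  shows "QL (i div 2) i R s v = QR i R s w"
proof (induction i arbitrary: R rule: induct_nat_012)
  case 0
  show ?case by (simp add: QL_def hcoef_0 divpow_def QR_0[OF v])
next
  case 1
  show ?case
  proof (cases R)
    case 0 then show ?thesis by (simp add: QL_def QR_def divpow_def)
  next
    case (Suc R')
    then show ?thesis using QR_1[of R' s w] by (simp add: QL_def hcoef_0 divpow_def QR_0[OF v])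
  qed
next
  case (ge2 i)
  show ?case
  proof (cases R)
    \<comment> \<open>The recurrence lowers R and so says nothing here, but v^0 / 0! is constant and
      all its derivatives vanish.\<close>
    case 0
    have "QL L (Suc (Suc i)) 0 s v = 0" for L
      unfolding QL_def by (rule sum.neutral) (auto simp: hcoef_def divpow_def)
    then show ?thesis using 0 by (simp add: QR_def)
  next
    case (Suc R')
    have "QL (Suc (Suc i) div 2) (Suc (Suc i)) R s v = QL (Suc (i div 2)) (Suc (Suc i)) (Suc R') s v"
      using Suc by simp
    also have "\<dots> = s * QL (Suc (i div 2)) (Suc i) R' s v + real (Suc i) * QL (i div 2) i R' s v"
      by (rule QL_rec)
    also have "QL (Suc (i div 2)) (Suc i) R' s v = QL (Suc i div 2) (Suc i) R' s v"
      by (rule QL_bound) simp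
    also have "s * QL (Suc i div 2) (Suc i) R' s v + real (Suc i) * QL (i div 2) i R' s v = QR (Suc (Suc i)) R s w"
      unfolding ge2 Suc QR_rec ..
    finally show ?thesis .
  qed
qed

text \<open>Pascal's rule splits the sum into two parts whose terms carry the factors \<beta> + n
  and -(\<alpha> + n). Together these give \<beta> - \<alpha>, free of n, and the induction
  hypothesis applies at \<beta> + 1.\<close>

lemma pochhammer_vandermonde:
  fixes \<alpha> \<beta> :: "'a::{field_char_0}"
  shows "(\<Sum>n\<le>q. of_nat (q choose n) * (-1) ^ n * pochhammer \<alpha> n * pochhammer (\<beta> + of_nat n) (q - n)) = pochhammer (\<beta> - \<alpha>) q"
proof (induction q arbitrary: \<beta>)
  case (Suc q)
  let ?f = "\<lambda>n. of_nat (q choose n) * (-1) ^ n * pochhammer \<alpha> n * pochhammer (\<beta> + 1 + of_nat n) (q - n)"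
  let ?G = "\<lambda>c n. of_nat c * (-1) ^ n * pochhammer \<alpha> n * pochhammer (\<beta> + of_nat n) (Suc q - n)"
  have p: "pochhammer (\<beta> + of_nat n) (Suc q - n) = (\<beta> + of_nat n) * pochhammer (\<beta> + 1 + of_nat n) (q - n)" if "n \<le> q" for n
    using that by (simp add: Suc_diff_le pochhammer_rec add_ac)
  have "(\<Sum>n\<le>Suc q. ?G (Suc q choose n) n) = ?G 1 0 + (\<Sum>n\<le>q. ?G (q choose Suc n) (Suc n) + ?G (q choose n) (Suc n))"
    by (simp only: sum.atMost_Suc_shift) (simp add: algebra_simps)
  also have "\<dots> = (?G (q choose 0) 0 + (\<Sum>n\<le>q. ?G (q choose Suc n) (Suc n))) + (\<Sum>n\<le>q. ?G (q choose n) (Suc n))"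
    by (simp only: sum.distrib add.assoc binomial_n_0)
  also have "?G (q choose 0) 0 + (\<Sum>n\<le>q. ?G (q choose Suc n) (Suc n)) = (\<Sum>n\<le>Suc q. ?G (q choose n) n)"
    by (rule sum.atMost_Suc_shift[symmetric])
  also have "\<dots> = (\<Sum>n\<le>q. (\<beta> + of_nat n) * ?f n)"
    by (simp add: p mult_ac)
  also have "(\<Sum>n\<le>q. ?G (q choose n) (Suc n)) = (\<Sum>n\<le>q. - ((\<alpha> + of_nat n) * ?f n))"
    by (rule sum.cong) (simp_all add: pochhammer_Suc add_ac mult_ac)
  also have "(\<Sum>n\<le>q. (\<beta> + of_nat n) * ?f n) + \<dots> = (\<Sum>n\<le>q. (\<beta> - \<alpha>) * ?f n)"
    unfolding sum.distrib[symmetric] by (rule sum.cong[OF refl]) (simp add: algebra_simps)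
  also have "\<dots> = (\<beta> - \<alpha>) * pochhammer (\<beta> + 1 - \<alpha>) q"
    unfolding sum_distrib_left[symmetric] Suc.IH ..
  also have "\<dots> = pochhammer (\<beta> - \<alpha>) (Suc q)"
    by (simp add: pochhammer_rec algebra_simps)
  finally show ?case .
qed simp

section \<open>Expansion of the kernel functions\<close>

text \<open>For integer order, with the powers of 2 regrouped around v = -t^2/2: this is the
  variable in which differentiation in s acts through the chain rule.\<close>

lemma Jt_sums:
  "(\<lambda>j. (- (t\<^sup>2) / 2) ^ j / (fact j * (2 ^ (n + j) * fact (n + j)))) sums Jt (real n) t"
proof -
  let ?c = "\<lambda>j. (- (t\<^sup>2) / 2) ^ j / (fact j * (2 ^ (n + j) * fact (n + j))) :: real"
  have "summable ?c"
  proof (rule summable_comparison_test')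
    show "summable (\<lambda>j. inverse (fact j) * (t\<^sup>2 / 2) ^ j)" by (rule summable_exp)
    fix j :: nat
    let ?M = "(2::real) ^ (n + j) * fact (n + j)"
    have "1 * 1 \<le> ?M" by (intro mult_mono) (auto simp: fact_ge_1)
    then have "fact j * 1 \<le> fact j * ?M" by (intro mult_left_mono) auto
    then have "(t\<^sup>2 / 2) ^ j / (fact j * ?M) \<le> (t\<^sup>2 / 2) ^ j / fact j"
      by (intro divide_left_mono mult_pos_pos) auto
    moreover have "norm (?c j) = (t\<^sup>2 / 2) ^ j / (fact j * ?M)"
      by (simp add: abs_mult power_abs)
    ultimately show "norm (?c j) \<le> inverse (fact j) * (t\<^sup>2 / 2) ^ j"
      by (simp only: divide_inverse mult.commute)
  qed
  then have S: "?c sums suminf ?c" by (rule summable_sums)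
  have eq: "(-1) ^ j / (fact j * Gamma (real j + real n + 1)) * (t / 2) ^ (2 * j) = 2 ^ n * ?c j" for j
  proof -
    have "Gamma (real j + real n + 1) = fact (n + j)"
      using Gamma_fact[of "n + j", where 'a = real] by (simp add: add_ac)
    moreover have "(-1) ^ j * (t / 2) ^ (2 * j) = (- (t\<^sup>2) / 2) ^ j / 2 ^ j"
    proof -
      have "(-1) ^ j * (t / 2) ^ (2 * j) = ((-1) * (t / 2)\<^sup>2) ^ j"
        by (simp only: power_mult power_mult_distrib)
      also have "(-1) * (t / 2)\<^sup>2 = (- (t\<^sup>2) / 2) / 2" by (simp add: power2_eq_square)
      finally show ?thesis by (simp only: power_divide)
    qed
    ultimately show ?thesis by (simp add: power_add)
  qed
  have "(\<lambda>j. 2 ^ n * ?c j) sums (2 ^ n * suminf ?c)" by (rule sums_mult[OF S])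
  then have "Jt (real n) t = (2 ^ n * suminf ?c) / 2 powr real n"
    unfolding Jt_def eq by (simp add: sums_iff)
  also have "\<dots> = suminf ?c" by (simp add: powr_realpow)
  finally show ?thesis using S by simp
qed

definition Aker :: "nat \<Rightarrow> nat \<Rightarrow> real \<Rightarrow> real \<Rightarrow> real" where
  "Aker N i s t = (\<Sum>l\<le>i div 2. hcoef i l * s ^ (i - 2 * l) * Jt (real N - real l) t)"

text \<open>The truncated subtraction is harmless: \<open>QL\<close> vanishes when $2R < i$, and $N \ge \lfloor i/2\rfloor$ where this is used.\<close>
definition tker :: "nat \<Rightarrow> nat \<Rightarrow> nat \<Rightarrow> real \<Rightarrow> real \<Rightarrow> real" where
  "tker N i R s v = QL (i div 2) i R s v / (2 ^ (N + R - i) * fact (N + R - i))"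

lemma tker_alt: "tker N i R s v = (\<Sum>l\<le>i div 2. hcoef i l * s ^ (i - 2 * l) *
    (divpow v (R + l) i / (2 ^ (N + R - i) * fact (N + R - i))))"
  by (simp add: tker_def QL_def sum_divide_distrib)

text \<open>The l-th part of the R-th term is nonzero only from R = i - l on. With R = j + (i - l)
  the index i disappears and the j-th term of the Bessel series of order N - l is left.\<close>

lemma divpow_shift:
  assumes "l \<le> i" "l \<le> N"
  shows "divpow v (j + (i - l) + l) i / (2 ^ (N + (j + (i - l)) - i) * fact (N + (j + (i - l)) - i)) =
    v ^ j / (fact j * (2 ^ (N - l + j) * fact (N - l + j)))"
proof -
  have "j + (i - l) + l = j + i" "N + (j + (i - l)) - i = N - l + j" using assms by simp_all
  then show ?thesis by (simp add: divpow_def)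
qed

lemma tker_sums:
  assumes "i div 2 \<le> N"
  shows "(\<lambda>R. tker N i R s (- (t\<^sup>2) / 2)) sums Aker N i s t"
  unfolding tker_alt Aker_def
proof (intro sums_sum sums_mult)
  fix l assume "l \<in> {..i div 2}"
  then have l: "l \<le> i" "l \<le> N" using assms by auto
  have "(\<lambda>j. divpow (- (t\<^sup>2) / 2) (j + (i - l) + l) i / (2 ^ (N + (j + (i - l)) - i) * fact (N + (j + (i - l)) - i))) sums Jt (real (N - l)) t"
    unfolding divpow_shift[OF l] by (rule Jt_sums)
  then have "(\<lambda>R. divpow (- (t\<^sup>2) / 2) (R + l) i / (2 ^ (N + R - i) * fact (N + R - i))) sums Jt (real (N - l)) t"
    by (subst (asm) sums_zero_iff_shift) (auto simp: divpow_def)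
  then show "(\<lambda>R. divpow (- (t\<^sup>2) / 2) (R + l) i / (2 ^ (N + R - i) * fact (N + R - i))) sums Jt (real N - real l) t"
    using l by (simp add: of_nat_diff)
qed

lemma sum_shift_le:
  fixes f :: "nat \<Rightarrow> real"
  assumes "\<And>j. 0 \<le> f j"
  shows "(\<Sum>R<n. if k \<le> R then f (R - k) else 0) \<le> (\<Sum>j<n. f j)"
proof -
  have "(\<Sum>R<n. if k \<le> R then f (R - k) else 0) = (\<Sum>j<n - k. f j)"
    by (induction n) (auto simp: Suc_diff_le not_le)
  also have "\<dots> \<le> (\<Sum>j<n. f j)" by (rule sum_mono2) (auto simp: assms)
  finally show ?thesis .
qed

text \<open>Each term before squaring is at most exp (t/2), and so is their sum; a sum of squares is
  at most the largest term times the sum.\<close>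

lemma sum_exp_sq_le:
  assumes "0 \<le> (t::real)"
  shows "(\<Sum>j<n. ((t / 2) ^ j / fact j)\<^sup>2) \<le> exp t"
proof -
  let ?a = "\<lambda>j. (t / 2) ^ j / fact j :: real"
  have "(\<lambda>j. (t / 2) ^ j /\<^sub>R fact j) sums exp (t / 2)" by (rule exp_converges)
  moreover have "(t / 2) ^ j /\<^sub>R fact j = ?a j" for j
    by (simp only: real_scaleR_def divide_inverse mult.commute)
  ultimately have s: "?a sums exp (t / 2)" by (simp only:)
  have a0: "0 \<le> ?a j" for j using assms by simp
  have le: "sum ?a A \<le> exp (t / 2)" if "finite A" for A
    using sum_le_suminf[OF sums_summable[OF s] that a0] unfolding sums_unique[OF s, symmetric] .
  have "(\<Sum>j<n. (?a j)\<^sup>2) \<le> (\<Sum>j<n. exp (t / 2) * ?a j)"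
  proof (rule sum_mono)
    fix j
    have "?a j \<le> exp (t / 2)" using le[of "{j}"] by simp
    then show "(?a j)\<^sup>2 \<le> exp (t / 2) * ?a j"
      unfolding power2_eq_square by (intro mult_right_mono a0)
  qed
  also have "\<dots> = exp (t / 2) * sum ?a {..<n}" by (simp only: sum_distrib_left)
  also have "\<dots> \<le> exp (t / 2) * exp (t / 2)" by (intro mult_left_mono le) auto
  also have "\<dots> = exp t" by (simp add: mult_exp_exp)
  finally show ?thesis .
qed

text \<open>The orders N - l are nonnegative, so the Bessel terms are bounded by those of order 0,
  the squares of \<open>sum_exp_sq_le\<close>. What matters is the exponent linear in t: one
  quadratic in t could outgrow the Gaussian for large y.\<close>

lemma tker_bound:
  assumes N: "i div 2 \<le> N" and t: "0 \<le> t"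
  shows "\<bar>\<Sum>R<n. tker N i R s (- (t\<^sup>2) / 2)\<bar> \<le> (\<Sum>l\<le>i div 2. hcoef i l * \<bar>s\<bar> ^ (i - 2 * l)) * exp t"
proof -
  let ?v = "- (t\<^sup>2) / 2"
  let ?d = "\<lambda>l R. divpow ?v (R + l) i / (2 ^ (N + R - i) * fact (N + R - i))"
  have d: "\<bar>\<Sum>R<n. ?d l R\<bar> \<le> exp t" if "l \<le> i div 2" for l
  proof -
    have l: "l \<le> i" "l \<le> N" using that N by auto
    let ?f = "\<lambda>j. ((t / 2) ^ j / fact j)\<^sup>2 :: real"
    have "\<bar>?d l R\<bar> \<le> (if i - l \<le> R then ?f (R - (i - l)) else 0)" for R
    proof (cases "i - l \<le> R")
      case True
      define j where "j = R - (i - l)"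
      have R: "R = j + (i - l)" using True by (simp add: j_def)
      have "\<bar>?d l R\<bar> = (t\<^sup>2 / 2) ^ j / (fact j * (2 ^ (N - l + j) * fact (N - l + j)))"
        unfolding R divpow_shift[OF l] by (simp add: abs_mult power_abs)
      also have "\<dots> \<le> (t\<^sup>2 / 2) ^ j / (fact j * (2 ^ j * fact j))"
        by (intro divide_left_mono mult_left_mono mult_mono power_increasing fact_mono mult_pos_pos) auto
      also have "\<dots> = (t\<^sup>2 / 2) ^ j / 2 ^ j / (fact j * fact j)"
        by (simp only: divide_divide_eq_left mult_ac)
      also have "(t\<^sup>2 / 2) ^ j / 2 ^ j = (t\<^sup>2 / 2 / 2) ^ j" by (simp only: power_divide)
      also have "t\<^sup>2 / 2 / 2 = (t / 2) * (t / 2)" by (simp add: power2_eq_square)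
      also have "((t / 2) * (t / 2)) ^ j = (t / 2) ^ j * (t / 2) ^ j" by (rule power_mult_distrib)
      also have "(t / 2) ^ j * (t / 2) ^ j / (fact j * fact j) = ?f j"
        by (simp only: power2_eq_square times_divide_times_eq)
      finally show ?thesis using True by (simp add: j_def)
    qed (use l in \<open>simp add: divpow_def\<close>)
    then have "\<bar>\<Sum>R<n. ?d l R\<bar> \<le> (\<Sum>R<n. if i - l \<le> R then ?f (R - (i - l)) else 0)"
      by (intro order_trans[OF sum_abs] sum_mono)
    also have "\<dots> \<le> (\<Sum>j<n. ?f j)" by (rule sum_shift_le) simp
    also have "\<dots> \<le> exp t" by (rule sum_exp_sq_le[OF t])
    finally show ?thesis .
  qed
  have h: "0 \<le> hcoef i l" for l by (simp add: hcoef_def)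
  have "(\<Sum>R<n. tker N i R s ?v) = (\<Sum>l\<le>i div 2. hcoef i l * s ^ (i - 2 * l) * (\<Sum>R<n. ?d l R))"
    unfolding tker_alt by (subst sum.swap) (simp only: sum_distrib_left)
  then have "\<bar>\<Sum>R<n. tker N i R s ?v\<bar> \<le> (\<Sum>l\<le>i div 2. \<bar>hcoef i l * s ^ (i - 2 * l) * (\<Sum>R<n. ?d l R)\<bar>)"
    by (simp only: sum_abs)
  also have "\<dots> \<le> (\<Sum>l\<le>i div 2. hcoef i l * \<bar>s\<bar> ^ (i - 2 * l) * exp t)"
    unfolding abs_mult power_abs using d h by (intro sum_mono mult_mono) auto
  finally show ?thesis by (simp only: sum_distrib_right)
qed

lemma wedge_norm_nonneg: "0 \<le> wedge_norm x y"
  unfolding wedge_norm_def by (intro real_sqrt_ge_zero sum_nonneg) auto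

text \<open>Lagrange's identity: the sum over j < k is half of the full symmetric double sum, whose
  diagonal vanishes.\<close>

lemma wedge_norm_sq:
  fixes x y :: "real^'n::{finite,linorder}"
  shows "(wedge_norm x y)\<^sup>2 = (norm x)\<^sup>2 * (norm y)\<^sup>2 - (x \<bullet> y)\<^sup>2"
proof -
  let ?g = "\<lambda>j k::'n. (x$j * y$k - x$k * y$j)\<^sup>2"
  let ?S = "\<Sum>j\<in>UNIV. \<Sum>k\<in>UNIV. if j < k then ?g j k else 0"
  have "?S = (\<Sum>j\<in>UNIV. \<Sum>k\<in>UNIV. if k < j then ?g j k else 0)"
    by (subst sum.swap) (auto intro!: sum.cong simp: power2_commute mult.commute)
  then have "2 * ?S = (\<Sum>j\<in>UNIV. \<Sum>k\<in>UNIV. (if j < k then ?g j k else 0) + (if k < j then ?g j k else 0))"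
    by (simp add: sum.distrib)
  also have "\<dots> = (\<Sum>j\<in>UNIV. \<Sum>k\<in>UNIV. ?g j k)"
    by (intro sum.cong refl) (auto simp: not_less elim: antisym)
  also have "\<dots> = (\<Sum>j\<in>UNIV. \<Sum>k\<in>UNIV. (x$j)\<^sup>2 * (y$k)\<^sup>2 + (x$k)\<^sup>2 * (y$j)\<^sup>2 - 2 * (x$j * y$j) * (x$k * y$k))"
    by (intro sum.cong refl) (simp add: power2_eq_square algebra_simps)
  also have "\<dots> = 2 * ((norm x)\<^sup>2 * (norm y)\<^sup>2 - (x \<bullet> y)\<^sup>2)"
  proof -
    have "(\<Sum>j\<in>UNIV. \<Sum>k\<in>UNIV. (x$j)\<^sup>2 * (y$k)\<^sup>2) = (norm x)\<^sup>2 * (norm y)\<^sup>2"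
      unfolding norm_sq_sum sum_product by (simp add: power2_eq_square)
    moreover have "(\<Sum>j\<in>UNIV. \<Sum>k\<in>UNIV. (x$k)\<^sup>2 * (y$j)\<^sup>2) = (norm x)\<^sup>2 * (norm y)\<^sup>2"
      unfolding norm_sq_sum sum_product by (subst sum.swap) (simp add: power2_eq_square)
    moreover have "(\<Sum>j\<in>UNIV. \<Sum>k\<in>UNIV. 2 * (x$j * y$j) * (x$k * y$k)) = 2 * (x \<bullet> y)\<^sup>2"
      by (simp add: inner_vec_sum sum_product power2_eq_square sum_distrib_left mult_ac)
    ultimately show ?thesis by (simp add: sum.distrib sum_subtractf)
  qed
  finally have "?S = (norm x)\<^sup>2 * (norm y)\<^sup>2 - (x \<bullet> y)\<^sup>2" by simp
  moreover have "0 \<le> ?S" by (intro sum_nonneg) auto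
  ultimately show ?thesis unfolding wedge_norm_def by simp
qed

lemma wedge_norm_le: "wedge_norm x y \<le> norm x * norm y"
proof (rule power2_le_imp_le)
  show "(wedge_norm x y)\<^sup>2 \<le> (norm x * norm y)\<^sup>2"
    unfolding wedge_norm_sq power_mult_distrib by simp
qed simp

section \<open>Integrating the kernel functions against harmonic polynomials\<close>

text \<open>\<open>c\<close> stands for m/2. Terms with r < \<kappa> vanish because the power 2r - i
  of s is below the degree k. With r = \<kappa> + n the rest is
  \<open>pochhammer_vandermonde\<close> at \<kappa> + 1/2 and c + k.\<close>

lemma coef_sum:
  fixes y u \<beta> :: real and i k \<kappa> q j :: nat
  assumes ik: "i + k = 2 * \<kappa>"
  shows "(\<Sum>r\<le>\<kappa> + q. (if i \<le> 2 * r then fact (2 * r) / (fact (2 * r - i) * fact r * fact (\<kappa> + q - r) * 2 ^ (\<kappa> + q)) else 0)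
      * (- (y\<^sup>2)) ^ (\<kappa> + q - r) * (2 ^ (\<kappa> + q - r + j) * pochhammer (c + real (2 * r - i + k) / 2) (\<kappa> + q - r + j))
      * (hmom (2 * r - i) k * y ^ (2 * r - i - k)))
    = 2 ^ \<kappa> * pochhammer (1/2) \<kappa> * (2 ^ j * pochhammer (c + real k + real q) j) * (- (y\<^sup>2)) ^ q / fact q
       * pochhammer (c + real k - real \<kappa> - 1/2) q"
    (is "(\<Sum>r\<le>_. ?F r) = ?rhs")
proof -
  let ?\<beta> = "c + real k"
  have z: "?F r = 0" if "r < \<kappa>" for r
  proof (cases "i \<le> 2 * r")
    case True
    then have "hmom (2 * r - i) k = 0" using that ik by (intro hmom_zero) linarith
    then show ?thesis by simp
  qed simp
  have "(\<Sum>r\<le>\<kappa> + q. ?F r) = (\<Sum>r=\<kappa>..\<kappa> + q. ?F r)"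
  proof (rule sum.mono_neutral_right)
    show "\<forall>r\<in>{..\<kappa> + q} - {\<kappa>..\<kappa> + q}. ?F r = 0"
    proof
      fix r assume "r \<in> {..\<kappa> + q} - {\<kappa>..\<kappa> + q}"
      then have "r < \<kappa>" by auto
      then show "?F r = 0" by (rule z)
    qed
  qed auto
  also have "\<dots> = (\<Sum>n\<le>q. ?F (\<kappa> + n))"
    by (rule sum.reindex_bij_witness[of _ "\<lambda>n. \<kappa> + n" "\<lambda>r. r - \<kappa>"]) auto
  also have "\<dots> = (\<Sum>n\<le>q. 2 ^ \<kappa> * pochhammer (1/2) \<kappa> * (2 ^ j * pochhammer (?\<beta> + real q) j) * (- (y\<^sup>2)) ^ q / fact q *
      (of_nat (q choose n) * (-1) ^ n * pochhammer (\<kappa> + 1/2) n * pochhammer (?\<beta> + of_nat n) (q - n)))"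
  proof (rule sum.cong[OF refl])
    fix n assume "n \<in> {..q}"
    then have n: "n \<le> q" by simp
    define d where "d = q - n"
    have q: "q = n + d" using n by (simp add: d_def)
    have e: "2 * (\<kappa> + n) - i = k + 2 * n" "\<kappa> + q - (\<kappa> + n) = d" "k + 2 * n - k = 2 * n" "i \<le> 2 * (\<kappa> + n)"
      using ik q by simp_all
    have h: "hmom (k + 2 * n) k = fact (k + 2 * n) / (2 ^ n * fact n)" by (rule hmom_eq)
    \<comment> \<open>The duplication formula, with the Pochhammer symbol cut at \<kappa>: the first
      piece is the later numerator double factorial, the second depends on n and enters
      Vandermonde.\<close>
    have f: "fact (2 * (\<kappa> + n)) = 2 ^ (2 * (\<kappa> + n)) * (pochhammer (1/2) \<kappa> * pochhammer (\<kappa> + 1/2) n) * (fact (\<kappa> + n) :: real)"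
      by (subst fact_double) (simp add: pochhammer_product' add.commute)
    \<comment> \<open>The symbol starts at c + k + n, so after d = q - n factors the other j start
      at c + k + q whatever n is; the effect of |x|^(2j) thus leaves the sum.\<close>
    have p: "pochhammer (c + real (k + 2 * n + k) / 2) (d + j) = pochhammer (?\<beta> + of_nat n) d * pochhammer (?\<beta> + real q) j"
    proof -
      have eq: "c + real (k + 2 * n + k) / 2 = ?\<beta> + of_nat n" by (simp add: field_simps)
      have e2: "?\<beta> + real q = ?\<beta> + of_nat n + of_nat d" using q by simp
      show ?thesis unfolding eq pochhammer_product' e2 ..
    qed
    have b: "real (q choose n) = fact q / (fact n * fact d)"
      unfolding d_def using n by (rule binomial_fact)
    have y2: "(- (y\<^sup>2)) ^ d * y ^ (2 * n) = (-1) ^ n * (- (y\<^sup>2)) ^ q"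
    proof -
      have "y ^ (2 * n) = (-1) ^ n * (- (y\<^sup>2)) ^ n"
        by (simp add: power_mult power_mult_distrib[symmetric])
      then show ?thesis unfolding q power_add by (simp only: mult_ac)
    qed
    have t2: "(2::real) ^ (2 * (\<kappa> + n)) * 2 ^ (d + j) = 2 ^ \<kappa> * 2 ^ j * (2 ^ (\<kappa> + q) * 2 ^ n)"
      unfolding q power_add[symmetric] by (rule arg_cong[where f = "power 2"]) simp
    let ?P1 = "pochhammer (1/2) \<kappa> :: real" let ?P2 = "pochhammer (\<kappa> + 1/2) n :: real"
    let ?P3 = "pochhammer (?\<beta> + of_nat n) d" let ?P4 = "pochhammer (?\<beta> + real q) j"
    let ?K = "fact (k + 2 * n) :: real" let ?L = "fact (\<kappa> + n) :: real"
    have "?F (\<kappa> + n) = (2 ^ (2 * (\<kappa> + n)) * (?P1 * ?P2) * ?L) / (?K * ?L * fact d * 2 ^ (\<kappa> + q))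
       * (- (y\<^sup>2)) ^ d * (2 ^ (d + j) * (?P3 * ?P4)) * (?K / (2 ^ n * fact n) * y ^ (2 * n))"
      unfolding e h p f[symmetric] using e(4) by (simp only: if_True)
    also have "\<dots> = (2 ^ (2 * (\<kappa> + n)) * 2 ^ (d + j)) / (2 ^ (\<kappa> + q) * 2 ^ n) * (?P1 * ?P2 * ?P3 * ?P4)
       * ((- (y\<^sup>2)) ^ d * y ^ (2 * n)) / (fact d * fact n)"
      by (simp add: divide_simps) 
    also have "(2 ^ (2 * (\<kappa> + n)) * 2 ^ (d + j)) / (2 ^ (\<kappa> + q) * 2 ^ n) = 2 ^ \<kappa> * (2::real) ^ j"
      unfolding t2 by simp
    also have "2 ^ \<kappa> * 2 ^ j * (?P1 * ?P2 * ?P3 * ?P4) * ((- (y\<^sup>2)) ^ d * y ^ (2 * n)) / (fact d * fact n) =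
       2 ^ \<kappa> * ?P1 * (2 ^ j * ?P4) * (- (y\<^sup>2)) ^ q / fact q * (fact q / (fact n * fact d) * (-1) ^ n * ?P2 * ?P3)"
      unfolding y2 by (simp add: mult_ac)
    finally show "?F (\<kappa> + n) = 2 ^ \<kappa> * ?P1 * (2 ^ j * ?P4) * (- (y\<^sup>2)) ^ q / fact q *
      (of_nat (q choose n) * (-1) ^ n * ?P2 * pochhammer (?\<beta> + of_nat n) (q - n))"
      unfolding b d_def .
  qed
  also have "\<dots> = 2 ^ \<kappa> * pochhammer (1/2) \<kappa> * (2 ^ j * pochhammer (?\<beta> + real q) j) * (- (y\<^sup>2)) ^ q / fact q *
      pochhammer (?\<beta> - (\<kappa> + 1/2)) q"
    unfolding sum_distrib_left[symmetric] pochhammer_vandermonde ..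
  finally show ?thesis by (simp add: diff_diff_eq)
qed

lemma QR_expand:
  "of_real (QR i R s (A * B)) * (of_real A ^ j * h) =
    (\<Sum>r\<le>R. of_real ((if i \<le> 2 * r then fact (2 * r) / (fact (2 * r - i) * fact r * fact (R - r) * 2 ^ R) else 0) * (- B) ^ (R - r))
      * (of_real A ^ (R - r + j) * (of_real s ^ (2 * r - i) * (h::complex))))"
  unfolding QR_def of_real_sum sum_distrib_right
proof (rule sum.cong[OF refl])
  fix r
  have *: "of_real (e * s ^ n * (- (A * B)) ^ d) * (of_real A ^ j * h) =
     of_real (e * (- B) ^ d) * (of_real A ^ (d + j) * (of_real s ^ n * h))" for e n d
  proof -
    have "- (A * B) = - B * A" by simp
    then have "(- (A * B)) ^ d = (- B) ^ d * A ^ d" by (simp only: power_mult_distrib)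
    then show ?thesis by (simp only: of_real_mult of_real_power power_add mult_ac)
  qed
  show "of_real ((if i \<le> 2 * r then fact (2 * r) / (fact (2 * r - i) * fact r * fact (R - r) * 2 ^ R) else 0) * s ^ (2 * r - i) * (- (A * B)) ^ (R - r)) * (of_real A ^ j * h) =
    of_real ((if i \<le> 2 * r then fact (2 * r) / (fact (2 * r - i) * fact r * fact (R - r) * 2 ^ R) else 0) * (- B) ^ (R - r)) * (of_real A ^ (R - r + j) * (of_real s ^ (2 * r - i) * h))"
    by (rule *)
qed

lemma gint_QR:
  fixes H :: "real^'n::finite \<Rightarrow> complex"
  assumes harm: "harmonic_poly k H"
  shows "gint (\<lambda>x. of_real (QR i R (x \<bullet> y) ((norm x)\<^sup>2 * (norm y)\<^sup>2)) * (of_real ((norm x)\<^sup>2) ^ j * H x)) =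
    of_real (\<Sum>r\<le>R. (if i \<le> 2 * r then fact (2 * r) / (fact (2 * r - i) * fact r * fact (R - r) * 2 ^ R) else 0)
      * (- ((norm y)\<^sup>2)) ^ (R - r) * (2 ^ (R - r + j) * pochhammer (real CARD('n) / 2 + real (2 * r - i + k) / 2) (R - r + j))
      * (hmom (2 * r - i) k * norm y ^ (2 * r - i - k))) * H y * gint (\<lambda>_::real^'n. 1)"
    (is "gint ?f = of_real (\<Sum>r\<le>R. ?e r * ?u r * ?p r * ?h r) * _ * ?g")
proof -
  have H: "hpoly k H" using harm by (simp add: harmonic_poly_def)
  let ?G = "\<lambda>r x. of_real ((norm x)\<^sup>2) ^ (R - r + j) * (of_real (x \<bullet> y) ^ (2 * r - i) * H x)"
  have hp: "hpoly (2 * r - i + k) (\<lambda>x. of_real (x \<bullet> y) ^ (2 * r - i) * H x)" for r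
    by (intro hpoly_mult hpoly_inner_power H)
  have G: "gintegrable (?G r)" for r
    by (rule hpoly_gintegrable[OF hpoly_mult[OF hpoly_norm_sq_power hp]])
  have "?f = (\<lambda>x. \<Sum>r\<le>R. of_real (?e r * ?u r) * ?G r x)"
    by (rule ext) (rule QR_expand)
  then have "gint ?f = (\<Sum>r\<le>R. of_real (?e r * ?u r) * gint (?G r))"
    by (simp only:) (subst gint_sum, rule gintegrable_cmul[OF G], simp only: gint_cmul)
  also have "\<dots> = (\<Sum>r\<le>R. of_real (?e r * ?u r * ?p r * ?h r) * H y * ?g)"
  proof (rule sum.cong[OF refl])
    fix r
    have "real (CARD('n) + (2 * r - i + k)) / 2 = real CARD('n) / 2 + real (2 * r - i + k) / 2"
      by (simp add: add_divide_distrib)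
    then show "of_real (?e r * ?u r) * gint (?G r) = of_real (?e r * ?u r * ?p r * ?h r) * H y * ?g"
      unfolding gint_norm_power[OF hp] gint_harmonic[OF harm] by (simp only: of_real_mult mult.assoc)
  qed
  finally show ?thesis by (simp only: sum_distrib_right of_real_sum)
qed

text \<open>All powers of s in \<open>QR\<close> have the parity of i, whereas \<open>hmom\<close>
  requires that of k. This selection rule makes each eigenvalue involve only e_i or only its
  conjugate.\<close>

lemma gint_QR_odd:
  fixes H :: "real^'n::finite \<Rightarrow> complex"
  assumes harm: "harmonic_poly k H" and odd: "odd (i + k)"
  shows "gint (\<lambda>x. of_real (QR i R (x \<bullet> y) ((norm x)\<^sup>2 * (norm y)\<^sup>2)) * (of_real ((norm x)\<^sup>2) ^ j * H x)) = 0"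
proof -
  have z: "(if i \<le> 2 * r then a else 0) * b * c * (hmom (2 * r - i) k * d) = 0" for a b c d and r
  proof (cases "i \<le> 2 * r")
    case True
    have "hmom (2 * r - i) k = 0"
    proof (rule hmom_zero)
      fix n
      show "2 * r - i \<noteq> k + 2 * n"
      proof
        assume "2 * r - i = k + 2 * n"
        then have "i + k = 2 * (r - n)" using True by (simp add: right_diff_distrib')
        then show False using odd by simp
      qed
    qed
    then show ?thesis by simp
  qed simp
  show ?thesis unfolding gint_QR[OF harm] z by simp
qed

lemma gint_QR_even:
  fixes H :: "real^'n::finite \<Rightarrow> complex"
  assumes harm: "harmonic_poly k H" and ik: "i + k = 2 * \<kappa>"
  shows "gint (\<lambda>x. of_real (QR i (q + \<kappa>) (x \<bullet> y) ((norm x)\<^sup>2 * (norm y)\<^sup>2)) * (of_real ((norm x)\<^sup>2) ^ j * H x)) =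
    of_real (2 ^ \<kappa> * pochhammer (1/2) \<kappa> * (2 ^ j * pochhammer (real CARD('n) / 2 + real k + real q) j) * (- ((norm y)\<^sup>2)) ^ q / fact q
       * pochhammer (real CARD('n) / 2 + real k - real \<kappa> - 1/2) q) * H y * gint (\<lambda>_::real^'n. 1)"
  unfolding gint_QR[OF harm] add.commute[of q \<kappa>] coef_sum[OF ik] ..

text \<open>The powers of s that occur are at most 2R - i, which is less than the degree k of the
  harmonic factor.\<close>

lemma gint_QR_zero:
  fixes H :: "real^'n::finite \<Rightarrow> complex"
  assumes harm: "harmonic_poly k H" and ik: "i + k = 2 * \<kappa>" and R: "R < \<kappa>"
  shows "gint (\<lambda>x. of_real (QR i R (x \<bullet> y) ((norm x)\<^sup>2 * (norm y)\<^sup>2)) * (of_real ((norm x)\<^sup>2) ^ j * H x)) = 0"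
proof -
  have z: "(if i \<le> 2 * r then a else 0) * b * c * (hmom (2 * r - i) k * d) = 0" if "r \<le> R" for a b c d and r
  proof (cases "i \<le> 2 * r")
    case True
    then have "hmom (2 * r - i) k = 0" using that ik R by (intro hmom_zero) linarith
    then show ?thesis by simp
  qed simp
  have "(\<Sum>r\<le>R. (if i \<le> 2 * r then a r else 0) * b r * c r * (hmom (2 * r - i) k * d r)) = 0" for a b c d
    by (rule sum.neutral) (use z in blast)
  then show ?thesis unfolding gint_QR[OF harm] by simp
qed

lemma expbd_Aker_bound:
  fixes y :: "real^'n::{finite,linorder}"
  shows "expbd (\<lambda>x. of_real ((\<Sum>l\<le>i div 2. hcoef i l * \<bar>x \<bullet> y\<bar> ^ (i - 2 * l)) * exp (wedge_norm x y)))"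
proof -
  have e: "expbd (\<lambda>x. complex_of_real (exp (wedge_norm x y)))"
  proof (rule expbdI[of 1 "norm y"])
    show "norm (complex_of_real (exp (wedge_norm x y))) \<le> 1 * exp (norm y * norm x)" for x
      using wedge_norm_le[of x y] by (simp add: mult.commute)
  qed auto
  have "expbd (\<lambda>x. complex_of_real (x \<bullet> y))" by (rule hpoly_expbd[OF hpoly_inner])
  then have a: "expbd (\<lambda>x. complex_of_real \<bar>x \<bullet> y\<bar>)" by (rule expbd_mono) simp
  show ?thesis unfolding of_real_mult of_real_sum of_real_power
    by (intro expbd_mult expbd_sum expbd_const expbd_power a e)
qed

text \<open>\<open>QL_eq_QR\<close> is used here at w = |x|^2 |y|^2, where v = -t^2/2: convergence
  and the majorant come from the chain-rule form, the integrals of the terms from the binomial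
  form.\<close>

lemma Aker_gint_sums:
  fixes P :: "real^'n::{finite,linorder} \<Rightarrow> complex"
  assumes N: "i div 2 \<le> N" and Pm: "P \<in> borel_measurable borel" and Pb: "expbd P"
    and int: "\<And>R. gintegrable (\<lambda>x. of_real (QR i R (x \<bullet> y) ((norm x)\<^sup>2 * (norm y)\<^sup>2)) * P x)"
  shows "gintegrable (\<lambda>x. of_real (Aker N i (x \<bullet> y) (wedge_norm x y)) * P x)"
    and "(\<lambda>R. gint (\<lambda>x. of_real (QR i R (x \<bullet> y) ((norm x)\<^sup>2 * (norm y)\<^sup>2)) * P x) / of_real (2 ^ (N + R - i) * fact (N + R - i)))
      sums gint (\<lambda>x. of_real (Aker N i (x \<bullet> y) (wedge_norm x y)) * P x)"
proof -
  let ?v = "\<lambda>x. - ((wedge_norm x y)\<^sup>2) / 2"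
  let ?Q = "\<lambda>R x. of_real (QR i R (x \<bullet> y) ((norm x)\<^sup>2 * (norm y)\<^sup>2)) * P x"
  let ?D = "\<lambda>R. complex_of_real (2 ^ (N + R - i) * fact (N + R - i))"
  let ?T = "\<lambda>R x. of_real (tker N i R (x \<bullet> y) (?v x)) * P x"
  have TQ: "?T R = (\<lambda>x. (1 / ?D R) * ?Q R x)" for R
  proof
    fix x
    have "?v x = ((x \<bullet> y)\<^sup>2 - (norm x)\<^sup>2 * (norm y)\<^sup>2) / 2" unfolding wedge_norm_sq by simp
    from QL_eq_QR[OF this, of i R] show "?T R x = (1 / ?D R) * ?Q R x"
      unfolding tker_def by simp
  qed
  have Tint: "gintegrable (?T R)" for R unfolding TQ by (intro gintegrable_cmul int)
  have Tm: "?T R \<in> borel_measurable borel" for R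
  proof -
    have "(\<lambda>x. complex_of_real (QR i R (x \<bullet> y) ((norm x)\<^sup>2 * (norm y)\<^sup>2))) \<in> borel_measurable borel"
      unfolding QR_def by (intro borel_measurable_continuous_onI continuous_intros)
    then show ?thesis unfolding TQ by (intro borel_measurable_times borel_measurable_const Pm)
  qed
  obtain C c where C: "0 \<le> C" and
    b: "\<And>x. norm (of_real ((\<Sum>l\<le>i div 2. hcoef i l * \<bar>x \<bullet> y\<bar> ^ (i - 2 * l)) * exp (wedge_norm x y)) * P x) \<le> C * exp (c * norm x)"
    using expbd_mult[OF expbd_Aker_bound Pb, of i y] unfolding expbd_def by blast
  have bd: "norm (\<Sum>R<n. ?T R x) \<le> C * exp (c * norm x)" for n x
  proof -
    have "norm (\<Sum>R<n. ?T R x) = \<bar>\<Sum>R<n. tker N i R (x \<bullet> y) (?v x)\<bar> * norm (P x)"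
      by (simp add: sum_distrib_right[symmetric] norm_mult flip: of_real_sum)
    also have "\<dots> \<le> ((\<Sum>l\<le>i div 2. hcoef i l * \<bar>x \<bullet> y\<bar> ^ (i - 2 * l)) * exp (wedge_norm x y)) * norm (P x)"
      by (intro mult_right_mono tker_bound[OF N wedge_norm_nonneg]) auto
    also have "\<dots> \<le> \<bar>(\<Sum>l\<le>i div 2. hcoef i l * \<bar>x \<bullet> y\<bar> ^ (i - 2 * l)) * exp (wedge_norm x y)\<bar> * norm (P x)"
      by (intro mult_right_mono) auto
    also have "\<dots> \<le> C * exp (c * norm x)" using b[of x] by (simp only: norm_mult norm_of_real)
    finally show ?thesis .
  qed
  have s: "(\<lambda>R. ?T R x) sums (of_real (Aker N i (x \<bullet> y) (wedge_norm x y)) * P x)" for x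
    by (intro sums_mult2 sums_of_real tker_sums N)
  show "gintegrable (\<lambda>x. of_real (Aker N i (x \<bullet> y) (wedge_norm x y)) * P x)"
    by (rule gint_sums(1)[OF Tm C bd s Tint])
  have "(\<lambda>R. gint (?T R)) sums gint (\<lambda>x. of_real (Aker N i (x \<bullet> y) (wedge_norm x y)) * P x)"
    by (rule gint_sums(2)[OF Tm C bd s Tint])
  then show "(\<lambda>R. gint (?Q R) / ?D R) sums gint (\<lambda>x. of_real (Aker N i (x \<bullet> y) (wedge_norm x y)) * P x)"
    unfolding TQ gint_cmul by simp
qed

text \<open>The factor by which $\sum_j a_j |x|^{2j}$ changes the Gaussian mean of a polynomial of degree $2\beta - m$.\<close>
definition lsum :: "(nat \<Rightarrow> real) \<Rightarrow> nat \<Rightarrow> real \<Rightarrow> real" where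
  "lsum a p \<beta> = (\<Sum>j\<le>p. a j * (2 ^ j * pochhammer \<beta> j))"

abbreviation radial :: "(nat \<Rightarrow> real) \<Rightarrow> nat \<Rightarrow> real^'n::finite \<Rightarrow> complex" where
  "radial a p x \<equiv> of_real (\<Sum>j\<le>p. a j * ((norm x)\<^sup>2) ^ j)"

lemma radial_distrib:
  "of_real c * (radial a p x * h) = (\<Sum>j\<le>p. of_real (a j) * (of_real c * (of_real ((norm x)\<^sup>2) ^ j * h)))"
  by (simp add: sum_distrib_left sum_distrib_right mult_ac)

lemma QR_gintegrable:
  assumes "hpoly k H"
  shows "gintegrable (\<lambda>x. of_real (QR i R (x \<bullet> y) ((norm x)\<^sup>2 * (norm y)\<^sup>2)) * (of_real ((norm x)\<^sup>2) ^ j * H x))"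
  unfolding QR_expand
  by (intro gintegrable_sum gintegrable_cmul)
     (rule hpoly_gintegrable[OF hpoly_mult[OF hpoly_norm_sq_power hpoly_mult[OF hpoly_inner_power assms]]])

lemma radial_props:
  assumes "hpoly k H"
  shows "(\<lambda>x. radial a p x * H x) \<in> borel_measurable borel" "expbd (\<lambda>x. radial a p x * H x)"
    "gintegrable (\<lambda>x. of_real (QR i R (x \<bullet> y) ((norm x)\<^sup>2 * (norm y)\<^sup>2)) * (radial a p x * H x))"
proof -
  have cont: "continuous_on UNIV H" using assms
    by (induction rule: hpoly.induct) (auto simp: monom_fun_def intro!: continuous_intros)
  show "(\<lambda>x. radial a p x * H x) \<in> borel_measurable borel"
    by (intro borel_measurable_continuous_onI continuous_intros cont)
  have eq: "(\<lambda>x. radial a p x * H x) = (\<lambda>x. \<Sum>j\<le>p. of_real (a j) * (of_real ((norm x)\<^sup>2) ^ j * H x))"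
    by (simp add: sum_distrib_right sum_distrib_left mult_ac)
  show "expbd (\<lambda>x. radial a p x * H x)" unfolding eq
    by (intro expbd_sum expbd_mult expbd_const expbd_power hpoly_expbd[OF hpoly_norm_sq] hpoly_expbd[OF assms])
  show "gintegrable (\<lambda>x. of_real (QR i R (x \<bullet> y) ((norm x)\<^sup>2 * (norm y)\<^sup>2)) * (radial a p x * H x))"
    unfolding radial_distrib by (intro gintegrable_sum gintegrable_cmul QR_gintegrable[OF assms])
qed

lemma gint_QR_radial:
  assumes "hpoly k H"
  shows "gint (\<lambda>x. of_real (QR i R (x \<bullet> y) ((norm x)\<^sup>2 * (norm y)\<^sup>2)) * (radial a p x * H x)) =
   (\<Sum>j\<le>p. of_real (a j) * gint (\<lambda>x. of_real (QR i R (x \<bullet> y) ((norm x)\<^sup>2 * (norm y)\<^sup>2)) * (of_real ((norm x)\<^sup>2) ^ j * H x)))"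
  unfolding radial_distrib
  by (subst gint_sum, rule gintegrable_cmul, rule QR_gintegrable[OF assms]) (simp only: gint_cmul)

lemma Aker_gintegrable:
  assumes "harmonic_poly k H" "i div 2 \<le> N"
  shows "gintegrable (\<lambda>x. of_real (Aker N i (x \<bullet> y) (wedge_norm x y)) * (radial a p x * H x))"
proof -
  have H: "hpoly k H" using assms by (simp add: harmonic_poly_def)
  show ?thesis by (rule Aker_gint_sums(1)[OF assms(2) radial_props[OF H]])
qed

lemma funk_hecke_odd:
  assumes "harmonic_poly k H" "i div 2 \<le> N" "odd (i + k)"
  shows "gint (\<lambda>x. of_real (Aker N i (x \<bullet> y) (wedge_norm x y)) * (radial a p x * H x)) = 0"
proof -
  have H: "hpoly k H" using assms by (simp add: harmonic_poly_def)
  have "(\<lambda>R. gint (\<lambda>x. of_real (QR i R (x \<bullet> y) ((norm x)\<^sup>2 * (norm y)\<^sup>2)) * (radial a p x * H x)) / of_real (2 ^ (N + R - i) * fact (N + R - i)))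
      sums gint (\<lambda>x. of_real (Aker N i (x \<bullet> y) (wedge_norm x y)) * (radial a p x * H x))"
    by (rule Aker_gint_sums(2)[OF assms(2) radial_props[OF H]])
  then have "(\<lambda>R. 0) sums gint (\<lambda>x. of_real (Aker N i (x \<bullet> y) (wedge_norm x y)) * (radial a p x * H x))"
    unfolding gint_QR_radial[OF H] gint_QR_odd[OF assms(1,3)] by simp
  then show ?thesis by (simp add: sums_iff)
qed

text \<open>The terms with R < \<kappa> vanish, so the series is reindexed by q = R - \<kappa>;
  \<mu> is chosen so that N + R - i becomes \<mu> + q.\<close>

lemma funk_hecke_even:
  fixes H :: "real^'n::{finite,linorder} \<Rightarrow> complex"
  assumes harm: "harmonic_poly k H" and N: "i div 2 \<le> N" and ik: "i + k = 2 * \<kappa>" and \<mu>: "N + \<kappa> = i + \<mu>"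
  shows "(\<lambda>q. of_real (2 ^ \<kappa> * pochhammer (1/2) \<kappa> / 2 ^ \<mu> * lsum a p (real CARD('n) / 2 + real k + real q)
       * (- ((norm y)\<^sup>2) / 2) ^ q / (fact q * fact (\<mu> + q)) * pochhammer (real CARD('n) / 2 + real k - real \<kappa> - 1/2) q)
       * H y * gint (\<lambda>_::real^'n::_. 1))
    sums gint (\<lambda>x. of_real (Aker N i (x \<bullet> y) (wedge_norm x y)) * (radial a p x * H x))"
proof -
  have H: "hpoly k H" using harm by (simp add: harmonic_poly_def)
  let ?g = "gint (\<lambda>_::real^'n::_. 1)"
  let ?c = "\<lambda>R. gint (\<lambda>x. of_real (QR i R (x \<bullet> y) ((norm x)\<^sup>2 * (norm y)\<^sup>2)) * (radial a p x * H x)) / complex_of_real (2 ^ (N + R - i) * fact (N + R - i))"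
  have s: "?c sums gint (\<lambda>x. of_real (Aker N i (x \<bullet> y) (wedge_norm x y)) * (radial a p x * H x))"
    by (rule Aker_gint_sums(2)[OF N radial_props[OF H]])
  have z: "?c R = 0" if "R < \<kappa>" for R
    unfolding gint_QR_radial[OF H] gint_QR_zero[OF harm ik that] by simp
  have e: "?c (q + \<kappa>) = of_real (2 ^ \<kappa> * pochhammer (1/2) \<kappa> / 2 ^ \<mu> * lsum a p (real CARD('n) / 2 + real k + real q)
       * (- ((norm y)\<^sup>2) / 2) ^ q / (fact q * fact (\<mu> + q)) * pochhammer (real CARD('n) / 2 + real k - real \<kappa> - 1/2) q) * H y * ?g"
    (is "_ = of_real ?R * _ * _") for q
  proof -
    let ?b = "real CARD('n) / 2 + real k + real q" let ?P = "pochhammer (real CARD('n) / 2 + real k - real \<kappa> - 1/2) q"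
    let ?A = "2 ^ \<kappa> * pochhammer (1/2) \<kappa> :: real" let ?Y = "(- ((norm y)\<^sup>2)) ^ q"
    have i: "N + (q + \<kappa>) - i = \<mu> + q" using \<mu> by simp
    have "gint (\<lambda>x. of_real (QR i (q + \<kappa>) (x \<bullet> y) ((norm x)\<^sup>2 * (norm y)\<^sup>2)) * (radial a p x * H x)) =
      (\<Sum>j\<le>p. of_real (a j * (?A * (2 ^ j * pochhammer ?b j) * ?Y / fact q * ?P)) * H y * ?g)"
      unfolding gint_QR_radial[OF H] gint_QR_even[OF harm ik] by (simp only: of_real_mult mult.assoc)
    also have "\<dots> = of_real (\<Sum>j\<le>p. a j * (?A * (2 ^ j * pochhammer ?b j) * ?Y / fact q * ?P)) * H y * ?g"
      by (simp only: of_real_sum sum_distrib_right)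
    also have "(\<Sum>j\<le>p. a j * (?A * (2 ^ j * pochhammer ?b j) * ?Y / fact q * ?P)) = ?A * lsum a p ?b * ?Y / fact q * ?P"
      unfolding lsum_def sum_distrib_left sum_distrib_right sum_divide_distrib
      by (rule sum.cong[OF refl]) (simp add: mult_ac)
    finally have "?c (q + \<kappa>) = of_real (?A * lsum a p ?b * ?Y / fact q * ?P / (2 ^ (\<mu> + q) * fact (\<mu> + q))) * H y * ?g"
      unfolding i by simp
    also have "?A * lsum a p ?b * ?Y / fact q * ?P / (2 ^ (\<mu> + q) * fact (\<mu> + q)) = ?R"
    proof -
      have "(- ((norm y)\<^sup>2) / 2) ^ q = ?Y / 2 ^ q" by (rule power_divide)
      then show ?thesis by (simp only:) (simp add: power_add mult_ac)
    qed
    finally show ?thesis .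
  qed
  have "(\<lambda>q. ?c (q + \<kappa>)) sums gint (\<lambda>x. of_real (Aker N i (x \<bullet> y) (wedge_norm x y)) * (radial a p x * H x))"
    using s z by (subst sums_zero_iff_shift) auto
  then show ?thesis unfolding e .
qed

lemma pochhammer_nat: "pochhammer (real \<mu> + 1) q = fact (\<mu> + q) / fact \<mu>"
proof -
  have "pochhammer (1::real) (\<mu> + q) = pochhammer 1 \<mu> * pochhammer (1 + real \<mu>) q"
    by (rule pochhammer_product')
  then show ?thesis by (simp add: pochhammer_fact[symmetric] add.commute)
qed

section \<open>Laguerre combinations of the radial factors and their exponential series\<close>

definition lag_coef :: "nat \<Rightarrow> real \<Rightarrow> nat \<Rightarrow> real" where
  "lag_coef p \<alpha> j = (-1) ^ j * ((real p + \<alpha>) gchoose (p - j)) / fact j"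

lemma laguerre_radial: "laguerre p \<alpha> x = (\<Sum>j\<le>p. lag_coef p \<alpha> j * x ^ j)"
  unfolding laguerre_def lag_coef_def atLeast0AtMost by (simp add: mult_ac)

text \<open>The aim is the basis \<open>q choose i\<close>, whose exponential series is known.
  Vandermonde's convolution expands the Pochhammer symbol, trinomial revision frees the generalised
  binomial of j, and the sum over j is (-2)^i (1 - 2)^(p - i), the origin of the sign
  (-1)^p.\<close>

lemma lsum_laguerre:
  "lsum (lag_coef p \<alpha>) p (\<alpha> + 1 + real q) = (-1) ^ p * (\<Sum>i\<le>p. ((real p + \<alpha>) gchoose (p - i)) * 2 ^ i * real (q choose i))"
proof -
  let ?a = "real p + \<alpha>"
  have t: "lag_coef p \<alpha> j * (2 ^ j * pochhammer (\<alpha> + 1 + real q) j) =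
    (\<Sum>i\<le>j. real (q choose i) * (?a gchoose (p - i)) * ((-2) ^ j * real ((p - i) choose (j - i))))" if j: "j \<le> p" for j
  proof -
    have "pochhammer (\<alpha> + 1 + real q) j / fact j = (real q + (\<alpha> + real j)) gchoose j"
      by (simp add: gbinomial_pochhammer' algebra_simps)
    also have "\<dots> = (\<Sum>i\<le>j. (real q gchoose i) * ((\<alpha> + real j) gchoose (j - i)))"
      unfolding atMost_atLeast0 by (rule gbinomial_Vandermonde[symmetric])
    finally have v: "pochhammer (\<alpha> + 1 + real q) j / fact j = (\<Sum>i\<le>j. real (q choose i) * ((\<alpha> + real j) gchoose (j - i)))"
      by (simp add: binomial_gbinomial)
    have tri: "(?a gchoose (p - j)) * ((\<alpha> + real j) gchoose (j - i)) = (?a gchoose (p - i)) * real ((p - i) choose (j - i))" if "i \<le> j" for i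
    proof -
      have "(?a gchoose (p - i)) * (of_nat (p - i) gchoose (p - j)) = (?a gchoose (p - j)) * (?a - of_nat (p - j) gchoose (p - i - (p - j)))"
        by (rule gbinomial_trinomial_revision) (use that in simp)
      moreover have "?a - of_nat (p - j) = \<alpha> + real j" "p - i - (p - j) = j - i"
        using that j by (simp_all add: of_nat_diff)
      moreover have "(p - i) choose (p - j) = (p - i) choose (j - i)"
        using binomial_symmetric[of "p - j" "p - i"] that j by simp
      ultimately show ?thesis by (simp add: binomial_gbinomial[symmetric])
    qed
    have "lag_coef p \<alpha> j * (2 ^ j * pochhammer (\<alpha> + 1 + real q) j) = (-2) ^ j * (?a gchoose (p - j)) * (pochhammer (\<alpha> + 1 + real q) j / fact j)"
      by (simp add: lag_coef_def power_mult_distrib[symmetric] flip: power_minus)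
    also have "\<dots> = (\<Sum>i\<le>j. (-2) ^ j * real (q choose i) * ((?a gchoose (p - j)) * ((\<alpha> + real j) gchoose (j - i))))"
      unfolding v sum_distrib_left by (intro sum.cong refl) (simp only: mult_ac)
    also have "\<dots> = (\<Sum>i\<le>j. real (q choose i) * (?a gchoose (p - i)) * ((-2) ^ j * real ((p - i) choose (j - i))))"
    proof (rule sum.cong[OF refl])
      fix i assume "i \<in> {..j}"
      then have "i \<le> j" by simp
      then show "(-2) ^ j * real (q choose i) * ((?a gchoose (p - j)) * ((\<alpha> + real j) gchoose (j - i))) =
         real (q choose i) * (?a gchoose (p - i)) * ((-2) ^ j * real ((p - i) choose (j - i)))"
        unfolding tri[OF \<open>i \<le> j\<close>] by (simp only: mult_ac)
    qed
    finally show ?thesis .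
  qed
  have b: "(\<Sum>j=i..p. (-2) ^ j * real ((p - i) choose (j - i))) = (-1) ^ p * 2 ^ i" if "i \<le> p" for i
  proof -
    have "(\<Sum>j=i..p. (-2) ^ j * real ((p - i) choose (j - i))) = (\<Sum>t\<le>p - i. (-2) ^ (i + t) * real ((p - i) choose t))"
      by (rule sum.reindex_bij_witness[of _ "\<lambda>t. i + t" "\<lambda>j. j - i"]) (use that in auto)
    also have "\<dots> = (-2) ^ i * (\<Sum>t\<le>p - i. real ((p - i) choose t) * (-2) ^ t * 1 ^ (p - i - t))"
      by (simp add: power_add sum_distrib_left mult_ac)
    also have "\<dots> = (-2) ^ i * (-2 + 1) ^ (p - i)" by (simp only: binomial_ring)
    also have "\<dots> = (-1) ^ i * (-1) ^ (p - i) * 2 ^ i" by (simp add: power_minus[of 2])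
    also have "(-1) ^ i * (-1) ^ (p - i) = ((-1) ^ p :: real)" using that by (simp flip: power_add)
    finally show ?thesis .
  qed
  have "lsum (lag_coef p \<alpha>) p (\<alpha> + 1 + real q) = (\<Sum>j\<le>p. \<Sum>i\<le>j. real (q choose i) * (?a gchoose (p - i)) * ((-2) ^ j * real ((p - i) choose (j - i))))"
    unfolding lsum_def using t by (intro sum.cong) auto
  also have "\<dots> = (\<Sum>i\<le>p. \<Sum>j=i..p. real (q choose i) * (?a gchoose (p - i)) * ((-2) ^ j * real ((p - i) choose (j - i))))"
    by (subst (1 2) sum.Sigma, simp_all, rule sum.reindex_bij_witness[of _ "\<lambda>(i, j). (j, i)" "\<lambda>(j, i). (i, j)"]) auto
  also have "\<dots> = (\<Sum>i\<le>p. real (q choose i) * (?a gchoose (p - i)) * ((-1) ^ p * 2 ^ i))"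
    unfolding sum_distrib_left[symmetric] by (intro sum.cong refl) (simp add: b)
  finally show ?thesis by (simp add: sum_distrib_left mult_ac)
qed

text \<open>With w = -u/2 the sum of (q choose i) w^q / q! is w^i / i! times exp w, and 2^i w^i =
  (-u)^i restores the Laguerre coefficients.\<close>

lemma lsum_laguerre_sums:
  "(\<lambda>q. lsum (lag_coef p \<alpha>) p (\<alpha> + 1 + real q) * (- u / 2) ^ q / fact q) sums ((-1) ^ p * laguerre p \<alpha> u * exp (- u / 2))"
proof -
  let ?w = "- u / 2"
  have e: "(\<lambda>q. real (q choose i) * ?w ^ q / fact q) sums (?w ^ i / fact i * exp ?w)" for i
  proof -
    have "(\<lambda>t. ?w ^ t /\<^sub>R fact t) sums exp ?w" by (rule exp_converges)
    then have "(\<lambda>t. ?w ^ i / fact i * (?w ^ t /\<^sub>R fact t)) sums (?w ^ i / fact i * exp ?w)" by (rule sums_mult)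
    moreover have "?w ^ i / fact i * (?w ^ t /\<^sub>R fact t) = real (t + i choose i) * ?w ^ (t + i) / fact (t + i)" for t
    proof -
      have "real (t + i choose i) = fact (t + i) / (fact i * fact t)"
        using binomial_fact[of i "t + i", where 'a = real] by simp
      then show ?thesis unfolding power_add real_scaleR_def inverse_eq_divide by simp
    qed
    ultimately have "(\<lambda>t. real (t + i choose i) * ?w ^ (t + i) / fact (t + i)) sums (?w ^ i / fact i * exp ?w)"
      by (simp only:)
    then show ?thesis by (subst (asm) sums_zero_iff_shift) (auto simp: binomial_eq_0)
  qed
  have "(\<lambda>q. (-1) ^ p * (\<Sum>i\<le>p. ((real p + \<alpha>) gchoose (p - i)) * 2 ^ i * (real (q choose i) * ?w ^ q / fact q))) sums
     ((-1) ^ p * (\<Sum>i\<le>p. ((real p + \<alpha>) gchoose (p - i)) * 2 ^ i * (?w ^ i / fact i * exp ?w)))"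
    by (intro sums_mult sums_sum e)
  moreover have "(-1) ^ p * (\<Sum>i\<le>p. ((real p + \<alpha>) gchoose (p - i)) * 2 ^ i * (real (q choose i) * ?w ^ q / fact q)) =
     lsum (lag_coef p \<alpha>) p (\<alpha> + 1 + real q) * ?w ^ q / fact q" for q
    unfolding lsum_laguerre sum_distrib_left sum_distrib_right sum_divide_distrib
    by (intro sum.cong refl) simp
  moreover have "(-1) ^ p * (\<Sum>i\<le>p. ((real p + \<alpha>) gchoose (p - i)) * 2 ^ i * (?w ^ i / fact i * exp ?w)) = (-1) ^ p * laguerre p \<alpha> u * exp ?w"
  proof -
    have *: "((real p + \<alpha>) gchoose (p - i)) * 2 ^ i * (?w ^ i / fact i * exp ?w) = ((-1) ^ i * ((real p + \<alpha>) gchoose (p - i)) * u ^ i / fact i) * exp ?w" for i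
    proof -
      have "2 ^ i * ?w ^ i = (2 * ?w) ^ i" by (rule power_mult_distrib[symmetric])
      also have "2 * ?w = -1 * u" by simp
      also have "(-1 * u) ^ i = (-1) ^ i * u ^ i" by (rule power_mult_distrib)
      finally have w: "2 ^ i * ?w ^ i = (-1) ^ i * u ^ i" .
      have "((real p + \<alpha>) gchoose (p - i)) * 2 ^ i * (?w ^ i / fact i * exp ?w) = ((real p + \<alpha>) gchoose (p - i)) * (2 ^ i * ?w ^ i) / fact i * exp ?w"
        by (simp only: times_divide_eq_left times_divide_eq_right mult.assoc)
      then show ?thesis unfolding w by (simp only: mult_ac)
    qed
    show ?thesis unfolding laguerre_def atLeast0AtMost * sum_distrib_right[symmetric] by simp
  qed
  ultimately show ?thesis by (simp only:)
qed

section \<open>Clifford algebra and spherical monogenics\<close>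

definition symd :: "'a set \<Rightarrow> 'a set \<Rightarrow> 'a set" where
  "symd A B = (A - B) \<union> (B - A)"

lemma symd_eq_iff: "symd A B = C \<longleftrightarrow> B = symd A C"
  by (auto simp: symd_def)

lemma symd_invol [simp]: "symd A (symd A B) = B"
  by (auto simp: symd_def)

lemma clif_mult_alt: "clif_mult a b C = (\<Sum>A\<in>UNIV. clif_sign A (symd A C) * a A * b (symd A C))"
  unfolding clif_mult_def symd_def[symmetric] symd_eq_iff by (simp add: sum.delta)

text \<open>The sign of e_j e_B: one change for each smaller generator that e_j passes, and one for
  e_j e_j = -1 if j lies in B.\<close>

definition esign :: "'n::{finite,linorder} \<Rightarrow> 'n set \<Rightarrow> complex" where
  "esign j B = (-1) ^ (card {b \<in> B. b < j} + (if j \<in> B then 1 else 0))"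

text \<open>Left multiplication by $e_j$.\<close>
definition emul :: "'n::{finite,linorder} \<Rightarrow> 'n clif \<Rightarrow> 'n clif" where
  "emul j a C = esign j (symd {j} C) * a (symd {j} C)"

lemma esign_sq: "esign j B * esign j B = 1"
  by (simp add: esign_def flip: power_add)

lemma esign_symd_self: "esign j (symd {j} B) = - esign j B"
proof -
  have "{b \<in> symd {j} B. b < j} = {b \<in> B. b < j}" by (auto simp: symd_def)
  moreover have "j \<in> symd {j} B \<longleftrightarrow> j \<notin> B" by (auto simp: symd_def)
  ultimately show ?thesis by (simp add: esign_def)
qed

lemma esign_symd_greater:
  assumes "j < k"
  shows "esign j (symd {k} B) = esign j B"
proof -
  have "{b \<in> symd {k} B. b < j} = {b \<in> B. b < j}" "j \<in> symd {k} B \<longleftrightarrow> j \<in> B"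
    using assms by (auto simp: symd_def)
  then show ?thesis by (simp add: esign_def)
qed

text \<open>Together with \<open>esign_symd_greater\<close> this encodes anticommutation: of two
  different generators, exactly one notices whether the other is present.\<close>

lemma esign_symd_less:
  assumes "j < k"
  shows "esign k (symd {j} B) = - esign k B"
proof -
  have k: "k \<in> symd {j} B \<longleftrightarrow> k \<in> B" using assms by (auto simp: symd_def)
  show ?thesis
  proof (cases "j \<in> B")
    case True
    then have "{b \<in> B. b < k} = insert j {b \<in> symd {j} B. b < k}" "j \<notin> {b \<in> symd {j} B. b < k}"
      using assms by (auto simp: symd_def)
    then have "card {b \<in> B. b < k} = Suc (card {b \<in> symd {j} B. b < k})" by simp
    then show ?thesis by (simp add: esign_def k)
  next
    case False
    then have "{b \<in> symd {j} B. b < k} = insert j {b \<in> B. b < k}" "j \<notin> {b \<in> B. b < k}"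
      using assms by (auto simp: symd_def)
    then have "card {b \<in> symd {j} B. b < k} = Suc (card {b \<in> B. b < k})" by simp
    then show ?thesis by (simp add: esign_def k)
  qed
qed

lemma clif_sign_single: "clif_sign {j} B = esign j B"
proof -
  have "{(a, b). a \<in> {j} \<and> b \<in> B \<and> b < a} = Pair j ` {b \<in> B. b < j}" by auto
  then have "card {(a, b). a \<in> {j} \<and> b \<in> B \<and> b < a} = card {b \<in> B. b < j}"
    by (simp add: card_image inj_on_def)
  then show ?thesis by (simp add: clif_sign_def esign_def)
qed

lemma clif_sign_pair:
  assumes "j < k"
  shows "clif_sign {j, k} B = esign j B * esign k B"
proof -
  have "{(a, b). a \<in> {j, k} \<and> b \<in> B \<and> b < a} = Pair j ` {b \<in> B. b < j} \<union> Pair k ` {b \<in> B. b < k}" by auto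
  moreover have "Pair j ` {b \<in> B. b < j} \<inter> Pair k ` {b \<in> B. b < k} = {}" using assms by auto
  ultimately have c: "card {(a, b). a \<in> {j, k} \<and> b \<in> B \<and> b < a} = card {b \<in> B. b < j} + card {b \<in> B. b < k}"
    by (simp add: card_Un_disjoint card_image inj_on_def)
  have "card ({j, k} \<inter> B) = (if j \<in> B then 1 else 0) + (if k \<in> B then 1 else 0)"
    using assms by (auto simp: Int_insert_left)
  with c show ?thesis by (simp add: clif_sign_def esign_def power_add mult_ac)
qed

lemma emul_square: "emul j (emul j a) C = - a C"
  using esign_sq[of j C] by (simp add: emul_def esign_symd_self)

lemma emul_pair:
  assumes "j < k"
  shows "emul j (emul k a) C = clif_sign {j, k} (symd {j, k} C) * a (symd {j, k} C)"
    and "emul k (emul j a) C = - emul j (emul k a) C"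
proof -
  let ?B = "symd {j, k} C"
  have B: "symd {k} (symd {j} C) = ?B" "symd {j} C = symd {k} ?B" "symd {k} C = symd {j} ?B" "symd {j} (symd {k} C) = ?B"
    using assms by (auto simp: symd_def)
  show 1: "emul j (emul k a) C = clif_sign {j, k} ?B * a ?B"
    unfolding emul_def B(1) clif_sign_pair[OF assms] unfolding B(2) esign_symd_greater[OF assms] by simp
  show "emul k (emul j a) C = - emul j (emul k a) C"
    unfolding 1 unfolding emul_def B(4) clif_sign_pair[OF assms] unfolding B(3) esign_symd_less[OF assms] by simp
qed

lemma emul_sum: "emul j (\<lambda>A. \<Sum>i\<in>I. f i A) C = (\<Sum>i\<in>I. emul j (f i) C)"
  by (simp add: emul_def sum_distrib_left)

lemma emul_cmul: "emul j (\<lambda>A. c * f A) C = c * emul j f C"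
  by (simp add: emul_def)

lemma clif_mult_gen: "clif_mult (clif_gen j) a C = emul j a C"
proof -
  have "clif_mult (clif_gen j) a C = (\<Sum>A\<in>UNIV. if A = {j} then clif_sign {j} (symd {j} C) * a (symd {j} C) else 0)"
    unfolding clif_mult_alt clif_gen_def by (intro sum.cong refl) auto
  then show ?thesis by (simp add: emul_def clif_sign_single)
qed

lemma clif_mult_vec: "clif_mult (clif_vec x) a C = (\<Sum>j\<in>UNIV. of_real (x$j) * emul j a C)"
proof -
  have "clif_mult (clif_vec x) a C = (\<Sum>A\<in>UNIV. \<Sum>j\<in>UNIV. if A = {j} then of_real (x$j) * (clif_sign {j} (symd {j} C) * a (symd {j} C)) else 0)"
    unfolding clif_mult_alt clif_vec_def sum_distrib_left sum_distrib_right by (intro sum.cong refl) auto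
  also have "\<dots> = (\<Sum>j\<in>UNIV. \<Sum>A\<in>UNIV. if A = {j} then of_real (x$j) * (clif_sign {j} (symd {j} C) * a (symd {j} C)) else 0)"
    by (rule sum.swap)
  finally show ?thesis by (simp add: emul_def clif_sign_single)
qed

lemma clif_mult_wedge: "clif_mult (clif_wedge x y) a C =
  (\<Sum>j\<in>UNIV. \<Sum>k\<in>UNIV. if j < k then of_real (x$j * y$k - x$k * y$j) * emul j (emul k a) C else 0)"
proof -
  let ?f = "\<lambda>j k. of_real (x$j * y$k - x$k * y$j) * (clif_sign {j, k} (symd {j, k} C) * a (symd {j, k} C))"
  have "clif_mult (clif_wedge x y) a C = (\<Sum>A\<in>UNIV. \<Sum>j\<in>UNIV. \<Sum>k\<in>UNIV. if A = {j, k} then (if j < k then ?f j k else 0) else 0)"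
    unfolding clif_mult_alt clif_wedge_def sum_distrib_left sum_distrib_right by (intro sum.cong refl) auto
  also have "\<dots> = (\<Sum>j\<in>UNIV. \<Sum>k\<in>UNIV. \<Sum>A\<in>UNIV. if A = {j, k} then (if j < k then ?f j k else 0) else 0)"
    by (subst sum.swap, rule sum.cong[OF refl], rule sum.swap)
  also have "\<dots> = (\<Sum>j\<in>UNIV. \<Sum>k\<in>UNIV. if j < k then ?f j k else 0)"
    by (simp add: sum.delta)
  finally show ?thesis by (simp add: emul_pair(1) cong: if_cong)
qed

text \<open>Grouping (j,k) with (k,j) exposes the anticommutation of generators: used for the
  product of two vectors and for the square of the Dirac operator.\<close>

lemma double_sum_split:
  fixes F :: "'n::{finite,linorder} \<Rightarrow> 'n \<Rightarrow> complex"
  shows "(\<Sum>j\<in>UNIV. \<Sum>k\<in>UNIV. F j k) = (\<Sum>j\<in>UNIV. F j j) + (\<Sum>j\<in>UNIV. \<Sum>k\<in>UNIV. if j < k then F j k + F k j else 0)"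
proof -
  have "(\<Sum>j\<in>UNIV. \<Sum>k\<in>UNIV. F j k) =
    (\<Sum>j\<in>UNIV. \<Sum>k\<in>UNIV. (if j = k then F j k else 0) + (if j < k then F j k else 0) + (if k < j then F j k else 0))"
    by (intro sum.cong refl) auto
  also have "\<dots> = (\<Sum>j\<in>UNIV. F j j) + (\<Sum>j\<in>UNIV. \<Sum>k\<in>UNIV. if j < k then F j k else 0) + (\<Sum>j\<in>UNIV. \<Sum>k\<in>UNIV. if k < j then F j k else 0)"
    by (simp add: sum.distrib)
  also have "(\<Sum>j\<in>UNIV. \<Sum>k\<in>UNIV. if k < j then F j k else 0) = (\<Sum>j\<in>UNIV. \<Sum>k\<in>UNIV. if j < k then F k j else 0)"
    by (rule sum.swap)
  finally show ?thesis
    by (simp add: add.assoc sum.distrib[symmetric] if_distrib cong: if_cong)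
qed

lemma vec_vec_mult:
  fixes x y :: "real^'n::{finite,linorder}"
  shows "clif_mult (clif_vec y) (clif_mult (clif_vec x) a) C = - of_real (x \<bullet> y) * a C - clif_mult (clif_wedge x y) a C"
proof -
  have e: "clif_mult (clif_vec x) a = (\<lambda>A. \<Sum>k\<in>UNIV. of_real (x$k) * emul k a A)"
    by (rule ext) (rule clif_mult_vec)
  have "clif_mult (clif_vec y) (clif_mult (clif_vec x) a) C = (\<Sum>j\<in>UNIV. \<Sum>k\<in>UNIV. of_real (y$j) * (of_real (x$k) * emul j (emul k a) C))"
    unfolding clif_mult_vec[of y] e emul_sum emul_cmul by (simp only: sum_distrib_left)
  also have "\<dots> = (\<Sum>j\<in>UNIV. of_real (y$j) * (of_real (x$j) * - a C)) +
     (\<Sum>j\<in>UNIV. \<Sum>k\<in>UNIV. if j < k then of_real (y$j) * (of_real (x$k) * emul j (emul k a) C) + of_real (y$k) * (of_real (x$j) * emul k (emul j a) C) else 0)"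
    unfolding double_sum_split[of "\<lambda>j k. of_real (y$j) * (of_real (x$k) * emul j (emul k a) C)"] emul_square ..
  also have "(\<Sum>j\<in>UNIV. of_real (y$j) * (of_real (x$j) * - a C)) = - of_real (x \<bullet> y) * a C"
    by (simp add: inner_vec_sum sum_distrib_right sum_distrib_left sum_negf mult_ac)
  also have "(\<Sum>j\<in>UNIV. \<Sum>k\<in>UNIV. if j < k then of_real (y$j) * (of_real (x$k) * emul j (emul k a) C) + of_real (y$k) * (of_real (x$j) * emul k (emul j a) C) else 0)
     = (\<Sum>j\<in>UNIV. \<Sum>k\<in>UNIV. - (if j < k then of_real (x$j * y$k - x$k * y$j) * emul j (emul k a) C else 0))"
    by (intro sum.cong refl) (auto simp: emul_pair(2) algebra_simps)
  also have "\<dots> = - clif_mult (clif_wedge x y) a C"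
    unfolding clif_mult_wedge sum_negf ..
  finally show ?thesis by simp
qed

lemma vec_square:
  fixes y :: "real^'n::{finite,linorder}"
  shows "clif_mult (clif_vec y) (clif_mult (clif_vec y) a) C = - of_real ((norm y)\<^sup>2) * a C"
  unfolding vec_vec_mult clif_mult_wedge by (simp add: power2_norm_eq_inner mult.commute cong: if_cong)

section \<open>Harmonicity of the components of a monogenic and of its product with x\<close>

lemma harmonic_cmul: 
  assumes "harmonic_poly k H" shows "harmonic_poly k (\<lambda>x. c * H x)"
proof -
  have H: "hpoly k H" and h: "\<And>x. (\<Sum>j\<in>UNIV. pd j (pd j H) x) = 0" using assms by (auto simp: harmonic_poly_def)
  have "pd j (pd j (\<lambda>x. c * H x)) = (\<lambda>x. c * pd j (pd j H) x)" for j
    by (simp add: pd_cmul[OF H] pd_cmul[OF hpoly_pd_pred[OF H]])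
  then show ?thesis unfolding harmonic_poly_def using hpoly_cmul[OF H] h
    by (simp add: sum_distrib_left[symmetric])
qed

lemma harmonic_sum:
  assumes "finite I" and "\<And>i. i \<in> I \<Longrightarrow> harmonic_poly k (f i)"
  shows "harmonic_poly k (\<lambda>x. \<Sum>i\<in>I. f i x)"
proof -
  have H: "hpoly k (f i)" and h: "\<And>x. (\<Sum>j\<in>UNIV. pd j (pd j (f i)) x) = 0" if "i \<in> I" for i using assms(2)[OF that] by (auto simp: harmonic_poly_def)
  have "pd j (pd j (\<lambda>x. \<Sum>i\<in>I. f i x)) = (\<lambda>x. \<Sum>i\<in>I. pd j (pd j (f i)) x)" for j
    by (simp add: pd_sum[OF assms(1) H] pd_sum[OF assms(1) hpoly_pd_pred[OF H]])
  moreover have "(\<Sum>j\<in>UNIV. \<Sum>i\<in>I. pd j (pd j (f i)) x) = 0" for x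
    by (subst sum.swap) (simp add: h)
  ultimately show ?thesis unfolding harmonic_poly_def using hpoly_sum[OF assms(1) H] by simp
qed

text \<open>The Laplacian of the sum of x_j G_j is the sum of x_j times the Laplacian of G_j, plus
  twice the divergence of G.\<close>

lemma harmonic_coord_sum:
  fixes G :: "'n::finite \<Rightarrow> real^'n \<Rightarrow> complex"
  assumes G: "\<And>j. harmonic_poly k (G j)" and div: "\<And>x. (\<Sum>j\<in>UNIV. pd j (G j) x) = 0"
  shows "harmonic_poly (Suc k) (\<lambda>x. \<Sum>j\<in>UNIV. of_real (x$j) * G j x)"
proof -
  have H: "hpoly k (G j)" and h: "\<And>x. (\<Sum>i\<in>UNIV. pd i (pd i (G j)) x) = 0" for j using G[of j] by (auto simp: harmonic_poly_def)
  have xG: "hpoly (Suc k) (\<lambda>x. of_real (x$j) * G j x)" for j by (rule hpoly_coord_mult[OF H])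
  have p1: "pd i (\<lambda>x. of_real (x$j) * G j x) = (\<lambda>x. of_real (x$j) * pd i (G j) x + (if j = i then 1 else 0) * G j x)" for i j
    unfolding pd_mult[OF hpoly_coord H] pd_coord ..
  have hp: "hpoly (k - 1) (pd i (G j))" for i j by (rule hpoly_pd_pred[OF H])
  have p2: "pd i (pd i (\<lambda>x. of_real (x$j) * G j x)) =
     (\<lambda>x. of_real (x$j) * pd i (pd i (G j)) x + (if j = i then 1 else 0) * pd i (G j) x + (if j = i then 1 else 0) * pd i (G j) x)" for i j
    unfolding p1 pd_add[OF hpoly_mult[OF hpoly_coord hp] hpoly_cmul[OF H]] pd_mult[OF hpoly_coord hp] pd_coord pd_cmul[OF H] ..
  have "pd i (pd i (\<lambda>x. \<Sum>j\<in>UNIV. of_real (x$j) * G j x)) x = (\<Sum>j\<in>UNIV. of_real (x$j) * pd i (pd i (G j)) x) + 2 * pd i (G i) x" for i x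
  proof -
    have "pd i (\<lambda>x. \<Sum>j\<in>UNIV. of_real (x$j) * G j x) = (\<lambda>x. \<Sum>j\<in>UNIV. pd i (\<lambda>x. of_real (x$j) * G j x) x)"
      by (rule pd_sum[OF _ xG]) simp
    then have "pd i (pd i (\<lambda>x. \<Sum>j\<in>UNIV. of_real (x$j) * G j x)) = (\<lambda>x. \<Sum>j\<in>UNIV. pd i (pd i (\<lambda>x. of_real (x$j) * G j x)) x)"
      by (simp only:) (rule pd_sum[OF _ hpoly_pd_pred[OF xG]], simp)
    moreover have "(\<Sum>j\<in>UNIV. (if j = i then 1 else 0) * pd i (G j) x) = pd i (G i) x"
    proof -
      have "(\<Sum>j\<in>UNIV. (if j = i then 1 else 0) * pd i (G j) x) = (\<Sum>j\<in>UNIV. if j = i then pd i (G j) x else 0)"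
        by (rule sum.cong) auto
      then show ?thesis by simp
    qed
    ultimately show ?thesis unfolding p2 by (simp only: sum.distrib) simp
  qed
  then have "(\<Sum>i\<in>UNIV. pd i (pd i (\<lambda>x. \<Sum>j\<in>UNIV. of_real (x$j) * G j x)) x) =
     (\<Sum>j\<in>UNIV. of_real (x$j) * (\<Sum>i\<in>UNIV. pd i (pd i (G j)) x)) + 2 * (\<Sum>i\<in>UNIV. pd i (G i) x)" for x
    by (simp add: sum.distrib sum_distrib_left) (rule sum.swap)
  moreover have "hpoly (Suc k) (\<lambda>x. \<Sum>j\<in>UNIV. of_real (x$j) * G j x)" by (rule hpoly_sum[OF _ xG]) simp
  ultimately show ?thesis unfolding harmonic_poly_def by (simp add: h div)
qed

context
  fixes k :: nat and M :: "real^'n::{finite,linorder} \<Rightarrow> 'n clif"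
  assumes sm: "spherical_monogenic k M"
begin

lemma monogenic_hpoly: "hpoly k (\<lambda>x. M x A)"
proof -
  obtain c :: "('n \<Rightarrow> nat) \<Rightarrow> 'n set \<Rightarrow> real" where c: "\<And>x A. M x A = complex_of_real (\<Sum>\<alpha>\<in>{\<alpha>. sum \<alpha> UNIV = k}. c \<alpha> A * (\<Prod>j\<in>UNIV. (x$j) ^ \<alpha> j))"
    using sm unfolding spherical_monogenic_def by blast
  have "(\<lambda>x. M x A) = (\<lambda>x. \<Sum>\<alpha>\<in>{\<alpha>. sum \<alpha> UNIV = k}. of_real (c \<alpha> A) * of_real (monom_fun \<alpha> x))"
    unfolding c monom_fun_def by simp
  moreover have "hpoly k (\<lambda>x::real^'n::_. \<Sum>\<alpha>\<in>{\<alpha>. sum \<alpha> UNIV = k}. of_real (c \<alpha> A) * of_real (monom_fun \<alpha> x))"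
    \<comment> \<open>A sum over an infinite set is 0 by convention, and 0 is homogeneous of every
      degree, so the finiteness of the index set need not be established.\<close>
    by (cases "finite {\<alpha>::'n \<Rightarrow> nat. sum \<alpha> UNIV = k}") (auto intro!: hpoly_sum hpoly_monom hpoly_0)
  ultimately show ?thesis by simp
qed

lemma monogenic_dirac: "(\<Sum>j\<in>UNIV. emul j (\<lambda>A. pd j (\<lambda>x. M x A) x) C) = 0"
proof -
  have "dirac M x C = 0" using sm by (simp add: spherical_monogenic_def)
  then show ?thesis by (simp add: dirac_def clif_mult_gen clif_partial_def pd_def)
qed

text \<open>The Dirac operator squares to minus the Laplacian: the mixed terms cancel in pairs
  because generators anticommute while derivatives commute.\<close>

lemma monogenic_harmonic: "harmonic_poly k (\<lambda>x. M x C)"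
proof -
  let ?P = "\<lambda>x i j A. pd i (pd j (\<lambda>x. M x A)) x"
  have 1: "(\<Sum>j\<in>UNIV. emul j (?P x i j) C) = 0" for x i C
  proof -
    have "pd i (\<lambda>x. \<Sum>j\<in>UNIV. emul j (\<lambda>A. pd j (\<lambda>x. M x A) x) C) = (\<lambda>x. \<Sum>j\<in>UNIV. emul j (?P x i j) C)"
      unfolding emul_def
      by (subst pd_sum[OF _ hpoly_cmul[OF hpoly_pd_pred[OF monogenic_hpoly]]])
         (simp_all add: pd_cmul[OF hpoly_pd_pred[OF monogenic_hpoly]])
    then show ?thesis unfolding monogenic_dirac pd_hpoly0[OF hpoly_const] by (rule fun_cong[symmetric])
  qed
  have "(\<Sum>i\<in>UNIV. pd i (pd i (\<lambda>x. M x C)) x) = 0" for x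
  proof -
    let ?F = "\<lambda>i j. emul i (emul j (?P x i j)) C"
    have "0 = (\<Sum>i\<in>UNIV. emul i (\<lambda>C. \<Sum>j\<in>UNIV. emul j (?P x i j) C) C)"
      unfolding 1 by (simp add: emul_def)
    also have "\<dots> = (\<Sum>i\<in>UNIV. \<Sum>j\<in>UNIV. ?F i j)" by (simp only: emul_sum)
    also have "\<dots> = (\<Sum>i\<in>UNIV. ?F i i)"
    proof -
      have "?F j i = - ?F i j" if "i < j" for i j
      proof -
        have "?P x j i = ?P x i j" by (rule ext) (simp only: pd_commute[OF monogenic_hpoly, of j i])
        then show ?thesis using that emul_pair(2)[of i j "?P x i j" C] by (simp only:)
      qed
      then have "(\<Sum>i\<in>UNIV. \<Sum>j\<in>UNIV. if i < j then ?F i j + ?F j i else 0) = 0"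
        by (intro sum.neutral ballI) auto
      then show ?thesis unfolding double_sum_split[of ?F] by simp
    qed
    finally show ?thesis unfolding emul_square by (simp add: sum_negf)
  qed
  then show ?thesis by (simp add: harmonic_poly_def monogenic_hpoly)
qed

text \<open>With G_j = e_j M the divergence condition of \<open>harmonic_coord_sum\<close> is
  exactly the Dirac equation.\<close>

lemma vec_monogenic_harmonic: "harmonic_poly (Suc k) (\<lambda>x. clif_mult (clif_vec x) (M x) C)"
  unfolding clif_mult_vec
proof (rule harmonic_coord_sum)
  show "harmonic_poly k (\<lambda>x. emul j (M x) C)" for j
    unfolding emul_def by (intro harmonic_cmul monogenic_harmonic)
  show "(\<Sum>j\<in>UNIV. pd j (\<lambda>x. emul j (M x) C) x) = 0" for x
    using monogenic_dirac[of x C] unfolding emul_def pd_cmul[OF monogenic_hpoly] .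
qed

end

lemma vec_mult_harmonic:
  assumes "\<And>A. harmonic_poly k (\<lambda>x. F x A)"
  shows "harmonic_poly k (\<lambda>x. clif_mult (clif_vec y) (F x) C)"
  unfolding clif_mult_vec emul_def by (intro harmonic_sum harmonic_cmul assms) simp

section \<open>Closed forms of the eigenvalues\<close>

text \<open>Absorbs the |x|^2 that arises from x(xM) = -|x|^2 M into the radial polynomial, so that
  the general formulas apply with p + 1.\<close>

lemma radial_shift:
  "radial (\<lambda>j. case j of 0 \<Rightarrow> 0 | Suc j \<Rightarrow> a j) (Suc p) x = of_real ((norm x)\<^sup>2) * radial a p x"
  unfolding sum.atMost_Suc_shift by (simp add: sum_distrib_left mult_ac)

lemma lsum_shift:
  "lsum (\<lambda>j. case j of 0 \<Rightarrow> 0 | Suc j \<Rightarrow> a j) (Suc p) \<beta> = 2 * \<beta> * lsum a p (\<beta> + 1)"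
  unfolding lsum_def sum.atMost_Suc_shift by (simp add: sum_distrib_left pochhammer_rec mult_ac)

text \<open>For m = 2N + 3 the Vandermonde parameter equals \<mu> + 1, so its Pochhammer symbol
  cancels (\<mu> + q)! up to the constant \<mu>!, and an exponential series remains.\<close>

lemma gint_hat:
  fixes H :: "real^'n::{finite,linorder} \<Rightarrow> complex"
  assumes harm: "harmonic_poly k H" and m: "CARD('n) = 2 * N + 3"
    and N: "i div 2 \<le> N" and ik: "i + k = 2 * \<kappa>" and \<mu>: "N + \<kappa> = i + \<mu>"
    and S: "(\<lambda>q. lsum a p (real CARD('n) / 2 + real k + real q) * (- ((norm y)\<^sup>2) / 2) ^ q / fact q) sums S"
  shows "gint (\<lambda>x. of_real (Aker N i (x \<bullet> y) (wedge_norm x y)) * (radial a p x * H x)) =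
    of_real (2 ^ \<kappa> * pochhammer (1/2) \<kappa> / (2 ^ \<mu> * fact \<mu>) * S) * H y * gint (\<lambda>_::real^'n::_. 1)"
proof -
  let ?c = "2 ^ \<kappa> * pochhammer (1/2) \<kappa> / (2 ^ \<mu> * fact \<mu>) :: real"
  let ?l = "\<lambda>q. lsum a p (real CARD('n) / 2 + real k + real q)" let ?w = "- ((norm y)\<^sup>2) / 2"
  let ?g = "gint (\<lambda>_::real^'n::_. 1)"
  have "real CARD('n) / 2 + real k - real \<kappa> - 1/2 = real \<mu> + 1"
    using m ik \<mu> by (simp add: field_simps)
  then have "2 ^ \<kappa> * pochhammer (1/2) \<kappa> / 2 ^ \<mu> * ?l q * ?w ^ q / (fact q * fact (\<mu> + q)) * pochhammer (real CARD('n) / 2 + real k - real \<kappa> - 1/2) q =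
     ?c * (?l q * ?w ^ q / fact q)" for q
    by (simp only: pochhammer_nat) (simp add: mult_ac)
  then have "(\<lambda>q. of_real (?c * (?l q * ?w ^ q / fact q)) * H y * ?g) sums
      gint (\<lambda>x. of_real (Aker N i (x \<bullet> y) (wedge_norm x y)) * (radial a p x * H x))"
    using funk_hecke_even[OF harm N ik \<mu>, of a p y] by (simp only:)
  moreover have "(\<lambda>q. of_real (?c * (?l q * ?w ^ q / fact q)) * H y * ?g) sums (of_real (?c * S) * H y * ?g)"
    by (intro sums_mult2 sums_of_real sums_mult S)
  ultimately show ?thesis by (rule sums_unique2)
qed

text \<open>The first integral carries (\<mu>)_q, one short of what would cancel (\<mu> + q)!. The
  second, with H' of degree k + 1, supplies the missing part: \<mu> (\<mu>+1)_(q-1) + q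
  (\<mu>+1)_(q-1) = (\<mu>+1)_q.\<close>

lemma gint_even_pair:
  fixes H :: "real^'n::{finite,linorder} \<Rightarrow> complex"
  assumes harm: "harmonic_poly k H" and harm': "harmonic_poly (Suc k) H'" and HH: "H' y = - of_real ((norm y)\<^sup>2) * H y"
    and m: "CARD('n) = 2 * \<nu> + 1"
    and N: "Suc i div 2 \<le> \<nu>" and ik: "Suc i + k = 2 * \<kappa>" and \<mu>: "\<nu> + \<kappa> = Suc i + \<mu>"
    and S: "(\<lambda>q. lsum a p (real CARD('n) / 2 + real k + real q) * (- ((norm y)\<^sup>2) / 2) ^ q / fact q) sums S"
  shows "gint (\<lambda>x. of_real (Aker \<nu> (Suc i) (x \<bullet> y) (wedge_norm x y)) * (radial a p x * H x)) +
    gint (\<lambda>x. of_real (Aker \<nu> i (x \<bullet> y) (wedge_norm x y)) * (radial a p x * H' x)) =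
    of_real (2 ^ \<kappa> * pochhammer (1/2) \<kappa> / (2 ^ \<mu> * fact \<mu>) * S) * H y * gint (\<lambda>_::real^'n::_. 1)"
    (is "?I1 + ?I2 = _")
proof -
  let ?D = "2 ^ \<kappa> * pochhammer (1/2) \<kappa> / 2 ^ \<mu> :: real"
  let ?l = "\<lambda>q. lsum a p (real CARD('n) / 2 + real k + real q)" let ?u = "(norm y)\<^sup>2" let ?w = "- ((norm y)\<^sup>2) / 2"
  let ?g = "gint (\<lambda>_::real^'n::_. 1)"
  define c1 where "c1 q = ?D * ?l q * ?w ^ q / (fact q * fact (\<mu> + q)) * pochhammer (real \<mu>) q" for q
  define c2 where "c2 q = 2 ^ \<kappa> * pochhammer (1/2) \<kappa> / 2 ^ (Suc \<mu>) * ?l (Suc q) * ?w ^ q / (fact q * fact (Suc \<mu> + q)) * pochhammer (real \<mu> + 1) q" for q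
  have e1: "real CARD('n) / 2 + real k - real \<kappa> - 1/2 = real \<mu>" and e2: "real CARD('n) / 2 + real (Suc k) - real \<kappa> - 1/2 = real \<mu> + 1"
    using m ik \<mu> by (simp_all add: field_simps)
  have s1: "(\<lambda>q. of_real (c1 q) * H y * ?g) sums ?I1"
    using funk_hecke_even[OF harm N ik \<mu>, of a p y] unfolding c1_def e1 .
  have "i div 2 \<le> \<nu>" "i + Suc k = 2 * \<kappa>" "\<nu> + \<kappa> = i + Suc \<mu>" using N ik \<mu> by auto
  from funk_hecke_even[OF harm' this, of a p y]
  have s2: "(\<lambda>q. of_real (c2 q) * H' y * ?g) sums ?I2"
    unfolding c2_def e2 by (simp only: of_nat_Suc add_ac)
  \<comment> \<open>The value of H' contributes -|y|^2, twice the variable -|y|^2/2 of the series,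
    so the second series is moved up by one power before the two are added.\<close>
  define c2' where "c2' q = (case q of 0 \<Rightarrow> 0 | Suc q \<Rightarrow> - ?u * c2 q)" for q
  have "(\<lambda>q. of_real (c2' (Suc q)) * H y * ?g) sums ?I2"
    using s2 unfolding HH c2'_def by (simp add: mult_ac)
  then have "(\<lambda>q. of_real (c2' q) * H y * ?g) sums (?I2 + of_real (c2' 0) * H y * ?g)"
    by (rule sums_Suc)
  then have s2': "(\<lambda>q. of_real (c2' q) * H y * ?g) sums ?I2" by (simp add: c2'_def)
  have key: "c1 q + c2' q = ?D / fact \<mu> * (?l q * ?w ^ q / fact q)" for q
  proof (cases q)
    case 0 then show ?thesis by (simp add: c1_def c2'_def)
  next
    case (Suc r)
    let ?P = "pochhammer (real \<mu> + 1) r"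
    have p1: "pochhammer (real \<mu>) q = real \<mu> * ?P" unfolding Suc by (rule pochhammer_rec)
    have "c2' q = - ?u * (2 ^ \<kappa> * pochhammer (1/2) \<kappa> / 2 ^ (Suc \<mu>) * ?l q * ?w ^ r / (fact r * fact (\<mu> + q)) * ?P)"
      unfolding c2'_def c2_def Suc by simp
    also have "\<dots> = ?D * ?l q * (?w * ?w ^ r) / (fact r * fact (\<mu> + q)) * ?P"
      by (simp add: mult_ac)
    also have "?w * ?w ^ r = ?w ^ q" unfolding Suc power_Suc ..
    also have "?D * ?l q * ?w ^ q / (fact r * fact (\<mu> + q)) * ?P = ?D * ?l q * ?w ^ q / (fact q * fact (\<mu> + q)) * (real q * ?P)"
      unfolding Suc by (simp add: divide_simps)
    finally have "c1 q + c2' q = ?D * ?l q * ?w ^ q / (fact q * fact (\<mu> + q)) * (real \<mu> * ?P + real q * ?P)"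
      unfolding c1_def p1 by (simp only: distrib_left)
    also have "real \<mu> * ?P + real q * ?P = pochhammer (real \<mu> + 1) q"
      unfolding Suc pochhammer_Suc by (simp add: algebra_simps)
    also have "\<dots> = fact (\<mu> + q) / fact \<mu>" by (rule pochhammer_nat)
    finally show ?thesis by (simp add: mult_ac)
  qed
  have "(\<lambda>q. of_real (c1 q) * H y * ?g + of_real (c2' q) * H y * ?g) sums (?I1 + ?I2)"
    by (rule sums_add[OF s1 s2'])
  moreover have "of_real (c1 q) * H y * ?g + of_real (c2' q) * H y * ?g = of_real (?D / fact \<mu> * (?l q * ?w ^ q / fact q)) * H y * ?g" for q
    unfolding key[symmetric] by (simp add: distrib_right)
  ultimately have "(\<lambda>q. of_real (?D / fact \<mu> * (?l q * ?w ^ q / fact q)) * H y * ?g) sums (?I1 + ?I2)"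
    by (simp only:)
  moreover have "(\<lambda>q. of_real (?D / fact \<mu> * (?l q * ?w ^ q / fact q)) * H y * ?g) sums (of_real (?D / fact \<mu> * S) * H y * ?g)"
    by (intro sums_mult2 sums_of_real sums_mult S)
  ultimately have "?I1 + ?I2 = of_real (?D / fact \<mu> * S) * H y * ?g" by (rule sums_unique2)
  then show ?thesis by (simp add: divide_divide_eq_left)
qed

text \<open>The extra |x|^2 multiplies the q-th term by 2(m/2 + k + q), and raising \<kappa> by one
  in the other integral gives the factor 2\<kappa> + 1. Their difference 2(\<mu> + 1 + q) reduces
  (\<mu> + 1 + q)! to the factorial that (\<mu> + 1)_q cancels.\<close>

lemma gint_odd_pair:
  fixes H :: "real^'n::{finite,linorder} \<Rightarrow> complex"
  assumes harm: "harmonic_poly (Suc k) H" and harm': "harmonic_poly k H'" and HH: "H' y = H y"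
    and m: "CARD('n) = 2 * \<nu> + 1"
    and N: "Suc i div 2 \<le> \<nu>" and ik: "i + k = 2 * \<kappa>" and \<mu>: "\<nu> + \<kappa> = i + Suc \<mu>"
    and S: "(\<lambda>q. lsum a p (real CARD('n) / 2 + real k + 1 + real q) * (- ((norm y)\<^sup>2) / 2) ^ q / fact q) sums S"
  shows "gint (\<lambda>x. of_real (Aker \<nu> i (x \<bullet> y) (wedge_norm x y)) * (of_real ((norm x)\<^sup>2) * radial a p x * H' x)) -
    gint (\<lambda>x. of_real (Aker \<nu> (Suc i) (x \<bullet> y) (wedge_norm x y)) * (radial a p x * H x)) =
    of_real (2 ^ \<kappa> * pochhammer (1/2) \<kappa> / (2 ^ \<mu> * fact \<mu>) * S) * H y * gint (\<lambda>_::real^'n::_. 1)"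
    (is "?I2 - ?I1 = _")
proof -
  let ?a = "\<lambda>j. case j of 0 \<Rightarrow> 0 | Suc j \<Rightarrow> a j"
  let ?D = "2 ^ \<kappa> * pochhammer (1/2) \<kappa> / 2 ^ Suc \<mu> :: real"
  let ?b = "real CARD('n) / 2 + real k"
  let ?l = "\<lambda>q. lsum a p (?b + 1 + real q)" let ?w = "- ((norm y)\<^sup>2) / 2"
  let ?g = "gint (\<lambda>_::real^'n::_. 1)"
  define c1 where "c1 q = 2 ^ Suc \<kappa> * pochhammer (1/2) (Suc \<kappa>) / 2 ^ Suc \<mu> * ?l q * ?w ^ q / (fact q * fact (Suc \<mu> + q)) * pochhammer (real \<mu> + 1) q" for q
  define c2 where "c2 q = ?D * (2 * (?b + real q) * ?l q) * ?w ^ q / (fact q * fact (Suc \<mu> + q)) * pochhammer (real \<mu> + 1) q" for q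
  have e1: "real CARD('n) / 2 + real (Suc k) - real (Suc \<kappa>) - 1/2 = real \<mu> + 1" and e2: "?b - real \<kappa> - 1/2 = real \<mu> + 1"
    using m ik \<mu> by (simp_all add: field_simps)
  have e3: "real CARD('n) / 2 + real (Suc k) + real q = ?b + 1 + real q" for q by simp
  have e4: "?b + real q + 1 = ?b + 1 + real q" for q by simp
  have "Suc i + Suc k = 2 * Suc \<kappa>" "\<nu> + Suc \<kappa> = Suc i + Suc \<mu>" using ik \<mu> by auto
  from funk_hecke_even[OF harm N this, of a p y]
  have s1: "(\<lambda>q. of_real (c1 q) * H y * ?g) sums ?I1" unfolding c1_def e1 e3 .
  have "i div 2 \<le> \<nu>" using N by auto
  from funk_hecke_even[OF harm' this ik \<mu>, of ?a "Suc p" y]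
  have s2: "(\<lambda>q. of_real (c2 q) * H y * ?g) sums ?I2"
    unfolding c2_def e2 radial_shift lsum_shift HH e4 .
  have key: "c2 q - c1 q = 2 * ?D / fact \<mu> * (?l q * ?w ^ q / fact q)" for q
  proof -
    let ?P = "pochhammer (real \<mu> + 1) q"
    have "c1 q = ?D * (2 * (1/2 + real \<kappa>) * ?l q) * ?w ^ q / (fact q * fact (Suc \<mu> + q)) * ?P"
    proof -
      have "2 ^ Suc \<kappa> * pochhammer (1/2) (Suc \<kappa>) = 2 ^ \<kappa> * pochhammer (1/2) \<kappa> * (2 * (1/2 + real \<kappa>))"
        by (simp only: pochhammer_Suc power_Suc mult_ac)
      then show ?thesis unfolding c1_def by (simp only: mult_ac times_divide_eq_left times_divide_eq_right)
    qed
    then have "c2 q - c1 q = ?D * ((2 * (?b + real q) - 2 * (1/2 + real \<kappa>)) * ?l q) * ?w ^ q / (fact q * fact (Suc \<mu> + q)) * ?P"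
      unfolding c2_def by (simp only: left_diff_distrib right_diff_distrib diff_divide_distrib)
    also have "2 * (?b + real q) - 2 * (1/2 + real \<kappa>) = 2 * real (Suc \<mu> + q)"
      using e2 by simp
    also have "?P = fact (\<mu> + q) / fact \<mu>" by (rule pochhammer_nat)
    also have "fact (Suc \<mu> + q) = real (Suc \<mu> + q) * fact (\<mu> + q)" by simp
    also have "?D * (2 * real (Suc \<mu> + q) * ?l q) * ?w ^ q / (fact q * (real (Suc \<mu> + q) * fact (\<mu> + q))) * (fact (\<mu> + q) / fact \<mu>) = 2 * ?D / fact \<mu> * (?l q * ?w ^ q / fact q)"
      by (simp add: mult_ac del: of_nat_add of_nat_Suc)
    finally show ?thesis .
  qed
  have "(\<lambda>q. of_real (c2 q) * H y * ?g - of_real (c1 q) * H y * ?g) sums (?I2 - ?I1)"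
    by (rule sums_diff[OF s2 s1])
  moreover have "of_real (c2 q) * H y * ?g - of_real (c1 q) * H y * ?g = of_real (2 * ?D / fact \<mu> * (?l q * ?w ^ q / fact q)) * H y * ?g" for q
    unfolding key[symmetric] by (simp add: left_diff_distrib)
  ultimately have "(\<lambda>q. of_real (2 * ?D / fact \<mu> * (?l q * ?w ^ q / fact q)) * H y * ?g) sums (?I2 - ?I1)"
    by (simp only:)
  moreover have "(\<lambda>q. of_real (2 * ?D / fact \<mu> * (?l q * ?w ^ q / fact q)) * H y * ?g) sums (of_real (2 * ?D / fact \<mu> * S) * H y * ?g)"
    by (intro sums_mult2 sums_of_real sums_mult S)
  ultimately have "?I2 - ?I1 = of_real (2 * ?D / fact \<mu> * S) * H y * ?g" by (rule sums_unique2)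
  moreover have "2 * ?D / fact \<mu> * S = 2 ^ \<kappa> * pochhammer (1/2) \<kappa> / (2 ^ \<mu> * fact \<mu>) * S" by simp
  ultimately show ?thesis by (simp only:)
qed

text \<open>The factors are listed in reverse order. For \<kappa> = 0 the product is empty, in
  agreement with (-1)!! = 1.\<close>

lemma dfact_odd: "dfact (2 * int \<kappa> - 1) = 2 ^ \<kappa> * pochhammer (1/2) \<kappa>"
proof -
  have "dfact (2 * int \<kappa> - 1) = (\<Prod>j\<in>{0..<\<kappa>}. real_of_int (2 * int \<kappa> - 1 - 2 * int j))"
    unfolding dfact_def by simp
  also have "\<dots> = (\<Prod>j\<in>{0..<\<kappa>}. 2 * (1/2 + real j))"
    by (rule prod.reindex_bij_witness[of _ "\<lambda>j. \<kappa> - 1 - j" "\<lambda>j. \<kappa> - 1 - j"]) (auto simp: of_nat_diff)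
  also have "\<dots> = 2 ^ \<kappa> * pochhammer (1/2) \<kappa>"
    unfolding prod.distrib pochhammer_prod by simp
  finally show ?thesis .
qed

lemma dfact_even: "dfact (2 * int \<mu>) = 2 ^ \<mu> * fact \<mu>"
proof -
  have "dfact (2 * int \<mu>) = (\<Prod>j\<in>{0..<\<mu>}. real_of_int (2 * int \<mu> - 2 * int j))"
    unfolding dfact_def by simp
  also have "\<dots> = (\<Prod>j\<in>{0..<\<mu>}. 2 * (1 + real j))"
    by (rule prod.reindex_bij_witness[of _ "\<lambda>j. \<mu> - 1 - j" "\<lambda>j. \<mu> - 1 - j"]) (auto simp: of_nat_diff)
  also have "\<dots> = 2 ^ \<mu> * fact \<mu>"
    unfolding prod.distrib pochhammer_fact pochhammer_prod by simp
  finally show ?thesis .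
qed

section \<open>The transform on the Clifford--Hermite functions\<close>

lemma hcoef_Gamma:
  assumes "2 * l \<le> i"
  shows "1 / (2 ^ l * fact l) * (Gamma (real i + 1) / Gamma (real i + 1 - 2 * real l)) = hcoef i l"
proof -
  have "real i + 1 - 2 * real l = 1 + of_nat (i - 2 * l)" using assms by (simp add: of_nat_diff)
  then have "Gamma (real i + 1 - 2 * real l) = fact (i - 2 * l)" by (simp only: Gamma_fact)
  moreover have "Gamma (real i + 1) = fact i" using Gamma_fact[of i, where 'a = real] by (simp add: add.commute)
  ultimately show ?thesis using assms by (simp add: hcoef_def)
qed

lemma g_fun_Aker:
  assumes "m = 2 * \<nu> + 1"
  shows "g_fun m i s t = Aker \<nu> i s t"
  unfolding g_fun_def Aker_def atLeast0AtMost
proof (rule sum.cong[OF refl])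
  fix l assume "l \<in> {..i div 2}"
  then have l: "2 * l \<le> i" by auto
  have "(real m - 2 * real l - 1) / 2 = real \<nu> - real l" using assms by (simp add: field_simps)
  then show "s ^ (i - 2 * l) * (1 / (2 ^ l * fact l)) * (Gamma (real i + 1) / Gamma (real i + 1 - 2 * real l)) * Jt ((real m - 2 * real l - 1) / 2) t
    = hcoef i l * s ^ (i - 2 * l) * Jt (real \<nu> - real l) t"
    unfolding hcoef_Gamma[OF l, symmetric] by (simp only: mult_ac)
qed

lemma f_hat_Aker:
  assumes "m = 2 * N + 3"
  shows "f_hat m i s t = (-1) ^ ((m + 1) div 2 + i) * Aker N i s t"
proof -
  have "(\<Sum>l=0..i div 2. s ^ (i - 2 * l) * (1 / (2 ^ l * fact l)) * (Gamma (real i + 1) / Gamma (real i + 1 - 2 * real l)) * Jt ((real m - 2 * real l - 3) / 2) t) = Aker N i s t"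
    unfolding Aker_def atLeast0AtMost
  proof (rule sum.cong[OF refl])
    fix l assume "l \<in> {..i div 2}"
    then have l: "2 * l \<le> i" by auto
    have "(real m - 2 * real l - 3) / 2 = real N - real l" using assms by (simp add: field_simps)
    then show "s ^ (i - 2 * l) * (1 / (2 ^ l * fact l)) * (Gamma (real i + 1) / Gamma (real i + 1 - 2 * real l)) * Jt ((real m - 2 * real l - 3) / 2) t
      = hcoef i l * s ^ (i - 2 * l) * Jt (real N - real l) t"
      unfolding hcoef_Gamma[OF l, symmetric] by (simp only: mult_ac)
  qed
  then show ?thesis by (simp only: f_hat_def)
qed

text \<open>Leibniz' rule in disguise: the (i+1)-st derivative is the i-th derivative of s times a
  Bessel function, that is s \<open>Aker \<nu> i\<close> plus i times
  \<open>Aker (\<nu> - 1) (i - 1)\<close>, and \<open>f_tilde\<close> is minus the latter. On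
  coefficients this is \<open>hcoef_rec\<close>.\<close>

lemma f_tilde_Aker:
  assumes "m = 2 * \<nu> + 1"
  shows "f_tilde m i s t - s * g_fun m i s t = - Aker \<nu> (Suc i) s t"
proof (cases i)
  case 0
  then show ?thesis unfolding g_fun_Aker[OF assms] by (simp add: f_tilde_def Aker_def hcoef_0)
next
  case (Suc i')
  let ?J = "\<lambda>l. Jt (real \<nu> - real (Suc l)) t"
  have f: "f_tilde m i s t = - (\<Sum>l\<le>i' div 2. real i * hcoef i' l * s ^ (i' - 2 * l) * ?J l)"
  proof -
    have "s ^ (i - 1 - 2 * l) * (1 / (2 ^ l * fact l)) * (Gamma (real i + 1) / Gamma (real i - 2 * real l)) * Jt ((real m - 2 * real l - 3) / 2) t
      = real i * hcoef i' l * s ^ (i' - 2 * l) * ?J l" if "l \<in> {..i' div 2}" for l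
    proof -
      have l: "2 * l \<le> i'" using that by auto
      have G: "Gamma (real i + 1) = real i * Gamma (real i' + 1)"
        using Gamma_plus1[of "real i"] Suc by (simp add: nonpos_Ints_def add.commute)
      have e: "real i - 2 * real l = real i' + 1 - 2 * real l" "(real m - 2 * real l - 3) / 2 = real \<nu> - real (Suc l)" "i - 1 - 2 * l = i' - 2 * l"
        using Suc assms by (simp_all add: field_simps)
      show ?thesis unfolding hcoef_Gamma[OF l, symmetric] G e by (simp add: mult_ac)
    qed
    then show ?thesis unfolding f_tilde_def atLeast0AtMost using Suc by simp
  qed
  have "s * g_fun m i s t = (\<Sum>l\<le>i div 2. hcoef i l * s ^ (Suc i - 2 * l) * Jt (real \<nu> - real l) t)"
    unfolding g_fun_Aker[OF assms] Aker_def sum_distrib_left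
    by (rule sum.cong) (auto simp: Suc_diff_le mult_ac)
  \<comment> \<open>For even i' the range grows by one term beyond \<open>i div 2\<close>, whose
    coefficient is 0; now it matches the range of \<open>Aker \<nu> (Suc i)\<close>.\<close>
  also have "\<dots> = (\<Sum>l\<le>Suc (i' div 2). hcoef i l * s ^ (Suc i - 2 * l) * Jt (real \<nu> - real l) t)"
    by (rule sum.mono_neutral_left) (auto simp: Suc hcoef_def)
  finally have g: "s * g_fun m i s t = s ^ Suc i * Jt (real \<nu>) t + (\<Sum>l\<le>i' div 2. hcoef i (Suc l) * s ^ (Suc i - 2 * Suc l) * ?J l)"
    unfolding sum.atMost_Suc_shift by (simp add: hcoef_0)
  have "Suc i div 2 = Suc (i' div 2)" using Suc by simp
  then have "Aker \<nu> (Suc i) s t = s ^ Suc i * Jt (real \<nu>) t + (\<Sum>l\<le>i' div 2. hcoef (Suc i) (Suc l) * s ^ (Suc i - 2 * Suc l) * ?J l)"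
    unfolding Aker_def by (simp only: sum.atMost_Suc_shift) (simp add: hcoef_0)
  also have "(\<Sum>l\<le>i' div 2. hcoef (Suc i) (Suc l) * s ^ (Suc i - 2 * Suc l) * ?J l) =
    (\<Sum>l\<le>i' div 2. hcoef i (Suc l) * s ^ (Suc i - 2 * Suc l) * ?J l) + (\<Sum>l\<le>i' div 2. real i * hcoef i' l * s ^ (i' - 2 * l) * ?J l)"
  proof -
    have "Suc i - 2 * Suc l = i' - 2 * l" for l using Suc by simp
    then show ?thesis unfolding sum.distrib[symmetric] Suc hcoef_rec
      by (intro sum.cong refl) (simp add: algebra_simps)
  qed
  finally show ?thesis unfolding f g by simp
qed

lemma clif_mult_one:
  fixes a :: "'n::{finite,linorder} clif"
  shows "clif_mult clif_one a C = a C"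
proof -
  have "clif_mult clif_one a C = (\<Sum>A\<in>(UNIV :: 'n set set). if A = {} then clif_sign {} (symd {} C) * a (symd {} C) else 0)"
    unfolding clif_mult_alt clif_one_def by (intro sum.cong refl) auto
  then show ?thesis by (simp add: clif_sign_def symd_def)
qed

lemma clif_mult_add_left: "clif_mult (clif_add a b) c C = clif_mult a c C + clif_mult b c C"
  by (simp add: clif_mult_alt clif_add_def algebra_simps sum.distrib)

lemma clif_mult_scal_left: "clif_mult (clif_scal r a) c C = r * clif_mult a c C"
  by (simp add: clif_mult_alt clif_scal_def sum_distrib_left mult_ac)

lemma clif_mult_scal_right: "clif_mult a (\<lambda>A. r * c A) C = r * clif_mult a c C"
  by (simp add: clif_mult_alt sum_distrib_left mult_ac)

text \<open>Here N = (m - 3)/2, so \<open>Suc N\<close> is the \<nu> of the overview. Eliminating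
  the wedge product adds -s g to \<open>f_tilde\<close>, which is the combination of
  \<open>f_tilde_Aker\<close>.\<close>

lemma kernel_mult:
  fixes x y :: "real^'n::{finite,linorder}"
  assumes m: "CARD('n) = 2 * N + 3"
  shows "clif_mult (kernel_plus i ec x y) a C =
    - ec * (of_real (Aker (Suc N) (Suc i) (x \<bullet> y) (wedge_norm x y)) * a C
          + of_real (Aker (Suc N) i (x \<bullet> y) (wedge_norm x y)) * clif_mult (clif_vec y) (clif_mult (clif_vec x) a) C)
    + \<i> * cnj ec * (-1) ^ ((CARD('n) + 1) div 2 + i) * (of_real (Aker N i (x \<bullet> y) (wedge_norm x y)) * a C)"
proof -
  let ?s = "x \<bullet> y" and ?t = "wedge_norm x y"
  have m': "CARD('n) = 2 * Suc N + 1" using m by simp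
  have w: "clif_mult (clif_wedge x y) a C = - of_real ?s * a C - clif_mult (clif_vec y) (clif_mult (clif_vec x) a) C"
    unfolding vec_vec_mult by simp
  have f: "f_tilde CARD('n) i ?s ?t = ?s * Aker (Suc N) i ?s ?t - Aker (Suc N) (Suc i) ?s ?t"
    using f_tilde_Aker[OF m', of i ?s ?t] g_fun_Aker[OF m', of i ?s ?t] by simp
  show ?thesis
    unfolding kernel_plus_def Let_def clif_mult_add_left clif_mult_scal_left clif_mult_one w f g_fun_Aker[OF m'] f_hat_Aker[OF m]
    by (simp add: algebra_simps)
qed

text \<open>To be used with F = M for \<open>psi_even\<close> and F = xM for \<open>psi_odd\<close>;
  the three integrability facts allow the integral to be split.\<close>

lemma fourier_radial:
  fixes F :: "real^'n::{finite,linorder} \<Rightarrow> 'n clif" and y :: "real^'n::_"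
  assumes m: "CARD('n) = 2 * N + 3"
    and i1: "gintegrable (\<lambda>x. of_real (Aker (Suc N) (Suc i) (x \<bullet> y) (wedge_norm x y)) * (radial a p x * F x C))"
    and i2: "gintegrable (\<lambda>x. of_real (Aker (Suc N) i (x \<bullet> y) (wedge_norm x y)) * (radial a p x * clif_mult (clif_vec y) (clif_mult (clif_vec x) (F x)) C))"
    and i3: "gintegrable (\<lambda>x. of_real (Aker N i (x \<bullet> y) (wedge_norm x y)) * (radial a p x * F x C))"
    and \<psi>: "\<And>x. \<psi> x = (\<lambda>A. of_real (exp (- (norm x)\<^sup>2 / 2)) * (radial a p x * F x A))"
  shows "(LINT x|lborel. clif_mult (kernel_plus i ec x y) (\<psi> x) C) =
    - ec * (gint (\<lambda>x. of_real (Aker (Suc N) (Suc i) (x \<bullet> y) (wedge_norm x y)) * (radial a p x * F x C))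
      + gint (\<lambda>x. of_real (Aker (Suc N) i (x \<bullet> y) (wedge_norm x y)) * (radial a p x * clif_mult (clif_vec y) (clif_mult (clif_vec x) (F x)) C)))
    + \<i> * cnj ec * (-1) ^ ((CARD('n) + 1) div 2 + i) * gint (\<lambda>x. of_real (Aker N i (x \<bullet> y) (wedge_norm x y)) * (radial a p x * F x C))"
    (is "_ = - ec * (gint ?f1 + gint ?f2) + ?d * gint ?f3")
proof -
  have "clif_mult (kernel_plus i ec x y) (\<psi> x) C = of_real (exp (- (norm x)\<^sup>2 / 2)) * (- ec * (?f1 x + ?f2 x) + ?d * ?f3 x)" for x
  proof -
    have "clif_mult (clif_vec x) (\<psi> x) = (\<lambda>A. of_real (exp (- (norm x)\<^sup>2 / 2)) * (radial a p x * clif_mult (clif_vec x) (F x) A))"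
      unfolding \<psi> by (rule ext) (simp only: clif_mult_scal_right)
    then have "clif_mult (clif_vec y) (clif_mult (clif_vec x) (\<psi> x)) C = of_real (exp (- (norm x)\<^sup>2 / 2)) * (radial a p x * clif_mult (clif_vec y) (clif_mult (clif_vec x) (F x)) C)"
      by (simp only: clif_mult_scal_right)
    then show ?thesis unfolding kernel_mult[OF m] by (simp only: \<psi>) (simp only: algebra_simps)
  qed
  then have "(LINT x|lborel. clif_mult (kernel_plus i ec x y) (\<psi> x) C) = gint (\<lambda>x. - ec * (?f1 x + ?f2 x) + ?d * ?f3 x)"
    unfolding gint_def by (simp only:)
  also have "\<dots> = gint (\<lambda>x. - ec * (?f1 x + ?f2 x)) + gint (\<lambda>x. ?d * ?f3 x)"
    by (intro gint_add gintegrable_cmul gintegrable_add i1 i2 i3)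
  also have "\<dots> = - ec * (gint ?f1 + gint ?f2) + ?d * gint ?f3"
    by (simp only: gint_cmul gint_add[OF i1 i2])
  finally show ?thesis .
qed

lemma gauss_const:
  "complex_of_real ((2 * pi) powr (- real CARD('n) / 2)) * gint (\<lambda>_::real^'n::finite. 1) = 1"
proof -
  have "(2 * pi) powr (- real CARD('n) / 2) * sqrt (2 * pi) ^ CARD('n) = 1"
    by (simp add: powr_half_sqrt[symmetric] powr_powr powr_realpow[symmetric] powr_add[symmetric])
  then show ?thesis unfolding gint_1 by (metis of_real_1 of_real_mult)
qed

context
  fixes M :: "real^'n::{finite,linorder} \<Rightarrow> 'n clif" and i k p N :: nat and ec :: complex
  assumes m: "CARD('n) = 2 * N + 3" and i: "i \<le> 2 * N + 1" and sm: "spherical_monogenic k M"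
begin

private lemma bounds: "i div 2 \<le> N" "i div 2 \<le> Suc N" "Suc i div 2 \<le> Suc N" "CARD('n) = 2 * Suc N + 1"
  using i m by auto

private lemma harm_M: "harmonic_poly k (\<lambda>x. M x C)"
  by (rule monogenic_harmonic[OF sm])

private lemma harm_xM: "harmonic_poly (Suc k) (\<lambda>x. clif_mult (clif_vec x) (M x) C)"
  by (rule vec_monogenic_harmonic[OF sm])

private lemma harm_yxM: "harmonic_poly (Suc k) (\<lambda>x. clif_mult (clif_vec y) (clif_mult (clif_vec x) (M x)) C)"
  by (rule vec_mult_harmonic) (rule harm_xM)

private lemma harm_yM: "harmonic_poly k (\<lambda>x. clif_mult (clif_vec y) (M x) C)"
  by (rule vec_mult_harmonic) (rule harm_M)

private lemma psi_even_radial: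
  "psi_even p k M x = (\<lambda>A. of_real (exp (- (norm x)\<^sup>2 / 2)) * (radial (lag_coef p (real CARD('n) / 2 + real k - 1)) p x * M x A))"
  unfolding psi_even_def clif_scal_def laguerre_radial by (simp add: mult_ac)

private lemma psi_odd_radial:
  "psi_odd p k M x = (\<lambda>A. of_real (exp (- (norm x)\<^sup>2 / 2)) * (radial (lag_coef p (real CARD('n) / 2 + real k)) p x * clif_mult (clif_vec x) (M x) A))"
  unfolding psi_odd_def clif_scal_def laguerre_radial by (simp add: mult_ac)

private lemma fourier_even:
  fixes y :: "real^'n::_"
  defines "a \<equiv> lag_coef p (real CARD('n) / 2 + real k - 1)"
  shows "(LINT x|lborel. clif_mult (kernel_plus i ec x y) (psi_even p k M x) C) =
    - ec * (gint (\<lambda>x. of_real (Aker (Suc N) (Suc i) (x \<bullet> y) (wedge_norm x y)) * (radial a p x * M x C))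
      + gint (\<lambda>x. of_real (Aker (Suc N) i (x \<bullet> y) (wedge_norm x y)) * (radial a p x * clif_mult (clif_vec y) (clif_mult (clif_vec x) (M x)) C)))
    + \<i> * cnj ec * (-1) ^ ((CARD('n) + 1) div 2 + i) * gint (\<lambda>x. of_real (Aker N i (x \<bullet> y) (wedge_norm x y)) * (radial a p x * M x C))"
  unfolding a_def
  by (rule fourier_radial[OF m Aker_gintegrable[OF harm_M bounds(3)] Aker_gintegrable[OF harm_yxM bounds(2)]
        Aker_gintegrable[OF harm_M bounds(1)] psi_even_radial])

text \<open>For \<open>psi_odd\<close> the vector x acts twice and collapses to -|x|^2, so the
  harmonic factor to integrate is yM, of degree k rather than k + 2.\<close>

private lemma yxxM: "clif_mult (clif_vec y) (clif_mult (clif_vec x) (clif_mult (clif_vec x) (M x))) C = - (of_real ((norm x)\<^sup>2) * clif_mult (clif_vec y) (M x) C)"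
proof -
  have "clif_mult (clif_vec x) (clif_mult (clif_vec x) (M x)) = (\<lambda>A. - of_real ((norm x)\<^sup>2) * M x A)"
    by (rule ext) (rule vec_square)
  then show ?thesis by (simp only: clif_mult_scal_right) simp
qed

private lemma yM_integrable:
  "gintegrable (\<lambda>x. of_real (Aker (Suc N) i (x \<bullet> y) (wedge_norm x y)) * (of_real ((norm x)\<^sup>2) * radial a q x * clif_mult (clif_vec y) (M x) C))"
  unfolding radial_shift[symmetric] by (rule Aker_gintegrable[OF harm_yM bounds(2)])

private lemma fourier_odd:
  fixes y :: "real^'n::_"
  defines "a \<equiv> lag_coef p (real CARD('n) / 2 + real k)"
  shows "(LINT x|lborel. clif_mult (kernel_plus i ec x y) (psi_odd p k M x) C) =
    ec * (gint (\<lambda>x. of_real (Aker (Suc N) i (x \<bullet> y) (wedge_norm x y)) * (of_real ((norm x)\<^sup>2) * radial a p x * clif_mult (clif_vec y) (M x) C))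
      - gint (\<lambda>x. of_real (Aker (Suc N) (Suc i) (x \<bullet> y) (wedge_norm x y)) * (radial a p x * clif_mult (clif_vec x) (M x) C)))
    + \<i> * cnj ec * (-1) ^ ((CARD('n) + 1) div 2 + i) * gint (\<lambda>x. of_real (Aker N i (x \<bullet> y) (wedge_norm x y)) * (radial a p x * clif_mult (clif_vec x) (M x) C))"
proof -
  let ?f = "\<lambda>x. of_real (Aker (Suc N) i (x \<bullet> y) (wedge_norm x y)) * (of_real ((norm x)\<^sup>2) * radial a p x * clif_mult (clif_vec y) (M x) C)"
  have e: "(\<lambda>x. of_real (Aker (Suc N) i (x \<bullet> y) (wedge_norm x y)) * (radial a p x * clif_mult (clif_vec y) (clif_mult (clif_vec x) (clif_mult (clif_vec x) (M x))) C))
    = (\<lambda>x. - 1 * ?f x)"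
    unfolding yxxM by (rule ext) simp
  have i2: "gintegrable (\<lambda>x. of_real (Aker (Suc N) i (x \<bullet> y) (wedge_norm x y)) * (radial a p x * clif_mult (clif_vec y) (clif_mult (clif_vec x) (clif_mult (clif_vec x) (M x))) C))"
    unfolding e by (intro gintegrable_cmul yM_integrable)
  have "(LINT x|lborel. clif_mult (kernel_plus i ec x y) (psi_odd p k M x) C) =
    - ec * (gint (\<lambda>x. of_real (Aker (Suc N) (Suc i) (x \<bullet> y) (wedge_norm x y)) * (radial a p x * clif_mult (clif_vec x) (M x) C))
      + gint (\<lambda>x. of_real (Aker (Suc N) i (x \<bullet> y) (wedge_norm x y)) * (radial a p x * clif_mult (clif_vec y) (clif_mult (clif_vec x) (clif_mult (clif_vec x) (M x))) C)))
    + \<i> * cnj ec * (-1) ^ ((CARD('n) + 1) div 2 + i) * gint (\<lambda>x. of_real (Aker N i (x \<bullet> y) (wedge_norm x y)) * (radial a p x * clif_mult (clif_vec x) (M x) C))"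
    using i2 unfolding a_def
    by (rule fourier_radial[OF m Aker_gintegrable[OF harm_xM bounds(3)] _
        Aker_gintegrable[OF harm_xM bounds(1)] psi_odd_radial])
  then show ?thesis unfolding e gint_cmul by (simp add: algebra_simps)
qed

private lemma lsums_even: "(\<lambda>q. lsum (lag_coef p (real CARD('n) / 2 + real k - 1)) p (real CARD('n) / 2 + real k + real q) * (- ((norm y)\<^sup>2) / 2) ^ q / fact q)
   sums ((-1) ^ p * laguerre p (real CARD('n) / 2 + real k - 1) ((norm y)\<^sup>2) * exp (- ((norm y)\<^sup>2) / 2))" for y :: "real^'n::_"
  using lsum_laguerre_sums[of p "real CARD('n) / 2 + real k - 1" "(norm y)\<^sup>2"] by simp

private lemma lsums_odd: "(\<lambda>q. lsum (lag_coef p (real CARD('n) / 2 + real k)) p (real CARD('n) / 2 + real k + 1 + real q) * (- ((norm y)\<^sup>2) / 2) ^ q / fact q)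
   sums ((-1) ^ p * laguerre p (real CARD('n) / 2 + real k) ((norm y)\<^sup>2) * exp (- ((norm y)\<^sup>2) / 2))" for y :: "real^'n::_"
  by (rule lsum_laguerre_sums)

private lemma scale: 
  "complex_of_real ((2 * pi) powr (- real CARD('n) / 2)) * (c * (of_real (d * ((-1) ^ p * L * E)) * v * gint (\<lambda>_::real^'n::_. 1))) =
    c * of_real d * (-1) ^ p * (of_real (L * E) * v)"
proof -
  have "complex_of_real ((2 * pi) powr (- real CARD('n) / 2)) * (c * (of_real (d * ((-1) ^ p * L * E)) * v * gint (\<lambda>_::real^'n::_. 1))) =
    (complex_of_real ((2 * pi) powr (- real CARD('n) / 2)) * gint (\<lambda>_::real^'n::_. 1)) * (c * of_real (d * ((-1) ^ p * L * E)) * v)"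
    by (simp only: mult_ac)
  then show ?thesis unfolding gauss_const by simp
qed

text \<open>With i + k even, both integrals carrying \<open>ec\<close> vanish by parity: index i + 1
  meets M of degree k, and index i meets y(xM) of degree k + 1.\<close>

lemma fourier_even_same:
  assumes ik: "i + k = 2 * \<kappa>" and \<mu>: "N + \<kappa> = i + \<mu>"
  shows "fourier_plus i ec (psi_even p k M) = fun_scal (\<i> * cnj ec * (-1) ^ ((CARD('n) + 1) div 2 + i)
     * of_real (dfact (2 * int \<kappa> - 1) / dfact (2 * int \<mu>)) * (-1) ^ p) (psi_even p k M)"
proof (rule ext, rule ext)
  fix y :: "real^'n::_" and C :: "'n set"
  have o: "odd (Suc i + k)" "odd (i + Suc k)" using ik by presburger+
  show "fourier_plus i ec (psi_even p k M) y C = fun_scal (\<i> * cnj ec * (-1) ^ ((CARD('n) + 1) div 2 + i)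
     * of_real (dfact (2 * int \<kappa> - 1) / dfact (2 * int \<mu>)) * (-1) ^ p) (psi_even p k M) y C"
    unfolding fourier_plus_def fourier_even
    unfolding funk_hecke_odd[OF harm_M bounds(3) o(1)] funk_hecke_odd[OF harm_yxM bounds(2) o(2)]
      gint_hat[OF harm_M m bounds(1) ik \<mu> lsums_even] add_0_left add_0_right mult_zero_right
    unfolding scale
    unfolding fun_scal_def clif_scal_def psi_even_def dfact_odd dfact_even ..
qed

text \<open>Now the integral from \<open>f_hat\<close> vanishes. At x = y the polynomial y(xM) takes
  the value y(yM) = -|y|^2 M(y), which is what \<open>gint_even_pair\<close> asks of H'.\<close>

lemma fourier_even_diff:
  assumes ik: "Suc i + k = 2 * \<kappa>" and \<mu>: "Suc N + \<kappa> = Suc i + \<mu>"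
  shows "fourier_plus i ec (psi_even p k M) = fun_scal (- ec
     * of_real (dfact (2 * int \<kappa> - 1) / dfact (2 * int \<mu>)) * (-1) ^ p) (psi_even p k M)"
proof (rule ext, rule ext)
  fix y :: "real^'n::_" and C :: "'n set"
  have o: "odd (i + k)" using ik by presburger
  show "fourier_plus i ec (psi_even p k M) y C = fun_scal (- ec
     * of_real (dfact (2 * int \<kappa> - 1) / dfact (2 * int \<mu>)) * (-1) ^ p) (psi_even p k M) y C"
    unfolding fourier_plus_def fourier_even
    unfolding funk_hecke_odd[OF harm_M bounds(1) o]
      gint_even_pair[OF harm_M harm_yxM vec_square bounds(4,3) ik \<mu> lsums_even] add_0_left add_0_right mult_zero_right
    unfolding scale
    unfolding fun_scal_def clif_scal_def psi_even_def dfact_odd dfact_even ..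
qed

text \<open>The polynomials xM and yM, of degrees k + 1 and k, have the same value at x = y, as
  \<open>gint_odd_pair\<close> requires; \<open>f_hat\<close> meets xM with odd total degree and
  drops out.\<close>

lemma fourier_odd_same:
  assumes ik: "i + k = 2 * \<kappa>" and \<mu>: "Suc N + \<kappa> = i + Suc \<mu>"
  shows "fourier_plus i ec (psi_odd p k M) = fun_scal (ec
     * of_real (dfact (2 * int \<kappa> - 1) / dfact (2 * int \<mu>)) * (-1) ^ p) (psi_odd p k M)"
proof (rule ext, rule ext)
  fix y :: "real^'n::_" and C :: "'n set"
  have o: "odd (i + Suc k)" using ik by presburger
  show "fourier_plus i ec (psi_odd p k M) y C = fun_scal (ec
     * of_real (dfact (2 * int \<kappa> - 1) / dfact (2 * int \<mu>)) * (-1) ^ p) (psi_odd p k M) y C"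
    unfolding fourier_plus_def fourier_odd
    unfolding funk_hecke_odd[OF harm_xM bounds(1) o]
      gint_odd_pair[OF harm_xM harm_yM refl bounds(4,3) ik \<mu> lsums_odd] add_0_left add_0_right mult_zero_right
    unfolding scale
    unfolding fun_scal_def clif_scal_def psi_odd_def dfact_odd dfact_even ..
qed

text \<open>The only survivor is \<open>f_hat\<close> against xM, so \<open>gint_hat\<close> is used
  in degree k + 1.\<close>

lemma fourier_odd_diff:
  assumes ik: "i + Suc k = 2 * \<kappa>" and \<mu>: "N + \<kappa> = i + \<mu>"
  shows "fourier_plus i ec (psi_odd p k M) = fun_scal (\<i> * cnj ec * (-1) ^ ((CARD('n) + 1) div 2 + i)
     * of_real (dfact (2 * int \<kappa> - 1) / dfact (2 * int \<mu>)) * (-1) ^ p) (psi_odd p k M)"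
proof (rule ext, rule ext)
  fix y :: "real^'n::_" and C :: "'n set"
  have o: "odd (Suc i + Suc k)" "odd (i + k)" using ik by presburger+
  have s: "(\<lambda>q. lsum (lag_coef p (real CARD('n) / 2 + real k)) p (real CARD('n) / 2 + real (Suc k) + real q) * (- ((norm y)\<^sup>2) / 2) ^ q / fact q)
   sums ((-1) ^ p * laguerre p (real CARD('n) / 2 + real k) ((norm y)\<^sup>2) * exp (- ((norm y)\<^sup>2) / 2))"
    using lsums_odd[of y] by (simp add: add_ac)
  show "fourier_plus i ec (psi_odd p k M) y C = fun_scal (\<i> * cnj ec * (-1) ^ ((CARD('n) + 1) div 2 + i)
     * of_real (dfact (2 * int \<kappa> - 1) / dfact (2 * int \<mu>)) * (-1) ^ p) (psi_odd p k M) y C"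
    unfolding fourier_plus_def fourier_odd
    unfolding radial_shift[symmetric] funk_hecke_odd[OF harm_xM bounds(3) o(1)] funk_hecke_odd[OF harm_yM bounds(2) o(2)]
      gint_hat[OF harm_xM m bounds(1) ik \<mu> s] add_0_left diff_0_right mult_zero_right
    unfolding scale
    unfolding fun_scal_def clif_scal_def psi_odd_def dfact_odd dfact_even ..
qed

end

theorem theorem5p4:
  fixes M :: "real^'n::_ \<Rightarrow> ('n::{finite,linorder}) clif"
    and m i k p :: nat and ec :: complex
  assumes "m = CARD('n)" and "odd m" and "m \<ge> 3" and "i \<le> m - 2"
    and "spherical_monogenic k M"
  shows
   "(even i \<and> even k \<longrightarrow>
      fourier_plus i ec (psi_even p k M) = fun_scal (\<i> * cnj ec * (-1) ^ ((m + 1) div 2)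
         * complex_of_real (dfact (int k + int i - 1) / dfact (int k - int i + int m - 3)) * (-1) ^ p)
         (psi_even p k M)
    \<and> fourier_plus i ec (psi_odd p k M) = fun_scal (ec
         * complex_of_real (dfact (int k + int i - 1) / dfact (int k + int m - int i - 3)) * (-1) ^ p)
         (psi_odd p k M))
  \<and> (even i \<and> odd k \<longrightarrow>
      fourier_plus i ec (psi_even p k M) = fun_scal (ec
         * complex_of_real (dfact (int k + int i) / dfact (int k + int m - int i - 2)) * (-1) ^ (p + 1))
         (psi_even p k M)
    \<and> fourier_plus i ec (psi_odd p k M) = fun_scal (\<i> * cnj ec * (-1) ^ ((m + 1) div 2)
         * complex_of_real (dfact (int k + int i) / dfact (int k - int i + int m - 2)) * (-1) ^ p)
         (psi_odd p k M))
  \<and> (odd i \<and> even k \<longrightarrow>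
      fourier_plus i ec (psi_even p k M) = fun_scal (ec
         * complex_of_real (dfact (int k + int i) / dfact (int k + int m - int i - 2)) * (-1) ^ (p + 1))
         (psi_even p k M)
    \<and> fourier_plus i ec (psi_odd p k M) = fun_scal (\<i> * cnj ec * (-1) ^ ((m + 1) div 2)
         * complex_of_real (dfact (int k + int i) / dfact (int k + int m - int i - 2)) * (-1) ^ (p + 1))
         (psi_odd p k M))
  \<and> (odd i \<and> odd k \<longrightarrow>
      fourier_plus i ec (psi_even p k M) = fun_scal (\<i> * cnj ec * (-1) ^ ((m + 1) div 2)
         * complex_of_real (dfact (int k - 1 + int i) / dfact (int k + int m - int i - 3)) * (-1) ^ (p + 1))
         (psi_even p k M)
    \<and> fourier_plus i ec (psi_odd p k M) = fun_scal (ec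
         * complex_of_real (dfact (int k + int i - 1) / dfact (int k + int m - int i - 3)) * (-1) ^ p)
         (psi_odd p k M))"
proof -
  obtain N where N: "m = 2 * N + 3"
  proof -
    from \<open>odd m\<close> obtain n where "m = 2 * n + 1" by (auto elim: oddE)
    with \<open>m \<ge> 3\<close> that[of "n - 1"] show thesis by auto
  qed
  have m: "CARD('n) = 2 * N + 3" and i: "i \<le> 2 * N + 1" using assms N by auto
  note sm = \<open>spherical_monogenic k M\<close>
  let ?h = "\<i> * cnj ec * (-1) ^ ((m + 1) div 2)"
  \<comment> \<open>Apart from the sign (-1)^i in \<open>f_hat\<close> only the parity of i + k
    matters, so \<open>same\<close> and \<open>diff\<close> cover all four cases.\<close>
  have same: "fourier_plus i ec (psi_even p k M) = fun_scal (?h * (-1) ^ i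
       * of_real (dfact (int k + int i - 1) / dfact (int k + int m - int i - 3)) * (-1) ^ p) (psi_even p k M)"
    "fourier_plus i ec (psi_odd p k M) = fun_scal (ec
       * of_real (dfact (int k + int i - 1) / dfact (int k + int m - int i - 3)) * (-1) ^ p) (psi_odd p k M)"
    if par: "even (i + k)"
  proof -
    obtain \<kappa> where \<kappa>: "i + k = 2 * \<kappa>" using par by (rule evenE)
    \<comment> \<open>The subtraction is exact: 2(N + \<kappa> - i) = 2N + k - i, and in the extreme
      case i = 2N + 1 the number k is odd, hence positive.\<close>
    define \<mu> where "\<mu> = N + \<kappa> - i"
    have \<mu>: "N + \<kappa> = i + \<mu>" "Suc N + \<kappa> = i + Suc \<mu>" using i \<kappa> unfolding \<mu>_def by presburger+
    have e: "2 * int \<kappa> - 1 = int k + int i - 1" "2 * int \<mu> = int k + int m - int i - 3"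
      using \<kappa> \<mu>(1) N by presburger+
    show "fourier_plus i ec (psi_even p k M) = fun_scal (?h * (-1) ^ i
       * of_real (dfact (int k + int i - 1) / dfact (int k + int m - int i - 3)) * (-1) ^ p) (psi_even p k M)"
      using fourier_even_same[OF m i sm \<kappa> \<mu>(1), of ec p] unfolding e assms(1)[symmetric] power_add mult.assoc .
    show "fourier_plus i ec (psi_odd p k M) = fun_scal (ec
       * of_real (dfact (int k + int i - 1) / dfact (int k + int m - int i - 3)) * (-1) ^ p) (psi_odd p k M)"
      using fourier_odd_same[OF m i sm \<kappa> \<mu>(2), of ec p] unfolding e .
  qed
  have diff: "fourier_plus i ec (psi_even p k M) = fun_scal (- ec
       * of_real (dfact (int k + int i) / dfact (int k + int m - int i - 2)) * (-1) ^ p) (psi_even p k M)"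
    "fourier_plus i ec (psi_odd p k M) = fun_scal (?h * (-1) ^ i
       * of_real (dfact (int k + int i) / dfact (int k + int m - int i - 2)) * (-1) ^ p) (psi_odd p k M)"
    if par: "odd (i + k)"
  proof -
    obtain n where "i + k = 2 * n + 1" using par by (rule oddE)
    define \<kappa> where "\<kappa> = Suc n"
    have \<kappa>: "Suc i + k = 2 * \<kappa>" "i + Suc k = 2 * \<kappa>" using \<open>i + k = 2 * n + 1\<close> by (simp_all add: \<kappa>_def)
    define \<mu> where "\<mu> = N + \<kappa> - i"
    have \<mu>: "Suc N + \<kappa> = Suc i + \<mu>" "N + \<kappa> = i + \<mu>" using i \<kappa> unfolding \<mu>_def by presburger+
    have e: "2 * int \<kappa> - 1 = int k + int i" "2 * int \<mu> = int k + int m - int i - 2"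
      using \<kappa> \<mu>(2) N by presburger+
    show "fourier_plus i ec (psi_even p k M) = fun_scal (- ec
       * of_real (dfact (int k + int i) / dfact (int k + int m - int i - 2)) * (-1) ^ p) (psi_even p k M)"
      using fourier_even_diff[OF m i sm \<kappa>(1) \<mu>(1), of ec p] unfolding e .
    show "fourier_plus i ec (psi_odd p k M) = fun_scal (?h * (-1) ^ i
       * of_real (dfact (int k + int i) / dfact (int k + int m - int i - 2)) * (-1) ^ p) (psi_odd p k M)"
      using fourier_odd_diff[OF m i sm \<kappa>(2) \<mu>(2), of ec p] unfolding e assms(1)[symmetric] power_add mult.assoc .
  qed
  have arith: "int k - int i + int m - 3 = int k + int m - int i - 3" "int k - int i + int m - 2 = int k + int m - int i - 2"
    "int k - 1 + int i = int k + int i - 1" by simp_all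
  \<comment> \<open>The parity of i now settles the remaining (-1)^i, and the minus sign of the
    \<open>ec\<close> term in \<open>diff\<close> becomes the exponent p + 1.\<close>
  show ?thesis unfolding arith
    by (intro conjI impI; elim conjE) (simp_all add: same diff)
qed

end
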